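(* (1) The category $\mathsf{AlgFrm_{FInf}}$ is equivalent to $\mathsf{DMS_{FSup}}$ and dually equivalent to $\mathsf{PGPS_S}$. (2) The category $\mathsf{AlgFrm_{FInfB}}$ is equivalent to $\mathsf{DMS_{FSupB}}$ and dually equivalent to $\mathsf{PGPS_{ST}}$.
   Context: Frames. $\mathsf K(L)$ is the set of compact elements of a complete lattice $L$. An algebraic frame is a frame in which every element is a join of compact elements; a frame is compact if its top element is compact. $\mathsf{AlgFrm_{FInf}}$: algebraic frames and maps $\alpha\colon L_1\to L_2$ preserving arbitrary joins and compact elements such that whenever $\varnothing\ne S\subseteq\mathsf K(L_1)$ is finite and $\bigwedge S\in\mathsf K(L_1)$, then $\alpha(\bigwedge S)=\bigwedge\alpha[S]$. $\mathsf{AlgFrm_{FInfB}}$: same objects, those $\mathsf{AlgFrm_{FInf}}$-morphisms $\alpha\colon L_1\to L_2$ that are bounded, meaning that whenever $L_1$ and $L_2$ are compact, then $\alpha(1)=1$. Semilattices. A meet-semilattice is a poset with all finite meets, including the empty one (top $1$); it is bounded if it has a bottom $0$. It is distributive if $a\wedge b\le c$ implies there are $a'\ge a$, $b'\ge b$ with $a'\wedge b'=c$. $\mathsf{DMS_{FSup}}$: distributive meet-semilattices and maps preserving all finite meets (including $1$) and all existing nonempty finite suprema. $\mathsf{DMS_{FSupB}}$: same objects, those $\mathsf{DMS_{FSup}}$-morphisms $\alpha\colon M_1\to M_2$ that are bounded, meaning that whenever $M_1$ and $M_2$ are bounded, then $\alpha(0)=0$. Spaces. A Priestley space is a compact space with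 a partial order such that $x\not\le y$ implies there is a clopen upset containing $x$ and missing $y$. Given a subset $X_0$, a clopen upset $U$ is admissible if the maximal points of $X\setminus U$ lie in $X_0$; $\mathcal A(X)$ is the set of admissible clopen upsets and $\mathcal I_x=\{U\in\mathcal A(X)\mid x\notin U\}$. A pointed generalized Priestley space is a tuple $(X,\tau,\le,X_0,m)$ such that: $(X,\tau,\le)$ is a Priestley space; $m$ is the unique maximum of $X$; $X_0$ is a dense subset of $X\setminus\{m\}$; for each $x\ne m$ there is $y\in X_0$ with $x\le y$; $x\in X_0$ iff $\mathcal I_x$ is nonempty and directed under inclusion; $x\le y$ iff for all $U\in\mathcal A(X)$, $x\in U$ implies $y\in U$. A strong Priestley morphism is an order-preserving map $f\colon X\to Y$ such that $U\in\mathcal A(Y)$ implies $f^{-1}(U)\in\mathcal A(X)$. $\mathsf{PGPS_S}$: pointed generalized Priestley spaces and strong Priestley morphisms (usual composition of functions). $\mathsf{PGPS_{ST}}$: same objects, those strong Priestley morphisms $f\colon(X,m)\to(Y,n)$ that additionally satisfy $f[X\setminus\{m\}]\subseteq Y\setminus\{n\}$ provided $m$ and $n$ are isolated points (of $X$ and $Y$ respectively).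
   Formalization: In (2) the bounded morphisms are not closed under composition (2→ω+1→2, second map 0), so these are not categories; equivalence is proved with the same hom-sets, without asserting closure. Structures are those small relative to an arbitrary universe. *)

theory Defs
  imports
    "HOL-Analysis.Abstract_Topology"
    "HOL-Algebra.Complete_Lattice"
    "HOL-Library.Equipollence"
    "HOL-Library.FuncSet"
begin

section \<open>Categories and equivalences\<close>

text \<open>
  Hom-sets are indexed by source and target and need not be disjoint, so composition and the action
  of a functor on morphisms receive the objects as arguments: \<open>Comp C X Y Z g f\<close> is the composite of
  \<open>f : X \<rightarrow> Y\<close> and \<open>g : Y \<rightarrow> Z\<close>.
\<close>

record ('o, 'm) cat =
  Obj :: "'o set"
  Hom :: "'o \<Rightarrow> 'o \<Rightarrow> 'm set"
  Id :: "'o \<Rightarrow> 'm"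
  Comp :: "'o \<Rightarrow> 'o \<Rightarrow> 'o \<Rightarrow> 'm \<Rightarrow> 'm \<Rightarrow> 'm"

text \<open>The axioms of a category other than closure of the hom-sets under composition.\<close>

definition precategory :: "('o, 'm) cat \<Rightarrow> bool" where
  "precategory C \<longleftrightarrow>
     (\<forall>X\<in>Obj C. Id C X \<in> Hom C X X) \<and>
     (\<forall>X\<in>Obj C. \<forall>Y\<in>Obj C. \<forall>f\<in>Hom C X Y.
        Comp C X X Y f (Id C X) = f \<and> Comp C X Y Y (Id C Y) f = f) \<and>
     (\<forall>W\<in>Obj C. \<forall>X\<in>Obj C. \<forall>Y\<in>Obj C. \<forall>Z\<in>Obj C.
        \<forall>f\<in>Hom C W X. \<forall>g\<in>Hom C X Y. \<forall>h\<in>Hom C Y Z.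
          Comp C W Y Z h (Comp C W X Y g f) = Comp C W X Z (Comp C X Y Z h g) f)"

definition category :: "('o, 'm) cat \<Rightarrow> bool" where
  "category C \<longleftrightarrow> precategory C \<and>
     (\<forall>X\<in>Obj C. \<forall>Y\<in>Obj C. \<forall>Z\<in>Obj C. \<forall>f\<in>Hom C X Y. \<forall>g\<in>Hom C Y Z.
        Comp C X Y Z g f \<in> Hom C X Z)"

definition op_cat :: "('o, 'm) cat \<Rightarrow> ('o, 'm) cat" where
  "op_cat C = \<lparr> Obj = Obj C, Hom = (\<lambda>X Y. Hom C Y X), Id = Id C,
                Comp = (\<lambda>X Y Z g f. Comp C Z Y X f g) \<rparr>"

definition is_functor ::
  "('o, 'm) cat \<Rightarrow> ('p, 'n) cat \<Rightarrow> ('o \<Rightarrow> 'p) \<Rightarrow> ('o \<Rightarrow> 'o \<Rightarrow> 'm \<Rightarrow> 'n) \<Rightarrow> bool" where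
  "is_functor C D Fo Fm \<longleftrightarrow>
     (\<forall>X\<in>Obj C. Fo X \<in> Obj D) \<and>
     (\<forall>X\<in>Obj C. \<forall>Y\<in>Obj C. \<forall>f\<in>Hom C X Y. Fm X Y f \<in> Hom D (Fo X) (Fo Y)) \<and>
     (\<forall>X\<in>Obj C. Fm X X (Id C X) = Id D (Fo X)) \<and>
     (\<forall>X\<in>Obj C. \<forall>Y\<in>Obj C. \<forall>Z\<in>Obj C. \<forall>f\<in>Hom C X Y. \<forall>g\<in>Hom C Y Z.
        Fm X Z (Comp C X Y Z g f) = Comp D (Fo X) (Fo Y) (Fo Z) (Fm Y Z g) (Fm X Y f))"

definition iso_in :: "('o, 'm) cat \<Rightarrow> 'o \<Rightarrow> 'o \<Rightarrow> 'm \<Rightarrow> bool" where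
  "iso_in C X Y f \<longleftrightarrow> f \<in> Hom C X Y \<and>
     (\<exists>g\<in>Hom C Y X. Comp C X Y X g f = Id C X \<and> Comp C Y X Y f g = Id C Y)"

definition natural_iso ::
  "('o, 'm) cat \<Rightarrow> ('p, 'n) cat \<Rightarrow> ('o \<Rightarrow> 'p) \<Rightarrow> ('o \<Rightarrow> 'o \<Rightarrow> 'm \<Rightarrow> 'n)
     \<Rightarrow> ('o \<Rightarrow> 'p) \<Rightarrow> ('o \<Rightarrow> 'o \<Rightarrow> 'm \<Rightarrow> 'n) \<Rightarrow> ('o \<Rightarrow> 'n) \<Rightarrow> bool" where
  "natural_iso C D Fo Fm Go Gm \<eta> \<longleftrightarrow>
     (\<forall>X\<in>Obj C. iso_in D (Fo X) (Go X) (\<eta> X)) \<and>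
     (\<forall>X\<in>Obj C. \<forall>Y\<in>Obj C. \<forall>f\<in>Hom C X Y.
        Comp D (Fo X) (Fo Y) (Go Y) (\<eta> Y) (Fm X Y f) =
        Comp D (Fo X) (Go X) (Go Y) (Gm X Y f) (\<eta> X))"

definition equivalent :: "('o, 'm) cat \<Rightarrow> ('p, 'n) cat \<Rightarrow> bool" where
  "equivalent C D \<longleftrightarrow>
     (\<exists>Fo Fm Go Gm \<eta> \<epsilon>.
        is_functor C D Fo Fm \<and> is_functor D C Go Gm \<and>
        natural_iso C C (\<lambda>X. X) (\<lambda>X Y f. f)
          (\<lambda>X. Go (Fo X)) (\<lambda>X Y f. Gm (Fo X) (Fo Y) (Fm X Y f)) \<eta> \<and>
        natural_iso D D (\<lambda>X. Fo (Go X)) (\<lambda>X Y f. Fm (Go X) (Go Y) (Gm X Y f))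
          (\<lambda>X. X) (\<lambda>X Y f. f) \<epsilon>)"

definition dually_equivalent :: "('o, 'm) cat \<Rightarrow> ('p, 'n) cat \<Rightarrow> bool" where
  "dually_equivalent C D \<longleftrightarrow> equivalent (op_cat C) D"

text \<open>Sets with structure, and those extensional functions between them that belong to \<open>H\<close>.\<close>

definition concrete_cat ::
  "('o \<Rightarrow> 'u set) \<Rightarrow> 'o set \<Rightarrow> ('o \<Rightarrow> 'o \<Rightarrow> ('u \<Rightarrow> 'u) set) \<Rightarrow> ('o, 'u \<Rightarrow> 'u) cat" where
  "concrete_cat car Ob H =
     \<lparr> Obj = Ob, Hom = H, Id = (\<lambda>X. \<lambda>x\<in>car X. x),
       Comp = (\<lambda>X Y Z g f. compose (car X) g f) \<rparr>"

text \<open>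
  HOL has no type of all structures, so the objects of each category below are carried by
  subsets of an arbitrary type \<open>'u\<close>, which plays the role of a universe. The constructions relating
  frames, semilattices and spaces form sets of sets of compact elements (semilattice elements,
  admissible clopen upsets). The objects are therefore restricted to those for which this set has a
  power set no larger than \<open>'u\<close>. No structure is lost: a frame or semilattice on a type \<open>'a\<close>
  becomes such an object over \<open>'u = 'a set\<close> on renaming \<open>x\<close> to \<open>{x}\<close>, and a space on \<open>'a\<close> becomes one
  over \<open>'u = 'a set set\<close> on renaming \<open>x\<close> to \<open>{{x}}\<close>.
\<close>

definition small :: "'u itself \<Rightarrow> 'b set \<Rightarrow> bool" where
  "small _ A \<longleftrightarrow> Pow A \<lesssim> (UNIV :: 'u set)"


section \<open>Algebraic frames\<close>

definition compact_elements :: "'a gorder \<Rightarrow> 'a set" where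
  "compact_elements L =
     {k \<in> carrier L. \<forall>S\<subseteq>carrier L. k \<sqsubseteq>\<^bsub>L\<^esub> \<Squnion>\<^bsub>L\<^esub> S \<longrightarrow>
        (\<exists>T\<subseteq>S. finite T \<and> k \<sqsubseteq>\<^bsub>L\<^esub> \<Squnion>\<^bsub>L\<^esub> T)}"

definition frame :: "'a gorder \<Rightarrow> bool" where
  "frame L \<longleftrightarrow> complete_lattice L \<and>
     (\<forall>a\<in>carrier L. \<forall>S\<subseteq>carrier L. a \<sqinter>\<^bsub>L\<^esub> \<Squnion>\<^bsub>L\<^esub> S = \<Squnion>\<^bsub>L\<^esub> ((\<lambda>s. a \<sqinter>\<^bsub>L\<^esub> s) ` S))"

definition algebraic_frame :: "'a gorder \<Rightarrow> bool" where
  "algebraic_frame L \<longleftrightarrow> frame L \<and>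
     (\<forall>a\<in>carrier L. \<exists>S\<subseteq>compact_elements L. a = \<Squnion>\<^bsub>L\<^esub> S)"

definition compact_frame :: "'a gorder \<Rightarrow> bool" where
  "compact_frame L \<longleftrightarrow> frame L \<and> \<top>\<^bsub>L\<^esub> \<in> compact_elements L"

definition FInf_hom :: "'a gorder \<Rightarrow> 'b gorder \<Rightarrow> ('a \<Rightarrow> 'b) set" where
  "FInf_hom L1 L2 = {\<alpha> \<in> carrier L1 \<rightarrow>\<^sub>E carrier L2.
     (\<forall>S\<subseteq>carrier L1. \<alpha> (\<Squnion>\<^bsub>L1\<^esub> S) = \<Squnion>\<^bsub>L2\<^esub> (\<alpha> ` S)) \<and>
     \<alpha> ` compact_elements L1 \<subseteq> compact_elements L2 \<and>
     (\<forall>S\<subseteq>compact_elements L1.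
        S \<noteq> {} \<and> finite S \<and> \<Sqinter>\<^bsub>L1\<^esub> S \<in> compact_elements L1 \<longrightarrow>
        \<alpha> (\<Sqinter>\<^bsub>L1\<^esub> S) = \<Sqinter>\<^bsub>L2\<^esub> (\<alpha> ` S))}"

definition FInfB_hom :: "'a gorder \<Rightarrow> 'b gorder \<Rightarrow> ('a \<Rightarrow> 'b) set" where
  "FInfB_hom L1 L2 = {\<alpha> \<in> FInf_hom L1 L2.
     compact_frame L1 \<and> compact_frame L2 \<longrightarrow> \<alpha> \<top>\<^bsub>L1\<^esub> = \<top>\<^bsub>L2\<^esub>}"


section \<open>Distributive meet-semilattices\<close>

text \<open>The case \<open>F = {}\<close> provides the top element.\<close>

definition meet_semilattice :: "'a gorder \<Rightarrow> bool" where
  "meet_semilattice M \<longleftrightarrow> partial_order M \<and>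
     (\<forall>F\<subseteq>carrier M. finite F \<longrightarrow> (\<exists>i. is_glb M i F))"

definition bounded_semilattice :: "'a gorder \<Rightarrow> bool" where
  "bounded_semilattice M \<longleftrightarrow> meet_semilattice M \<and> (\<exists>z. least M z (carrier M))"

definition distributive_semilattice :: "'a gorder \<Rightarrow> bool" where
  "distributive_semilattice M \<longleftrightarrow> meet_semilattice M \<and>
     (\<forall>a\<in>carrier M. \<forall>b\<in>carrier M. \<forall>c\<in>carrier M. a \<sqinter>\<^bsub>M\<^esub> b \<sqsubseteq>\<^bsub>M\<^esub> c \<longrightarrow>
        (\<exists>a'\<in>carrier M. \<exists>b'\<in>carrier M. a \<sqsubseteq>\<^bsub>M\<^esub> a' \<and> b \<sqsubseteq>\<^bsub>M\<^esub> b' \<and> a' \<sqinter>\<^bsub>M\<^esub> b' = c))"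

definition FSup_hom :: "'a gorder \<Rightarrow> 'b gorder \<Rightarrow> ('a \<Rightarrow> 'b) set" where
  "FSup_hom M1 M2 = {\<alpha> \<in> carrier M1 \<rightarrow>\<^sub>E carrier M2.
     (\<forall>F\<subseteq>carrier M1. finite F \<longrightarrow> \<alpha> (\<Sqinter>\<^bsub>M1\<^esub> F) = \<Sqinter>\<^bsub>M2\<^esub> (\<alpha> ` F)) \<and>
     (\<forall>F\<subseteq>carrier M1. \<forall>s. finite F \<and> F \<noteq> {} \<and> is_lub M1 s F \<longrightarrow> is_lub M2 (\<alpha> s) (\<alpha> ` F))}"

definition FSupB_hom :: "'a gorder \<Rightarrow> 'b gorder \<Rightarrow> ('a \<Rightarrow> 'b) set" where
  "FSupB_hom M1 M2 = {\<alpha> \<in> FSup_hom M1 M2.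
     bounded_semilattice M1 \<and> bounded_semilattice M2 \<longrightarrow> \<alpha> \<bottom>\<^bsub>M1\<^esub> = \<bottom>\<^bsub>M2\<^esub>}"


section \<open>Pointed generalized Priestley spaces\<close>

record 'a pspace =
  topo :: "'a topology"
  ordr :: "'a gorder"
  base :: "'a set"
  pt :: 'a

abbreviation points :: "'a pspace \<Rightarrow> 'a set" where
  "points X \<equiv> topspace (topo X)"

definition clopen_upset :: "'a pspace \<Rightarrow> 'a set \<Rightarrow> bool" where
  "clopen_upset X U \<longleftrightarrow> openin (topo X) U \<and> closedin (topo X) U \<and>
     (\<forall>x\<in>U. \<forall>y\<in>points X. x \<sqsubseteq>\<^bsub>ordr X\<^esub> y \<longrightarrow> y \<in> U)"

definition priestley_space :: "'a pspace \<Rightarrow> bool" where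
  "priestley_space X \<longleftrightarrow>
     compact_space (topo X) \<and> partial_order (ordr X) \<and> carrier (ordr X) = points X \<and>
     (\<forall>x\<in>points X. \<forall>y\<in>points X. \<not> x \<sqsubseteq>\<^bsub>ordr X\<^esub> y \<longrightarrow>
        (\<exists>U. clopen_upset X U \<and> x \<in> U \<and> y \<notin> U))"

definition maximal_points :: "'a gorder \<Rightarrow> 'a set \<Rightarrow> 'a set" where
  "maximal_points P S = {x \<in> S. \<forall>y\<in>S. x \<sqsubseteq>\<^bsub>P\<^esub> y \<longrightarrow> y = x}"

definition admissible :: "'a pspace \<Rightarrow> 'a set set" where
  "admissible X = {U. clopen_upset X U \<and> maximal_points (ordr X) (points X - U) \<subseteq> base X}"

definition admissible_avoiding :: "'a pspace \<Rightarrow> 'a \<Rightarrow> 'a set set" where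
  "admissible_avoiding X x = {U \<in> admissible X. x \<notin> U}"

definition directed_by_inclusion :: "'a set set \<Rightarrow> bool" where
  "directed_by_inclusion \<U> \<longleftrightarrow> (\<forall>U\<in>\<U>. \<forall>V\<in>\<U>. \<exists>W\<in>\<U>. U \<subseteq> W \<and> V \<subseteq> W)"

definition pgps :: "'a pspace \<Rightarrow> bool" where
  "pgps X \<longleftrightarrow>
     priestley_space X \<and>
     greatest (ordr X) (pt X) (points X) \<and>
     base X \<subseteq> points X - {pt X} \<and>
     subtopology (topo X) (points X - {pt X}) closure_of base X = points X - {pt X} \<and>
     (\<forall>x\<in>points X. x \<noteq> pt X \<longrightarrow> (\<exists>y\<in>base X. x \<sqsubseteq>\<^bsub>ordr X\<^esub> y)) \<and>
     (\<forall>x\<in>points X. x \<in> base X \<longleftrightarrow>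
        admissible_avoiding X x \<noteq> {} \<and> directed_by_inclusion (admissible_avoiding X x)) \<and>
     (\<forall>x\<in>points X. \<forall>y\<in>points X.
        x \<sqsubseteq>\<^bsub>ordr X\<^esub> y \<longleftrightarrow> (\<forall>U\<in>admissible X. x \<in> U \<longrightarrow> y \<in> U))"

definition strong_hom :: "'a pspace \<Rightarrow> 'b pspace \<Rightarrow> ('a \<Rightarrow> 'b) set" where
  "strong_hom X Y = {f \<in> points X \<rightarrow>\<^sub>E points Y.
     (\<forall>x\<in>points X. \<forall>y\<in>points X. x \<sqsubseteq>\<^bsub>ordr X\<^esub> y \<longrightarrow> f x \<sqsubseteq>\<^bsub>ordr Y\<^esub> f y) \<and>
     (\<forall>U\<in>admissible Y. f -` U \<inter> points X \<in> admissible X)}"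

definition strong_top_hom :: "'a pspace \<Rightarrow> 'b pspace \<Rightarrow> ('a \<Rightarrow> 'b) set" where
  "strong_top_hom X Y = {f \<in> strong_hom X Y.
     openin (topo X) {pt X} \<and> openin (topo Y) {pt Y} \<longrightarrow>
     f ` (points X - {pt X}) \<subseteq> points Y - {pt Y}}"


section \<open>The categories\<close>

text \<open>
  \<open>AlgFrm_FInfB\<close>, \<open>DMS_FSupB\<close> and \<open>PGPS_ST\<close> satisfy \<^const>\<open>precategory\<close>, but over a large enough
  type \<open>'u\<close> they fail \<^const>\<open>category\<close>: the extra condition on a map is vacuous unless both source
  and target are compact (bounded, have isolated maximum), and so is not inherited by composites
  through an intermediate object that is not. For frames, consider \<open>2 \<rightarrow> \<omega>+1 \<rightarrow> 2\<close>, the first map sending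
  \<open>1\<close> to \<open>1\<close> and the second being constantly \<open>0\<close>: both are bounded, as \<open>\<omega>+1\<close> is not compact, but the
  composite sends \<open>1\<close> to \<open>0\<close>. The notions of functor and equivalence above do not refer to closure
  under composition and, for categories, are the standard ones.
\<close>

type_synonym 'u order_cat = "('u gorder, 'u \<Rightarrow> 'u) cat"
type_synonym 'u space_cat = "('u pspace, 'u \<Rightarrow> 'u) cat"

definition AlgFrm_FInf :: "'u order_cat" where
  "AlgFrm_FInf = concrete_cat carrier
     {L. algebraic_frame L \<and> small TYPE('u) (compact_elements L)} FInf_hom"

definition AlgFrm_FInfB :: "'u order_cat" where
  "AlgFrm_FInfB = concrete_cat carrier
     {L. algebraic_frame L \<and> small TYPE('u) (compact_elements L)} FInfB_hom"

definition DMS_FSup :: "'u order_cat" where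
  "DMS_FSup = concrete_cat carrier
     {M. distributive_semilattice M \<and> small TYPE('u) (carrier M)} FSup_hom"

definition DMS_FSupB :: "'u order_cat" where
  "DMS_FSupB = concrete_cat carrier
     {M. distributive_semilattice M \<and> small TYPE('u) (carrier M)} FSupB_hom"

definition PGPS_S :: "'u space_cat" where
  "PGPS_S = concrete_cat points {X. pgps X \<and> small TYPE('u) (admissible X)} strong_hom"

definition PGPS_ST :: "'u space_cat" where
  "PGPS_ST = concrete_cat points {X. pgps X \<and> small TYPE('u) (admissible X)} strong_top_hom"

end

theory Submission
  imports Defs "HOL-Analysis.Function_Topology"
begin

text \<open>
  Distributive meet-semilattices are the common ground: frames and spaces are both compared with them,
  and frames are compared with spaces through them.

  From an algebraic frame \<open>L\<close> one passes to its compact elements with the order reversed. The frame law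
  makes this semilattice distributive (\<open>compact_splits\<close>). A join-preserving map is determined by its values
  on compact elements, and a semilattice map between them extends by joins (\<open>FInf_hom_extend\<close>).
  An infimum formed among the compact elements is also an infimum in \<open>L\<close>, so the condition on
  infima in \<open>FInf_hom\<close> says that existing nonempty finite suprema of the reversed order are preserved. Every distributive
  semilattice \<open>M\<close> arises in this way, from the frame of its filters, whose compact elements are the
  principal filters.

  From a space \<open>X\<close> one passes to its admissible sets under inclusion. Density of \<open>base X\<close> and directedness
  of the admissible sets avoiding one of its points imply that existing nonempty finite suprema of
  admissible sets are unions (\<open>admissible_covered\<close>), hence preserved by preimages. Directedness and
  compactness make the semilattice distributive (\<open>admissible_distributive\<close>). Compactness also yields a
  point for every family of admissible sets that looks like the set of admissible neighbourhoods of a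
  point (\<open>point_of_filter\<close>), and so turns each semilattice map into the preimage operation of a unique
  strong morphism. Every distributive
  semilattice \<open>M\<close> arises in this way, from the space of its optimal filters, with the prime filters as
  \<open>base\<close> and \<open>M\<close> itself as the maximum. This rests on the prime filter theorem
  (\<open>prime_filter_extension\<close>) and on the computation of the admissible sets of that space (\<open>admissible_space\<close>).

  Thus both passages are fully faithful and essentially surjective, and a formal argument
  (\<open>equivalent_of_cospan\<close>) yields the equivalences. For the bounded maps note that a frame is compact iff
  its semilattice has a least element, and that the maximum of a space is isolated iff its semilattice
  has a least element. The extra conditions then match. Bounded maps need not be closed under composition, but
  they include all isomorphisms and remain bounded after composition with isomorphisms, and the formal
  argument needs no more.
\<close>

section \<open>Equivalences from fully faithful functors\<close>

lemma category_id: "category C \<Longrightarrow> X \<in> Obj C \<Longrightarrow> Id C X \<in> Hom C X X"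
  by (simp add: category_def precategory_def)

lemma category_comp:
  "\<lbrakk>category C; X \<in> Obj C; Y \<in> Obj C; Z \<in> Obj C; f \<in> Hom C X Y; g \<in> Hom C Y Z\<rbrakk>
    \<Longrightarrow> Comp C X Y Z g f \<in> Hom C X Z"
  by (simp add: category_def)

lemma category_unit:
  assumes "category C" "X \<in> Obj C" "Y \<in> Obj C" "f \<in> Hom C X Y"
  shows "Comp C X X Y f (Id C X) = f" "Comp C X Y Y (Id C Y) f = f"
  using assms by (simp_all add: category_def precategory_def)

lemma category_assoc:
  assumes "category C" "W \<in> Obj C" "X \<in> Obj C" "Y \<in> Obj C" "Z \<in> Obj C"
    "f \<in> Hom C W X" "g \<in> Hom C X Y" "h \<in> Hom C Y Z"
  shows "Comp C W Y Z h (Comp C W X Y g f) = Comp C W X Z (Comp C X Y Z h g) f"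
  using assms by (simp add: category_def precategory_def)

lemma category_op: "category C \<Longrightarrow> category (op_cat C)"
  by (simp add: category_def precategory_def op_cat_def)

lemma iso_in_op:
  "iso_in (op_cat C) X Y f \<longleftrightarrow> iso_in C Y X f"
  by (auto simp: iso_in_def op_cat_def)

lemma iso_in_sym:
  assumes "iso_in C X Y f"
  obtains g where "iso_in C Y X g" "Comp C X Y X g f = Id C X" "Comp C Y X Y f g = Id C Y"
  using assms by (auto simp: iso_in_def)

lemma iso_in_hom: "iso_in C X Y f \<Longrightarrow> f \<in> Hom C X Y"
  by (simp add: iso_in_def)

lemma iso_in_comp:
  assumes C: "category C" and Ob: "X \<in> Obj C" "Y \<in> Obj C" "Z \<in> Obj C"
    and f: "iso_in C X Y f" and g: "iso_in C Y Z g"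
  shows "iso_in C X Z (Comp C X Y Z g f)"
proof -
  obtain f' where f': "f' \<in> Hom C Y X" "Comp C X Y X f' f = Id C X" "Comp C Y X Y f f' = Id C Y"
    using f by (auto simp: iso_in_def)
  obtain g' where g': "g' \<in> Hom C Z Y" "Comp C Y Z Y g' g = Id C Y" "Comp C Z Y Z g g' = Id C Z"
    using g by (auto simp: iso_in_def)
  note h = iso_in_hom[OF f] iso_in_hom[OF g]
  have "Comp C X Z X (Comp C Z Y X f' g') (Comp C X Y Z g f) = Id C X"
    using category_assoc[OF C Ob(1,3,2,1) category_comp[OF C Ob h] g'(1) f'(1)]
      category_assoc[OF C Ob(1,2,3,2) h g'(1)] category_unit[OF C Ob(1,2) h(1)] f'(2) g'(2)
    by simp
  moreover have "Comp C Z X Z (Comp C X Y Z g f) (Comp C Z Y X f' g') = Id C Z"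
    using category_assoc[OF C Ob(3,1,2,3) category_comp[OF C Ob(3,2,1) g'(1) f'(1)] h]
      category_assoc[OF C Ob(3,2,1,2) g'(1) f'(1) h(1)] category_unit[OF C Ob(3,2) g'(1)] f'(3) g'(3)
    by simp
  ultimately show ?thesis
    using category_comp[OF C Ob h] category_comp[OF C Ob(3,2,1) g'(1) f'(1)]
    by (auto simp: iso_in_def)
qed

definition fully_faithful ::
  "('o, 'm) cat \<Rightarrow> ('p, 'n) cat \<Rightarrow> ('o \<Rightarrow> 'p) \<Rightarrow> ('o \<Rightarrow> 'o \<Rightarrow> 'm \<Rightarrow> 'n) \<Rightarrow> bool" where
  "fully_faithful C D Fo Fm \<longleftrightarrow> is_functor C D Fo Fm \<and>
     (\<forall>X\<in>Obj C. \<forall>Y\<in>Obj C. bij_betw (Fm X Y) (Hom C X Y) (Hom D (Fo X) (Fo Y)))"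

lemma fully_faithful_op:
  "fully_faithful C D Fo Fm \<Longrightarrow> fully_faithful (op_cat C) (op_cat D) Fo (\<lambda>X Y. Fm Y X)"
  by (simp add: fully_faithful_def is_functor_def op_cat_def)

lemma fully_faithful_id: "category C \<Longrightarrow> fully_faithful C C (\<lambda>X. X) (\<lambda>X Y f. f)"
  by (simp add: fully_faithful_def is_functor_def bij_betw_def)

lemma functor_id: "is_functor C D Fo Fm \<Longrightarrow> X \<in> Obj C \<Longrightarrow> Fm X X (Id C X) = Id D (Fo X)"
  and functor_obj: "is_functor C D Fo Fm \<Longrightarrow> X \<in> Obj C \<Longrightarrow> Fo X \<in> Obj D"
  and functor_hom: "is_functor C D Fo Fm \<Longrightarrow> X \<in> Obj C \<Longrightarrow> Y \<in> Obj C \<Longrightarrow> f \<in> Hom C X Y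
    \<Longrightarrow> Fm X Y f \<in> Hom D (Fo X) (Fo Y)"
  and functor_comp: "is_functor C D Fo Fm \<Longrightarrow> X \<in> Obj C \<Longrightarrow> Y \<in> Obj C \<Longrightarrow> Z \<in> Obj C
    \<Longrightarrow> f \<in> Hom C X Y \<Longrightarrow> g \<in> Hom C Y Z
    \<Longrightarrow> Fm X Z (Comp C X Y Z g f) = Comp D (Fo X) (Fo Y) (Fo Z) (Fm Y Z g) (Fm X Y f)"
  by (simp_all add: is_functor_def)

lemma fully_faithful_eqD:
  assumes "fully_faithful C D Fo Fm" "X \<in> Obj C" "Y \<in> Obj C" "f \<in> Hom C X Y" "g \<in> Hom C X Y"
    "Fm X Y f = Fm X Y g"
  shows "f = g"
  using assms unfolding fully_faithful_def bij_betw_def by (meson inj_onD)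

lemma fully_faithful_lift:
  assumes "fully_faithful C D Fo Fm" "X \<in> Obj C" "Y \<in> Obj C" "g \<in> Hom D (Fo X) (Fo Y)"
  obtains f where "f \<in> Hom C X Y" "Fm X Y f = g"
  using assms unfolding fully_faithful_def bij_betw_def by (metis imageE)

lemma functor_iso:
  assumes F: "is_functor C D Fo Fm" and Ob: "X \<in> Obj C" "Y \<in> Obj C" and f: "iso_in C X Y f"
  shows "iso_in D (Fo X) (Fo Y) (Fm X Y f)"
proof -
  obtain g where g: "g \<in> Hom C Y X" "Comp C X Y X g f = Id C X" "Comp C Y X Y f g = Id C Y"
    using f by (auto simp: iso_in_def)
  note f = iso_in_hom[OF f]
  show ?thesis
    using functor_comp[OF F Ob(1,2,1) f g(1)] functor_comp[OF F Ob(2,1,2) g(1) f]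
      functor_id[OF F Ob(1)] functor_id[OF F Ob(2)] g functor_hom[OF F Ob f]
      functor_hom[OF F Ob(2,1) g(1)]
    by (auto simp: iso_in_def)
qed

lemma fully_faithful_reflects_iso:
  assumes C: "category C" and ff: "fully_faithful C D Fo Fm" and Ob: "X \<in> Obj C" "Y \<in> Obj C"
    and f: "f \<in> Hom C X Y" and iso: "iso_in D (Fo X) (Fo Y) (Fm X Y f)"
  shows "iso_in C X Y f"
proof -
  have F: "is_functor C D Fo Fm" using ff by (simp add: fully_faithful_def)
  obtain g' where g': "g' \<in> Hom D (Fo Y) (Fo X)"
    "Comp D (Fo X) (Fo Y) (Fo X) g' (Fm X Y f) = Id D (Fo X)"
    "Comp D (Fo Y) (Fo X) (Fo Y) (Fm X Y f) g' = Id D (Fo Y)"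
    using iso by (auto simp: iso_in_def)
  obtain g where g: "g \<in> Hom C Y X" "Fm Y X g = g'"
    using fully_faithful_lift[OF ff Ob(2,1) g'(1)] .
  have "Comp C X Y X g f = Id C X"
    using fully_faithful_eqD[OF ff Ob(1,1) category_comp[OF C Ob(1,2,1) f g(1)] category_id[OF C Ob(1)]]
      functor_comp[OF F Ob(1,2,1) f g(1)] functor_id[OF F Ob(1)] g g' by simp
  moreover have "Comp C Y X Y f g = Id C Y"
    using fully_faithful_eqD[OF ff Ob(2,2) category_comp[OF C Ob(2,1,2) g(1) f] category_id[OF C Ob(2)]]
      functor_comp[OF F Ob(2,1,2) g(1) f] functor_id[OF F Ob(2)] g g' by simp
  ultimately show ?thesis using f g(1) by (auto simp: iso_in_def)
qed

text \<open>
  Families of morphisms such as the bounded maps need not be closed under composition. Moving a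
  morphism along isomorphisms of its source and target composes it with isomorphisms only, so this
  is the amount of closure that equivalences between such families require.
\<close>

definition iso_stable :: "('o, 'm) cat \<Rightarrow> ('o \<Rightarrow> 'o \<Rightarrow> 'm set) \<Rightarrow> bool" where
  "iso_stable D K \<longleftrightarrow>
     (\<forall>X\<in>Obj D. \<forall>Y\<in>Obj D. \<forall>e. iso_in D X Y e \<longrightarrow> e \<in> K X Y) \<and>
     (\<forall>X\<in>Obj D. \<forall>Y\<in>Obj D. \<forall>Z\<in>Obj D. \<forall>f e. f \<in> K X Y \<and> iso_in D Y Z e \<longrightarrow>
        Comp D X Y Z e f \<in> K X Z) \<and>
     (\<forall>X\<in>Obj D. \<forall>Y\<in>Obj D. \<forall>Z\<in>Obj D. \<forall>f e. iso_in D X Y e \<and> f \<in> K Y Z \<longrightarrow>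
        Comp D X Y Z f e \<in> K X Z)"

lemma iso_stable_Hom: "category D \<Longrightarrow> iso_stable D (Hom D)"
  by (auto simp: iso_stable_def intro: category_comp iso_in_hom)

lemma iso_stable_op: "iso_stable D K \<Longrightarrow> iso_stable (op_cat D) (\<lambda>X Y. K Y X)"
  unfolding iso_stable_def iso_in_op by (simp add: op_cat_def)

text \<open>
  For each \<open>X\<close> choose an object \<open>G X\<close> and an isomorphism \<open>\<epsilon> X : F X \<rightarrow> F' (G X)\<close>. Since \<open>F'\<close> is fully
  faithful, \<open>\<epsilon> Y \<circ> F f \<circ> inverse (\<epsilon> X)\<close> is the image of exactly one morphism, which is taken as \<open>G f\<close>; uniqueness
  makes \<open>G\<close> a functor and the choice makes \<open>\<epsilon>\<close> natural. As \<open>F' (G f)\<close> arises from \<open>F f\<close> by composition with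
  isomorphisms, it stays in every isomorphism-stable family.
\<close>

lemma lift_functor:
  assumes C: "category C" and C': "category C'" and D: "category D"
    and F: "is_functor C D Fo Fm" and ff': "fully_faithful C' D Fo' Fm'"
    and ess: "\<forall>X\<in>Obj C. \<exists>Y\<in>Obj C'. \<exists>e. iso_in D (Fo X) (Fo' Y) e"
  obtains Go Gm \<epsilon> where
    "is_functor C C' Go Gm"
    "\<forall>X\<in>Obj C. iso_in D (Fo X) (Fo' (Go X)) (\<epsilon> X)"
    "\<forall>X\<in>Obj C. \<forall>Y\<in>Obj C. \<forall>f\<in>Hom C X Y.
       Comp D (Fo X) (Fo Y) (Fo' (Go Y)) (\<epsilon> Y) (Fm X Y f) =
       Comp D (Fo X) (Fo' (Go X)) (Fo' (Go Y)) (Fm' (Go X) (Go Y) (Gm X Y f)) (\<epsilon> X)"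
    "\<And>K X Y f. \<lbrakk>iso_stable D K; X \<in> Obj C; Y \<in> Obj C; f \<in> Hom C X Y; Fm X Y f \<in> K (Fo X) (Fo Y)\<rbrakk>
       \<Longrightarrow> Fm' (Go X) (Go Y) (Gm X Y f) \<in> K (Fo' (Go X)) (Fo' (Go Y))"
proof -
  have F': "is_functor C' D Fo' Fm'" using ff' by (simp add: fully_faithful_def)
  obtain Go \<epsilon> where G: "\<And>X. X \<in> Obj C \<Longrightarrow> Go X \<in> Obj C'"
      "\<And>X. X \<in> Obj C \<Longrightarrow> iso_in D (Fo X) (Fo' (Go X)) (\<epsilon> X)"
    using ess by metis
  have "\<exists>d. iso_in D (Fo' (Go X)) (Fo X) d \<and> Comp D (Fo X) (Fo' (Go X)) (Fo X) d (\<epsilon> X) = Id D (Fo X)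
          \<and> Comp D (Fo' (Go X)) (Fo X) (Fo' (Go X)) (\<epsilon> X) d = Id D (Fo' (Go X))" if "X \<in> Obj C" for X
    using iso_in_sym[OF G(2)[OF that]] by metis
  then obtain \<delta> where \<delta>: "\<And>X. X \<in> Obj C \<Longrightarrow> iso_in D (Fo' (Go X)) (Fo X) (\<delta> X)"
      "\<And>X. X \<in> Obj C \<Longrightarrow> Comp D (Fo X) (Fo' (Go X)) (Fo X) (\<delta> X) (\<epsilon> X) = Id D (Fo X)"
      "\<And>X. X \<in> Obj C \<Longrightarrow> Comp D (Fo' (Go X)) (Fo X) (Fo' (Go X)) (\<epsilon> X) (\<delta> X) = Id D (Fo' (Go X))"
    by metis
  note obF = functor_obj[OF F] and obG = functor_obj[OF F' G(1)]
  note e = iso_in_hom[OF G(2)] and d = iso_in_hom[OF \<delta>(1)]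
  define c where "c X Y f = Comp D (Fo' (Go X)) (Fo X) (Fo' (Go Y))
      (Comp D (Fo X) (Fo Y) (Fo' (Go Y)) (\<epsilon> Y) (Fm X Y f)) (\<delta> X)" for X Y f
  have ef: "Comp D (Fo X) (Fo Y) (Fo' (Go Y)) (\<epsilon> Y) (Fm X Y f) \<in> Hom D (Fo X) (Fo' (Go Y))"
    if "X \<in> Obj C" "Y \<in> Obj C" "f \<in> Hom C X Y" for X Y f
    using category_comp[OF D obF[OF that(1)] obF[OF that(2)] obG[OF that(2)] functor_hom[OF F that]
        e[OF that(2)]] .
  have cH: "c X Y f \<in> Hom D (Fo' (Go X)) (Fo' (Go Y))"
    if "X \<in> Obj C" "Y \<in> Obj C" "f \<in> Hom C X Y" for X Y f
    unfolding c_def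
    using category_comp[OF D obG[OF that(1)] obF[OF that(1)] obG[OF that(2)] d[OF that(1)] ef[OF that]] .
  have ce: "Comp D (Fo X) (Fo' (Go X)) (Fo' (Go Y)) (c X Y f) (\<epsilon> X)
      = Comp D (Fo X) (Fo Y) (Fo' (Go Y)) (\<epsilon> Y) (Fm X Y f)"
    if "X \<in> Obj C" "Y \<in> Obj C" "f \<in> Hom C X Y" for X Y f
    unfolding c_def
    using category_assoc[OF D obF[OF that(1)] obG[OF that(1)] obF[OF that(1)] obG[OF that(2)]
        e[OF that(1)] d[OF that(1)] ef[OF that]]
      category_unit[OF D obF[OF that(1)] obG[OF that(2)] ef[OF that]] \<delta>(2)[OF that(1)]
    by simp
  \<comment> \<open>A morphism out of \<open>F' (G X)\<close> is determined by its composite with the isomorphism \<open>\<epsilon> X\<close>.\<close>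
  have can: "u = v" if "X \<in> Obj C" "A \<in> Obj D" "u \<in> Hom D (Fo' (Go X)) A" "v \<in> Hom D (Fo' (Go X)) A"
      "Comp D (Fo X) (Fo' (Go X)) A u (\<epsilon> X) = Comp D (Fo X) (Fo' (Go X)) A v (\<epsilon> X)" for X A u v
    using category_assoc[OF D obG[OF that(1)] obF[OF that(1)] obG[OF that(1)] that(2)
        d[OF that(1)] e[OF that(1)]]
      category_unit[OF D obG[OF that(1)] that(2)] that(3-5) \<delta>(3)[OF that(1)] by metis
  define Gm where "Gm X Y f = inv_into (Hom C' (Go X) (Go Y)) (Fm' (Go X) (Go Y)) (c X Y f)" for X Y f
  have Gm: "Gm X Y f \<in> Hom C' (Go X) (Go Y)" "Fm' (Go X) (Go Y) (Gm X Y f) = c X Y f"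
    if "X \<in> Obj C" "Y \<in> Obj C" "f \<in> Hom C X Y" for X Y f
  proof -
    have "c X Y f \<in> Fm' (Go X) (Go Y) ` Hom C' (Go X) (Go Y)"
      using ff' cH[OF that] G(1) that(1,2) by (auto simp: fully_faithful_def bij_betw_def)
    then show "Gm X Y f \<in> Hom C' (Go X) (Go Y)" "Fm' (Go X) (Go Y) (Gm X Y f) = c X Y f"
      unfolding Gm_def by (auto intro: inv_into_into f_inv_into_f)
  qed
  have "Gm X X (Id C X) = Id C' (Go X)" if X: "X \<in> Obj C" for X
  proof (rule fully_faithful_eqD[OF ff' G(1)[OF X] G(1)[OF X] Gm(1)[OF X X category_id[OF C X]]
        category_id[OF C' G(1)[OF X]]])
    show "Fm' (Go X) (Go X) (Gm X X (Id C X)) = Fm' (Go X) (Go X) (Id C' (Go X))"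
      using Gm(2)[OF X X category_id[OF C X]] functor_id[OF F' G(1)[OF X]] functor_id[OF F X]
        category_unit[OF D obF[OF X] obG[OF X] e[OF X]] \<delta>(3)[OF X] by (simp add: c_def)
  qed
  moreover have "Gm X Z (Comp C X Y Z g f) = Comp C' (Go X) (Go Y) (Go Z) (Gm Y Z g) (Gm X Y f)"
    if X: "X \<in> Obj C" and Y: "Y \<in> Obj C" and Z: "Z \<in> Obj C" and f: "f \<in> Hom C X Y"
      and g: "g \<in> Hom C Y Z" for X Y Z f g
  proof (rule fully_faithful_eqD[OF ff' G(1)[OF X] G(1)[OF Z]])
    note gf = category_comp[OF C X Y Z f g]
    show "Gm X Z (Comp C X Y Z g f) \<in> Hom C' (Go X) (Go Z)" using Gm(1)[OF X Z gf] .
    show "Comp C' (Go X) (Go Y) (Go Z) (Gm Y Z g) (Gm X Y f) \<in> Hom C' (Go X) (Go Z)"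
      using category_comp[OF C' G(1)[OF X] G(1)[OF Y] G(1)[OF Z] Gm(1)[OF X Y f] Gm(1)[OF Y Z g]] .
    have "c X Z (Comp C X Y Z g f) = Comp D (Fo' (Go X)) (Fo' (Go Y)) (Fo' (Go Z)) (c Y Z g) (c X Y f)"
    proof (rule can[OF X obG[OF Z] cH[OF X Z gf]])
      show "Comp D (Fo' (Go X)) (Fo' (Go Y)) (Fo' (Go Z)) (c Y Z g) (c X Y f)
          \<in> Hom D (Fo' (Go X)) (Fo' (Go Z))"
        using category_comp[OF D obG[OF X] obG[OF Y] obG[OF Z] cH[OF X Y f] cH[OF Y Z g]] .
      have "Comp D (Fo X) (Fo' (Go X)) (Fo' (Go Z))
              (Comp D (Fo' (Go X)) (Fo' (Go Y)) (Fo' (Go Z)) (c Y Z g) (c X Y f)) (\<epsilon> X)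
          = Comp D (Fo X) (Fo' (Go Y)) (Fo' (Go Z)) (c Y Z g)
              (Comp D (Fo X) (Fo Y) (Fo' (Go Y)) (\<epsilon> Y) (Fm X Y f))"
        using category_assoc[OF D obF[OF X] obG[OF X] obG[OF Y] obG[OF Z] e[OF X] cH[OF X Y f]
            cH[OF Y Z g]] ce[OF X Y f] by simp
      also have "\<dots> = Comp D (Fo X) (Fo Y) (Fo' (Go Z))
          (Comp D (Fo Y) (Fo Z) (Fo' (Go Z)) (\<epsilon> Z) (Fm Y Z g)) (Fm X Y f)"
        using category_assoc[OF D obF[OF X] obF[OF Y] obG[OF Y] obG[OF Z] functor_hom[OF F X Y f]
            e[OF Y] cH[OF Y Z g]] ce[OF Y Z g] by simp
      also have "\<dots> = Comp D (Fo X) (Fo Z) (Fo' (Go Z)) (\<epsilon> Z) (Fm X Z (Comp C X Y Z g f))"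
        using category_assoc[OF D obF[OF X] obF[OF Y] obF[OF Z] obG[OF Z] functor_hom[OF F X Y f]
            functor_hom[OF F Y Z g] e[OF Z]] functor_comp[OF F X Y Z f g] by simp
      finally show "Comp D (Fo X) (Fo' (Go X)) (Fo' (Go Z)) (c X Z (Comp C X Y Z g f)) (\<epsilon> X) =
          Comp D (Fo X) (Fo' (Go X)) (Fo' (Go Z))
            (Comp D (Fo' (Go X)) (Fo' (Go Y)) (Fo' (Go Z)) (c Y Z g) (c X Y f)) (\<epsilon> X)"
        using ce[OF X Z gf] by simp
    qed
    then show "Fm' (Go X) (Go Z) (Gm X Z (Comp C X Y Z g f)) =
        Fm' (Go X) (Go Z) (Comp C' (Go X) (Go Y) (Go Z) (Gm Y Z g) (Gm X Y f))"
      using Gm(2)[OF X Z gf] Gm(2)[OF X Y f] Gm(2)[OF Y Z g]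
        functor_comp[OF F' G(1)[OF X] G(1)[OF Y] G(1)[OF Z] Gm(1)[OF X Y f] Gm(1)[OF Y Z g]] by simp
  qed
  ultimately have 1: "is_functor C C' Go Gm" using G(1) Gm(1) by (simp add: is_functor_def)
  have 4: "Fm' (Go X) (Go Y) (Gm X Y f) \<in> K (Fo' (Go X)) (Fo' (Go Y))"
    if K: "iso_stable D K" and X: "X \<in> Obj C" and Y: "Y \<in> Obj C" and f: "f \<in> Hom C X Y"
      and "Fm X Y f \<in> K (Fo X) (Fo Y)" for K X Y f
    using that(5) K obF[OF X] obF[OF Y] obG[OF X] obG[OF Y] G(2)[OF Y] \<delta>(1)[OF X]
    unfolding Gm(2)[OF X Y f] c_def iso_stable_def by blast
  show ?thesis
  proof (rule that[of Go Gm \<epsilon>])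
    show "is_functor C C' Go Gm" by fact
    show "\<forall>X\<in>Obj C. iso_in D (Fo X) (Fo' (Go X)) (\<epsilon> X)" using G(2) by simp
    show "\<forall>X\<in>Obj C. \<forall>Y\<in>Obj C. \<forall>f\<in>Hom C X Y.
       Comp D (Fo X) (Fo Y) (Fo' (Go Y)) (\<epsilon> Y) (Fm X Y f) =
       Comp D (Fo X) (Fo' (Go X)) (Fo' (Go Y)) (Fm' (Go X) (Go Y) (Gm X Y f)) (\<epsilon> X)"
      using Gm(2) ce by simp
  qed (fact 4)
qed

lemma natural_iso_lift:
  assumes C: "category C" and D: "category D" and ff: "fully_faithful C D Fo Fm"
    and T: "is_functor C C To Tm"
    and iso: "\<forall>X\<in>Obj C. iso_in D (Fo X) (Fo (To X)) (\<theta> X)"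
    and nat: "\<forall>X\<in>Obj C. \<forall>Y\<in>Obj C. \<forall>f\<in>Hom C X Y.
       Comp D (Fo X) (Fo Y) (Fo (To Y)) (\<theta> Y) (Fm X Y f) =
       Comp D (Fo X) (Fo (To X)) (Fo (To Y)) (Fm (To X) (To Y) (Tm X Y f)) (\<theta> X)"
  shows "\<exists>\<eta>. natural_iso C C (\<lambda>X. X) (\<lambda>X Y f. f) To Tm \<eta>"
proof -
  have F: "is_functor C D Fo Fm" using ff by (simp add: fully_faithful_def)
  note obT = functor_obj[OF T]
  have "\<exists>e. e \<in> Hom C X (To X) \<and> Fm X (To X) e = \<theta> X" if "X \<in> Obj C" for X
    using fully_faithful_lift[OF ff that obT[OF that] iso_in_hom[OF bspec[OF iso that]]] by metis
  then obtain \<eta> where \<eta>: "\<And>X. X \<in> Obj C \<Longrightarrow> \<eta> X \<in> Hom C X (To X)"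
      "\<And>X. X \<in> Obj C \<Longrightarrow> Fm X (To X) (\<eta> X) = \<theta> X"
    by metis
  have "iso_in C X (To X) (\<eta> X)" if "X \<in> Obj C" for X
    using fully_faithful_reflects_iso[OF C ff that obT[OF that] \<eta>(1)[OF that]] \<eta>(2) iso that by simp
  moreover have "Comp C X Y (To Y) (\<eta> Y) f = Comp C X (To X) (To Y) (Tm X Y f) (\<eta> X)"
    if X: "X \<in> Obj C" and Y: "Y \<in> Obj C" and f: "f \<in> Hom C X Y" for X Y f
  proof (rule fully_faithful_eqD[OF ff X obT[OF Y]])
    note Tf = functor_hom[OF T X Y f]
    show "Comp C X Y (To Y) (\<eta> Y) f \<in> Hom C X (To Y)"
      using category_comp[OF C X Y obT[OF Y] f \<eta>(1)[OF Y]] .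
    show "Comp C X (To X) (To Y) (Tm X Y f) (\<eta> X) \<in> Hom C X (To Y)"
      using category_comp[OF C X obT[OF X] obT[OF Y] \<eta>(1)[OF X] Tf] .
    show "Fm X (To Y) (Comp C X Y (To Y) (\<eta> Y) f) = Fm X (To Y) (Comp C X (To X) (To Y) (Tm X Y f) (\<eta> X))"
      using functor_comp[OF F X Y obT[OF Y] f \<eta>(1)[OF Y]]
        functor_comp[OF F X obT[OF X] obT[OF Y] \<eta>(1)[OF X] Tf] nat[rule_format, OF X Y f] \<eta>(2) X Y by simp
  qed
  ultimately show ?thesis by (intro exI[of _ \<eta>]) (simp add: natural_iso_def)
qed

lemma natural_iso_to_id:
  assumes C: "category C" and T: "is_functor C C To Tm"
    and n: "natural_iso C C (\<lambda>X. X) (\<lambda>X Y f. f) To Tm \<eta>"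
  obtains \<epsilon> where "natural_iso C C To Tm (\<lambda>X. X) (\<lambda>X Y f. f) \<epsilon>"
proof -
  note obT = functor_obj[OF T]
  have \<eta>: "\<And>X. X \<in> Obj C \<Longrightarrow> iso_in C X (To X) (\<eta> X)" using n by (simp add: natural_iso_def)
  have "\<exists>d. iso_in C (To X) X d \<and> Comp C X (To X) X d (\<eta> X) = Id C X
          \<and> Comp C (To X) X (To X) (\<eta> X) d = Id C (To X)" if "X \<in> Obj C" for X
    using iso_in_sym[OF \<eta>[OF that]] by metis
  then obtain \<delta> where \<delta>: "\<And>X. X \<in> Obj C \<Longrightarrow> iso_in C (To X) X (\<delta> X)"
      "\<And>X. X \<in> Obj C \<Longrightarrow> Comp C X (To X) X (\<delta> X) (\<eta> X) = Id C X"
      "\<And>X. X \<in> Obj C \<Longrightarrow> Comp C (To X) X (To X) (\<eta> X) (\<delta> X) = Id C (To X)"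
    by metis
  have "Comp C (To X) (To Y) Y (\<delta> Y) (Tm X Y f) = Comp C (To X) X Y f (\<delta> X)"
    if X: "X \<in> Obj C" and Y: "Y \<in> Obj C" and f: "f \<in> Hom C X Y" for X Y f
  proof -
    note h = iso_in_hom[OF \<eta>[OF X]] iso_in_hom[OF \<eta>[OF Y]] iso_in_hom[OF \<delta>(1)[OF X]]
      iso_in_hom[OF \<delta>(1)[OF Y]]
    note Tf = functor_hom[OF T X Y f]
    have "Comp C (To X) X Y f (\<delta> X)
        = Comp C (To X) X Y (Comp C X (To Y) Y (\<delta> Y) (Comp C X Y (To Y) (\<eta> Y) f)) (\<delta> X)"
      using category_assoc[OF C X Y obT[OF Y] Y f h(2,4)] category_unit[OF C X Y f] \<delta>(2)[OF Y] by simp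
    also have "\<dots> = Comp C (To X) X Y (Comp C X (To Y) Y (\<delta> Y) (Comp C X (To X) (To Y) (Tm X Y f) (\<eta> X))) (\<delta> X)"
      using n X Y f by (simp add: natural_iso_def)
    also have "\<dots> = Comp C (To X) X Y (Comp C X (To X) Y (Comp C (To X) (To Y) Y (\<delta> Y) (Tm X Y f)) (\<eta> X)) (\<delta> X)"
      using category_assoc[OF C X obT[OF X] obT[OF Y] Y h(1) Tf h(4)] by simp
    also have "\<dots> = Comp C (To X) (To Y) Y (\<delta> Y) (Tm X Y f)"
      using category_assoc[OF C obT[OF X] X obT[OF X] Y h(3,1)
          category_comp[OF C obT[OF X] obT[OF Y] Y Tf h(4)]] \<delta>(3)[OF X]
        category_unit[OF C obT[OF X] Y category_comp[OF C obT[OF X] obT[OF Y] Y Tf h(4)]] by simp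
    finally show ?thesis ..
  qed
  then show ?thesis using \<delta>(1) by (intro that[of \<delta>]) (simp add: natural_iso_def)
qed

text \<open>
  The components of a natural isomorphism and their inverses are isomorphisms, so they survive the
  passage to smaller hom-sets that still contain all isomorphisms.
\<close>

lemma natural_iso_restrict:
  assumes n: "natural_iso C C So Sm To Tm \<eta>" and K: "\<And>X Y. X \<in> Obj C \<Longrightarrow> Y \<in> Obj C \<Longrightarrow> K X Y \<subseteq> Hom C X Y"
    and S: "\<And>X. X \<in> Obj C \<Longrightarrow> So X \<in> Obj C" and T: "\<And>X. X \<in> Obj C \<Longrightarrow> To X \<in> Obj C"
    and iso: "\<And>X Y e. X \<in> Obj C \<Longrightarrow> Y \<in> Obj C \<Longrightarrow> iso_in C X Y e \<Longrightarrow> e \<in> K X Y"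
  shows "natural_iso (C\<lparr>Hom := K\<rparr>) (C\<lparr>Hom := K\<rparr>) So Sm To Tm \<eta>"
proof -
  have "iso_in (C\<lparr>Hom := K\<rparr>) X Y e" if "X \<in> Obj C" "Y \<in> Obj C" "iso_in C X Y e" for X Y e
    using iso_in_sym[OF that(3)] iso[OF that(2,1)] iso[OF that] unfolding iso_in_def[of "C\<lparr>Hom := K\<rparr>"]
    by simp metis
  moreover have "f \<in> Hom C X Y" if "X \<in> Obj C" "Y \<in> Obj C" "f \<in> K X Y" for X Y f
    using K that by blast
  ultimately show ?thesis using n S T by (simp add: natural_iso_def)
qed

lemma functor_compose:
  "is_functor C D Fo Fm \<Longrightarrow> is_functor D E Go Gm
    \<Longrightarrow> is_functor C E (\<lambda>X. Go (Fo X)) (\<lambda>X Y f. Gm (Fo X) (Fo Y) (Fm X Y f))"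
  by (simp add: is_functor_def)

text \<open>
  The isomorphisms \<open>U \<cong> V P \<cong> U Q P\<close> of functors into \<open>D\<close> lift along the fully faithful \<open>U\<close> to an
  isomorphism between the identity and \<open>Q P\<close>.
\<close>

lemma natural_iso_paste:
  assumes A: "category A" and D: "category D" and Uf: "fully_faithful A D Uo Um"
    and P: "is_functor A B Po Pm" and Q: "is_functor B A Qo Qm" and V: "is_functor B D Vo Vm"
    and a: "\<forall>X\<in>Obj A. iso_in D (Uo X) (Vo (Po X)) (\<alpha> X)"
    and na: "\<forall>X\<in>Obj A. \<forall>Y\<in>Obj A. \<forall>f\<in>Hom A X Y.
       Comp D (Uo X) (Uo Y) (Vo (Po Y)) (\<alpha> Y) (Um X Y f) =
       Comp D (Uo X) (Vo (Po X)) (Vo (Po Y)) (Vm (Po X) (Po Y) (Pm X Y f)) (\<alpha> X)"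
    and b: "\<forall>X\<in>Obj B. iso_in D (Vo X) (Uo (Qo X)) (\<beta> X)"
    and nb: "\<forall>X\<in>Obj B. \<forall>Y\<in>Obj B. \<forall>f\<in>Hom B X Y.
       Comp D (Vo X) (Vo Y) (Uo (Qo Y)) (\<beta> Y) (Vm X Y f) =
       Comp D (Vo X) (Uo (Qo X)) (Uo (Qo Y)) (Um (Qo X) (Qo Y) (Qm X Y f)) (\<beta> X)"
  shows "\<exists>\<eta>. natural_iso A A (\<lambda>X. X) (\<lambda>X Y f. f)
      (\<lambda>X. Qo (Po X)) (\<lambda>X Y f. Qm (Po X) (Po Y) (Pm X Y f)) \<eta>"
proof -
  have U: "is_functor A D Uo Um" using Uf by (simp add: fully_faithful_def)
  note obP = functor_obj[OF P]
  note obU = functor_obj[OF U] and obV = functor_obj[OF V obP]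
    and obQ = functor_obj[OF U functor_obj[OF Q obP]]
  define \<theta> where "\<theta> X = Comp D (Uo X) (Vo (Po X)) (Uo (Qo (Po X))) (\<beta> (Po X)) (\<alpha> X)" for X
  have 1: "iso_in D (Uo X) (Uo (Qo (Po X))) (\<theta> X)" if "X \<in> Obj A" for X
    unfolding \<theta>_def
    using iso_in_comp[OF D obU[OF that] obV[OF that] obQ[OF that] bspec[OF a that] bspec[OF b obP[OF that]]] .
  have 2: "Comp D (Uo X) (Uo Y) (Uo (Qo (Po Y))) (\<theta> Y) (Um X Y f) =
      Comp D (Uo X) (Uo (Qo (Po X))) (Uo (Qo (Po Y)))
        (Um (Qo (Po X)) (Qo (Po Y)) (Qm (Po X) (Po Y) (Pm X Y f))) (\<theta> X)"
    if X: "X \<in> Obj A" and Y: "Y \<in> Obj A" and f: "f \<in> Hom A X Y" for X Y f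
  proof -
    note Pf = functor_hom[OF P X Y f]
    note hs = iso_in_hom[OF bspec[OF a X]] iso_in_hom[OF bspec[OF a Y]] iso_in_hom[OF bspec[OF b obP[OF X]]]
      iso_in_hom[OF bspec[OF b obP[OF Y]]]
    note Uf = functor_hom[OF U X Y f] and Vf = functor_hom[OF V obP[OF X] obP[OF Y] Pf]
      and Qf = functor_hom[OF U functor_obj[OF Q obP[OF X]] functor_obj[OF Q obP[OF Y]]
        functor_hom[OF Q obP[OF X] obP[OF Y] Pf]]
    show ?thesis
      unfolding \<theta>_def
      using category_assoc[OF D obU[OF X] obU[OF Y] obV[OF Y] obQ[OF Y] Uf hs(2,4)]
        category_assoc[OF D obU[OF X] obV[OF X] obV[OF Y] obQ[OF Y] hs(1) Vf hs(4)]
        category_assoc[OF D obU[OF X] obV[OF X] obQ[OF X] obQ[OF Y] hs(1,3) Qf]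
        na[rule_format, OF X Y f] nb[rule_format, OF obP[OF X] obP[OF Y] Pf] by simp
  qed
  show ?thesis
    using natural_iso_lift[where \<theta> = \<theta> and To = "\<lambda>X. Qo (Po X)"
        and Tm = "\<lambda>X Y f. Qm (Po X) (Po Y) (Pm X Y f)", OF A D Uf functor_compose[OF P Q]] 1 2
    by simp
qed

text \<open>
  Two fully faithful functors into a common category whose images agree up to isomorphism have
  equivalent sources. Both passages between the sources come from \<open>lift_functor\<close>, so no inverse
  functor has to be described by hand. Since the functors, the unit and the counit obtained for the
  full hom-sets restrict to hom-sets cut out by an isomorphism-stable family, the same argument covers
  precategories of bounded maps, where composites may be lost.
\<close>

theorem equivalent_of_cospan:
  assumes C: "category C" and C': "category C'" and D: "category D"
    and ff: "fully_faithful C D Fo Fm" and ff': "fully_faithful C' D Fo' Fm'"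
    and ess: "\<forall>X\<in>Obj C. \<exists>Y\<in>Obj C'. \<exists>e. iso_in D (Fo X) (Fo' Y) e"
    and ess': "\<forall>Y\<in>Obj C'. \<exists>X\<in>Obj C. \<exists>e. iso_in D (Fo X) (Fo' Y) e"
    and stable: "iso_stable D KD"
    and K: "\<And>X Y. X \<in> Obj C \<Longrightarrow> Y \<in> Obj C \<Longrightarrow>
       K X Y = {f \<in> Hom C X Y. Fm X Y f \<in> KD (Fo X) (Fo Y)}"
    and K': "\<And>X Y. X \<in> Obj C' \<Longrightarrow> Y \<in> Obj C' \<Longrightarrow>
       K' X Y = {f \<in> Hom C' X Y. Fm' X Y f \<in> KD (Fo' X) (Fo' Y)}"
  shows "equivalent (C\<lparr>Hom := K\<rparr>) (C'\<lparr>Hom := K'\<rparr>)"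
proof -
  have F: "is_functor C D Fo Fm" and F': "is_functor C' D Fo' Fm'"
    using ff ff' by (simp_all add: fully_faithful_def)
  have ess'': "\<forall>Y\<in>Obj C'. \<exists>X\<in>Obj C. \<exists>e. iso_in D (Fo' Y) (Fo X) e"
    using ess' by (meson iso_in_sym)
  obtain Go Gm \<epsilon> where G: "is_functor C C' Go Gm"
    and \<epsilon>: "\<forall>X\<in>Obj C. iso_in D (Fo X) (Fo' (Go X)) (\<epsilon> X)"
    and n\<epsilon>: "\<forall>X\<in>Obj C. \<forall>Y\<in>Obj C. \<forall>f\<in>Hom C X Y.
       Comp D (Fo X) (Fo Y) (Fo' (Go Y)) (\<epsilon> Y) (Fm X Y f) =
       Comp D (Fo X) (Fo' (Go X)) (Fo' (Go Y)) (Fm' (Go X) (Go Y) (Gm X Y f)) (\<epsilon> X)"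
    and GK: "\<And>K X Y f. \<lbrakk>iso_stable D K; X \<in> Obj C; Y \<in> Obj C; f \<in> Hom C X Y; Fm X Y f \<in> K (Fo X) (Fo Y)\<rbrakk>
       \<Longrightarrow> Fm' (Go X) (Go Y) (Gm X Y f) \<in> K (Fo' (Go X)) (Fo' (Go Y))"
    by (rule lift_functor[OF C C' D F ff' ess]) blast
  obtain Ho Hm \<zeta> where H: "is_functor C' C Ho Hm"
    and \<zeta>: "\<forall>X\<in>Obj C'. iso_in D (Fo' X) (Fo (Ho X)) (\<zeta> X)"
    and n\<zeta>: "\<forall>X\<in>Obj C'. \<forall>Y\<in>Obj C'. \<forall>f\<in>Hom C' X Y.
       Comp D (Fo' X) (Fo' Y) (Fo (Ho Y)) (\<zeta> Y) (Fm' X Y f) =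
       Comp D (Fo' X) (Fo (Ho X)) (Fo (Ho Y)) (Fm (Ho X) (Ho Y) (Hm X Y f)) (\<zeta> X)"
    and HK: "\<And>K X Y f. \<lbrakk>iso_stable D K; X \<in> Obj C'; Y \<in> Obj C'; f \<in> Hom C' X Y; Fm' X Y f \<in> K (Fo' X) (Fo' Y)\<rbrakk>
       \<Longrightarrow> Fm (Ho X) (Ho Y) (Hm X Y f) \<in> K (Fo (Ho X)) (Fo (Ho Y))"
    by (rule lift_functor[OF C' C D F' ff ess'']) blast
  obtain \<eta> where \<eta>: "natural_iso C C (\<lambda>X. X) (\<lambda>X Y f. f)
      (\<lambda>X. Ho (Go X)) (\<lambda>X Y f. Hm (Go X) (Go Y) (Gm X Y f)) \<eta>"
    using natural_iso_paste[OF C D ff G H F' \<epsilon> n\<epsilon> \<zeta> n\<zeta>] by blast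
  obtain \<kappa>' where "natural_iso C' C' (\<lambda>X. X) (\<lambda>X Y f. f)
      (\<lambda>X. Go (Ho X)) (\<lambda>X Y f. Gm (Ho X) (Ho Y) (Hm X Y f)) \<kappa>'"
    using natural_iso_paste[OF C' D ff' H G F \<zeta> n\<zeta> \<epsilon> n\<epsilon>] by blast
  from natural_iso_to_id[OF C' functor_compose[OF H G] this]
  obtain \<kappa> where \<kappa>: "natural_iso C' C' (\<lambda>X. Go (Ho X)) (\<lambda>X Y f. Gm (Ho X) (Ho Y) (Hm X Y f))
      (\<lambda>X. X) (\<lambda>X Y f. f) \<kappa>" by blast
  have isoK: "e \<in> K X Y" if "X \<in> Obj C" "Y \<in> Obj C" "iso_in C X Y e" for X Y e
    using functor_iso[OF F that] stable functor_obj[OF F] that iso_in_hom[OF that(3)]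
    by (auto simp: K iso_stable_def)
  have isoK': "e \<in> K' X Y" if "X \<in> Obj C'" "Y \<in> Obj C'" "iso_in C' X Y e" for X Y e
    using functor_iso[OF F' that] stable functor_obj[OF F'] that iso_in_hom[OF that(3)]
    by (auto simp: K' iso_stable_def)
  have "is_functor (C\<lparr>Hom := K\<rparr>) (C'\<lparr>Hom := K'\<rparr>) Go Gm"
    using G GK[OF stable] by (simp add: is_functor_def K K')
  moreover have "is_functor (C'\<lparr>Hom := K'\<rparr>) (C\<lparr>Hom := K\<rparr>) Ho Hm"
    using H HK[OF stable] by (simp add: is_functor_def K K')
  moreover have "natural_iso (C\<lparr>Hom := K\<rparr>) (C\<lparr>Hom := K\<rparr>) (\<lambda>X. X) (\<lambda>X Y f. f)
      (\<lambda>X. Ho (Go X)) (\<lambda>X Y f. Hm (Go X) (Go Y) (Gm X Y f)) \<eta>"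
    by (rule natural_iso_restrict[OF \<eta>])
      (use K isoK functor_obj[OF functor_compose[OF G H]] in auto)
  moreover have "natural_iso (C'\<lparr>Hom := K'\<rparr>) (C'\<lparr>Hom := K'\<rparr>)
      (\<lambda>X. Go (Ho X)) (\<lambda>X Y f. Gm (Ho X) (Ho Y) (Hm X Y f)) (\<lambda>X. X) (\<lambda>X Y f. f) \<kappa>"
    by (rule natural_iso_restrict[OF \<kappa>])
      (use K' isoK' functor_obj[OF functor_compose[OF H G]] in auto)
  ultimately show ?thesis unfolding equivalent_def by blast
qed

section \<open>Meet-semilattices and their homomorphisms\<close>

lemma is_glb_iff:
  "F \<subseteq> carrier M \<Longrightarrow> is_glb M i F \<longleftrightarrow> i \<in> carrier M \<and> (\<forall>x\<in>F. i \<sqsubseteq>\<^bsub>M\<^esub> x) \<and>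
     (\<forall>y\<in>carrier M. (\<forall>x\<in>F. y \<sqsubseteq>\<^bsub>M\<^esub> x) \<longrightarrow> y \<sqsubseteq>\<^bsub>M\<^esub> i)"
  by (auto simp: greatest_def Lower_def Int_absorb2)

lemma is_lub_iff:
  "F \<subseteq> carrier M \<Longrightarrow> is_lub M i F \<longleftrightarrow> i \<in> carrier M \<and> (\<forall>x\<in>F. x \<sqsubseteq>\<^bsub>M\<^esub> i) \<and>
     (\<forall>y\<in>carrier M. (\<forall>x\<in>F. x \<sqsubseteq>\<^bsub>M\<^esub> y) \<longrightarrow> i \<sqsubseteq>\<^bsub>M\<^esub> y)"
  by (auto simp: least_def Upper_def Int_absorb2)

lemma least_iff:
  "least M z (carrier M) \<longleftrightarrow> z \<in> carrier M \<and> (\<forall>y\<in>carrier M. z \<sqsubseteq>\<^bsub>M\<^esub> y)"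
  by (auto simp: least_def)

lemma partial_order_refl: "partial_order M \<Longrightarrow> x \<in> carrier M \<Longrightarrow> x \<sqsubseteq>\<^bsub>M\<^esub> x"
  by (simp add: partial_order_def weak_partial_order.le_refl)

lemma partial_order_antisym:
  "partial_order M \<Longrightarrow> x \<in> carrier M \<Longrightarrow> y \<in> carrier M \<Longrightarrow> x \<sqsubseteq>\<^bsub>M\<^esub> y \<Longrightarrow> y \<sqsubseteq>\<^bsub>M\<^esub> x \<Longrightarrow> x = y"
  by (rule partial_order.le_antisym)

lemma partial_order_trans:
  "partial_order M \<Longrightarrow> x \<in> carrier M \<Longrightarrow> y \<in> carrier M \<Longrightarrow> z \<in> carrier M
    \<Longrightarrow> x \<sqsubseteq>\<^bsub>M\<^esub> y \<Longrightarrow> y \<sqsubseteq>\<^bsub>M\<^esub> z \<Longrightarrow> x \<sqsubseteq>\<^bsub>M\<^esub> z"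
  by (meson partial_order_def weak_partial_order.le_trans)

lemma partial_orderI:
  assumes "eq M = (=)" "\<And>x. x \<in> carrier M \<Longrightarrow> x \<sqsubseteq>\<^bsub>M\<^esub> x"
    "\<And>x y. \<lbrakk>x \<in> carrier M; y \<in> carrier M; x \<sqsubseteq>\<^bsub>M\<^esub> y; y \<sqsubseteq>\<^bsub>M\<^esub> x\<rbrakk> \<Longrightarrow> x = y"
    "\<And>x y z. \<lbrakk>x \<in> carrier M; y \<in> carrier M; z \<in> carrier M; x \<sqsubseteq>\<^bsub>M\<^esub> y; y \<sqsubseteq>\<^bsub>M\<^esub> z\<rbrakk> \<Longrightarrow> x \<sqsubseteq>\<^bsub>M\<^esub> z"
  shows "partial_order M"
  by (unfold_locales, unfold assms(1)) (use assms(2,3) in simp_all, use assms(4) in blast)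

lemma inf_eqI:
  assumes "partial_order M" "is_glb M i F" shows "\<Sqinter>\<^bsub>M\<^esub> F = i"
  unfolding inf_def using assms by (metis (no_types, lifting) partial_order.greatest_unique someI)

lemma sup_eqI:
  assumes "partial_order M" "is_lub M i F" shows "\<Squnion>\<^bsub>M\<^esub> F = i"
  unfolding sup_def using assms by (metis (no_types, lifting) partial_order.least_unique someI)

lemma bottom_eqI:
  assumes "partial_order M" "least M z (carrier M)" shows "\<bottom>\<^bsub>M\<^esub> = z"
  unfolding bottom_def using assms by (metis (no_types, lifting) partial_order.least_unique someI)

lemma semilattice_partial_order: "meet_semilattice M \<Longrightarrow> partial_order M"
  by (simp add: meet_semilattice_def)

lemma semilattice_inf:
  assumes "meet_semilattice M" "F \<subseteq> carrier M" "finite F"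
  shows "is_glb M (\<Sqinter>\<^bsub>M\<^esub> F) F"
  using assms inf_eqI unfolding meet_semilattice_def by metis

lemma semilattice_inf_closed:
    "meet_semilattice M \<Longrightarrow> F \<subseteq> carrier M \<Longrightarrow> finite F \<Longrightarrow> \<Sqinter>\<^bsub>M\<^esub> F \<in> carrier M"
  and semilattice_inf_lower:
    "meet_semilattice M \<Longrightarrow> F \<subseteq> carrier M \<Longrightarrow> finite F \<Longrightarrow> x \<in> F \<Longrightarrow> \<Sqinter>\<^bsub>M\<^esub> F \<sqsubseteq>\<^bsub>M\<^esub> x"
  and semilattice_inf_greatest:
    "meet_semilattice M \<Longrightarrow> F \<subseteq> carrier M \<Longrightarrow> finite F \<Longrightarrow> y \<in> carrier M
      \<Longrightarrow> (\<And>x. x \<in> F \<Longrightarrow> y \<sqsubseteq>\<^bsub>M\<^esub> x) \<Longrightarrow> y \<sqsubseteq>\<^bsub>M\<^esub> \<Sqinter>\<^bsub>M\<^esub> F"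
  using semilattice_inf[of M F] by (auto simp: is_glb_iff)

lemma semilattice_meet_closed:
    "meet_semilattice M \<Longrightarrow> a \<in> carrier M \<Longrightarrow> b \<in> carrier M \<Longrightarrow> a \<sqinter>\<^bsub>M\<^esub> b \<in> carrier M"
  and semilattice_meet_left:
    "meet_semilattice M \<Longrightarrow> a \<in> carrier M \<Longrightarrow> b \<in> carrier M \<Longrightarrow> a \<sqinter>\<^bsub>M\<^esub> b \<sqsubseteq>\<^bsub>M\<^esub> a"
  and semilattice_meet_right:
    "meet_semilattice M \<Longrightarrow> a \<in> carrier M \<Longrightarrow> b \<in> carrier M \<Longrightarrow> a \<sqinter>\<^bsub>M\<^esub> b \<sqsubseteq>\<^bsub>M\<^esub> b"
  and semilattice_meet_greatest:
    "meet_semilattice M \<Longrightarrow> a \<in> carrier M \<Longrightarrow> b \<in> carrier M \<Longrightarrow> c \<in> carrier M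
      \<Longrightarrow> c \<sqsubseteq>\<^bsub>M\<^esub> a \<Longrightarrow> c \<sqsubseteq>\<^bsub>M\<^esub> b \<Longrightarrow> c \<sqsubseteq>\<^bsub>M\<^esub> a \<sqinter>\<^bsub>M\<^esub> b"
  using semilattice_inf[of M "{a, b}"] by (auto simp: is_glb_iff meet_def)

lemma semilattice_meet_eq:
  assumes "meet_semilattice M" "a \<in> carrier M" "b \<in> carrier M" "a \<sqsubseteq>\<^bsub>M\<^esub> b"
  shows "\<Sqinter>\<^bsub>M\<^esub> {a, b} = a"
  using assms semilattice_partial_order[OF assms(1)]
  by (intro inf_eqI) (auto simp: is_glb_iff partial_order_refl)

lemma precategory_concrete:
  assumes "\<And>X Y. X \<in> Ob \<Longrightarrow> Y \<in> Ob \<Longrightarrow> H X Y \<subseteq> car X \<rightarrow>\<^sub>E car Y"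
    and "\<And>X. X \<in> Ob \<Longrightarrow> (\<lambda>x\<in>car X. x) \<in> H X X"
  shows "precategory (concrete_cat car Ob H)"
proof -
  have "f \<in> car X \<rightarrow> car Y" "f \<in> extensional (car X)" if "X \<in> Ob" "Y \<in> Ob" "f \<in> H X Y" for X Y f
    using assms(1)[OF that(1,2)] that(3) by (auto simp: PiE_def)
  note fs = this
  have "compose (car X) f (\<lambda>x\<in>car X. x) = f" "compose (car X) (\<lambda>x\<in>car Y. x) f = f"
    if "X \<in> Ob" "Y \<in> Ob" "f \<in> H X Y" for X Y f
    using compose_Id[OF fs[OF that]] Id_compose[OF fs[OF that]] .
  moreover have "\<forall>W\<in>Ob. \<forall>X\<in>Ob. \<forall>Y\<in>Ob. \<forall>Z\<in>Ob. \<forall>f\<in>H W X. \<forall>g\<in>H X Y. \<forall>h\<in>H Y Z.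
      compose (car W) h (compose (car W) g f) = compose (car W) (compose (car X) h g) f"
    by (intro ballI compose_assoc[OF fs(1)])
  ultimately show ?thesis using assms(2) by (simp add: precategory_def concrete_cat_def)
qed

lemma category_concrete:
  assumes "\<And>X Y. X \<in> Ob \<Longrightarrow> Y \<in> Ob \<Longrightarrow> H X Y \<subseteq> car X \<rightarrow>\<^sub>E car Y"
    and "\<And>X. X \<in> Ob \<Longrightarrow> (\<lambda>x\<in>car X. x) \<in> H X X"
    and "\<And>X Y Z f g. \<lbrakk>X \<in> Ob; Y \<in> Ob; Z \<in> Ob; f \<in> H X Y; g \<in> H Y Z\<rbrakk> \<Longrightarrow> compose (car X) g f \<in> H X Z"
  shows "category (concrete_cat car Ob H)"
  using precategory_concrete[of Ob H car, OF assms(1,2)] assms(3) by (simp add: category_def concrete_cat_def)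

lemma FSup_hom_funcset: "FSup_hom M N \<subseteq> carrier M \<rightarrow>\<^sub>E carrier N"
  by (auto simp: FSup_hom_def)

lemma FSup_hom_mono:
  assumes M: "meet_semilattice M" and N: "meet_semilattice N" and f: "f \<in> FSup_hom M N"
    and xy: "x \<in> carrier M" "y \<in> carrier M" "x \<sqsubseteq>\<^bsub>M\<^esub> y"
  shows "f x \<sqsubseteq>\<^bsub>N\<^esub> f y"
proof -
  have "f \<in> carrier M \<rightarrow> carrier N" "f (\<Sqinter>\<^bsub>M\<^esub> {x, y}) = \<Sqinter>\<^bsub>N\<^esub> (f ` {x, y})"
    using f xy by (auto simp: FSup_hom_def)
  then show ?thesis
    using semilattice_inf_lower[OF N, of "f ` {x, y}" "f y"] semilattice_meet_eq[OF M xy] xy by auto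
qed

lemma FSup_hom_id:
  assumes "meet_semilattice M" shows "(\<lambda>x\<in>carrier M. x) \<in> FSup_hom M M"
proof -
  have "(\<lambda>x\<in>carrier M. x) ` F = F" if "F \<subseteq> carrier M" for F
    using that by auto
  then show ?thesis
    using semilattice_inf_closed[OF assms] by (auto simp: FSup_hom_def least_def)
qed

lemma FSup_hom_compose:
  assumes f: "f \<in> FSup_hom M N" and g: "g \<in> FSup_hom N P" and M: "meet_semilattice M"
  shows "compose (carrier M) g f \<in> FSup_hom M P"
proof -
  have fN: "f ` F \<subseteq> carrier N" if "F \<subseteq> carrier M" for F
    using f that by (auto simp: FSup_hom_def)
  have im: "compose (carrier M) g f ` F = g ` f ` F" if "F \<subseteq> carrier M" for F
    using that by (auto simp: compose_def image_image subset_iff)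
  have "compose (carrier M) g f \<in> carrier M \<rightarrow>\<^sub>E carrier P"
    using f g by (auto simp: FSup_hom_def compose_def)
  moreover have "compose (carrier M) g f (\<Sqinter>\<^bsub>M\<^esub> F) = \<Sqinter>\<^bsub>P\<^esub> (compose (carrier M) g f ` F)"
    if "F \<subseteq> carrier M" "finite F" for F
    using f g fN[OF that(1)] that semilattice_inf_closed[OF M that] unfolding im[OF that(1)]
    by (simp add: FSup_hom_def compose_def)
  moreover have "is_lub P (compose (carrier M) g f s) (compose (carrier M) g f ` F)"
    if "F \<subseteq> carrier M" "finite F" "F \<noteq> {}" "is_lub M s F" for F s
    using f g fN[OF that(1)] that unfolding im[OF that(1)]
    by (simp add: FSup_hom_def compose_def)
  ultimately show ?thesis by (auto simp: FSup_hom_def)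
qed

lemma order_iso_FSup_hom:
  assumes M: "meet_semilattice M" and N: "meet_semilattice N"
    and bij: "bij_betw f (carrier M) (carrier N)" and ext: "f \<in> extensional (carrier M)"
    and ord: "\<And>x y. x \<in> carrier M \<Longrightarrow> y \<in> carrier M \<Longrightarrow> f x \<sqsubseteq>\<^bsub>N\<^esub> f y \<longleftrightarrow> x \<sqsubseteq>\<^bsub>M\<^esub> y"
  shows "f \<in> FSup_hom M N"
proof -
  have im: "f ` carrier M = carrier N" using bij by (simp add: bij_betw_def)
  have sub: "f ` F \<subseteq> carrier N" if "F \<subseteq> carrier M" for F using im image_mono[OF that] by metis
  have glb: "is_glb N (f i) (f ` F)" if F: "F \<subseteq> carrier M" and i: "is_glb M i F" for i F
  proof -
    have "f y \<sqsubseteq>\<^bsub>N\<^esub> f i" if "y \<in> carrier M" "\<forall>x\<in>F. f y \<sqsubseteq>\<^bsub>N\<^esub> f x" for y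
      using i F that ord unfolding is_glb_iff[OF F] by (meson subsetD)
    then show ?thesis
      using i F ord unfolding is_glb_iff[OF F] is_glb_iff[OF sub[OF F]] im[symmetric] by auto
  qed
  have lub: "is_lub N (f i) (f ` F)" if F: "F \<subseteq> carrier M" and i: "is_lub M i F" for i F
  proof -
    have "f i \<sqsubseteq>\<^bsub>N\<^esub> f y" if "y \<in> carrier M" "\<forall>x\<in>F. f x \<sqsubseteq>\<^bsub>N\<^esub> f y" for y
      using i F that ord unfolding is_lub_iff[OF F] by (meson subsetD)
    then show ?thesis
      using i F ord unfolding is_lub_iff[OF F] is_lub_iff[OF sub[OF F]] im[symmetric] by auto
  qed
  have "f (\<Sqinter>\<^bsub>M\<^esub> F) = \<Sqinter>\<^bsub>N\<^esub> (f ` F)" if "F \<subseteq> carrier M" "finite F" for F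
    using inf_eqI[OF semilattice_partial_order[OF N] glb[OF that(1) semilattice_inf[OF M that]]] by simp
  then show ?thesis using lub ext im by (auto simp: FSup_hom_def PiE_def)
qed

lemma Obj_DMS: "Obj DMS_FSup = {M :: 'u gorder. distributive_semilattice M \<and> small TYPE('u) (carrier M)}"
  and Hom_DMS: "Hom DMS_FSup = (FSup_hom :: 'u gorder \<Rightarrow> 'u gorder \<Rightarrow> _)"
  and Id_DMS: "Id DMS_FSup = (\<lambda>M :: 'u gorder. \<lambda>x\<in>carrier M. x)"
  and Comp_DMS: "Comp DMS_FSup = (\<lambda>M N P :: 'u gorder. \<lambda>g f. compose (carrier M) g f)"
  by (simp_all add: DMS_FSup_def concrete_cat_def)

lemma Obj_DMS_semilattice: "M \<in> Obj DMS_FSup \<Longrightarrow> meet_semilattice M"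
  by (simp add: Obj_DMS distributive_semilattice_def)

lemma category_DMS: "category DMS_FSup"
  unfolding DMS_FSup_def
  by (rule category_concrete[OF FSup_hom_funcset])
    (simp_all add: distributive_semilattice_def FSup_hom_id FSup_hom_compose)

lemma iso_in_DMS:
  assumes MN: "M \<in> Obj DMS_FSup" "N \<in> Obj DMS_FSup"
    and bij: "bij_betw f (carrier M) (carrier N)"
    and ord: "\<And>x y. x \<in> carrier M \<Longrightarrow> y \<in> carrier M \<Longrightarrow> f x \<sqsubseteq>\<^bsub>N\<^esub> f y \<longleftrightarrow> x \<sqsubseteq>\<^bsub>M\<^esub> y"
  shows "\<exists>e. iso_in DMS_FSup M N e"
proof -
  note sl = Obj_DMS_semilattice[OF MN(1)] Obj_DMS_semilattice[OF MN(2)]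
  define e where "e = restrict f (carrier M)"
  define g where "g = restrict (inv_into (carrier M) f) (carrier N)"
  have ge: "g (e x) = x" "e x \<in> carrier N" if "x \<in> carrier M" for x
    using that bij by (auto simp: e_def g_def bij_betw_def inv_into_f_f)
  have eg: "e (g y) = y" "g y \<in> carrier M" if "y \<in> carrier N" for y
    using that bij by (auto simp: e_def g_def bij_betw_def f_inv_into_f inv_into_into)
  have bije: "bij_betw e (carrier M) (carrier N)"
    using bij by (simp add: e_def)
  have "bij_betw g (carrier N) (carrier M)"
    using bij_betw_inv_into[OF bij] by (simp add: g_def)
  moreover have "g x \<sqsubseteq>\<^bsub>M\<^esub> g y \<longleftrightarrow> x \<sqsubseteq>\<^bsub>N\<^esub> y" if "x \<in> carrier N" "y \<in> carrier N" for x y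
    using ord[OF eg(2)[OF that(1)] eg(2)[OF that(2)]] eg that by (simp add: e_def)
  ultimately have g: "g \<in> FSup_hom N M"
    using sl by (intro order_iso_FSup_hom) (auto simp: g_def)
  have e: "e \<in> FSup_hom M N"
    using sl bije ord by (intro order_iso_FSup_hom) (auto simp: e_def)
  have "compose (carrier M) g e = (\<lambda>x\<in>carrier M. x)" "compose (carrier N) e g = (\<lambda>x\<in>carrier N. x)"
    using ge eg by (auto simp: compose_def)
  then show ?thesis
    using e g by (auto simp: iso_in_def Hom_DMS Id_DMS Comp_DMS)
qed

text \<open>
  Quantifying over all least elements replaces \<open>\<bottom>\<close>, whose value is unspecified when there is no least
  element.
\<close>

lemma FSupB_hom_iff:
  assumes "meet_semilattice M" "meet_semilattice N"
  shows "f \<in> FSupB_hom M N \<longleftrightarrow> f \<in> FSup_hom M N \<and>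
    (\<forall>z w. least M z (carrier M) \<and> least N w (carrier N) \<longrightarrow> f z = w)"
proof -
  note b = bottom_eqI[OF semilattice_partial_order[OF assms(1)]]
    bottom_eqI[OF semilattice_partial_order[OF assms(2)]]
  show ?thesis
    using assms b unfolding FSupB_hom_def bounded_semilattice_def by auto
qed

text \<open>
  An isomorphism carries a least element to a least element in both directions. Hence composing with
  one neither creates nor removes the situation in which a least element has to be preserved.
\<close>

lemma iso_stable_FSupB: "iso_stable DMS_FSup (FSupB_hom :: 'u gorder \<Rightarrow> 'u gorder \<Rightarrow> _)"
proof -
  have inv: "\<exists>g\<in>FSup_hom N M. (\<forall>x\<in>carrier M. g (e x) = x) \<and> (\<forall>y\<in>carrier N. e (g y) = y)"
    if iso: "iso_in DMS_FSup M N e" for M N :: "'u gorder" and e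
  proof -
    from iso obtain g where g: "g \<in> FSup_hom N M" "compose (carrier M) g e = (\<lambda>x\<in>carrier M. x)"
      "compose (carrier N) e g = (\<lambda>x\<in>carrier N. x)"
      by (auto simp: iso_in_def Hom_DMS Id_DMS Comp_DMS)
    have "g (e x) = x" if "x \<in> carrier M" for x
      using fun_cong[OF g(2), of x] that by (simp add: compose_def)
    moreover have "e (g y) = y" if "y \<in> carrier N" for y
      using fun_cong[OF g(3), of y] that by (simp add: compose_def)
    ultimately show ?thesis using g(1) by blast
  qed
  have least_transfer: "least N (e z) (carrier N)"
    if MN: "M \<in> Obj DMS_FSup" "N \<in> Obj DMS_FSup" and iso: "iso_in DMS_FSup M N e"
      and z: "least M z (carrier M)" for M N :: "'u gorder" and e z
  proof -
    note sl = Obj_DMS_semilattice[OF MN(1)] Obj_DMS_semilattice[OF MN(2)]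
    have e: "e \<in> FSup_hom M N" using iso_in_hom[OF iso] by (simp add: Hom_DMS)
    obtain g where g: "g \<in> FSup_hom N M" "\<forall>x\<in>carrier M. g (e x) = x" "\<forall>y\<in>carrier N. e (g y) = y"
      using inv[OF iso] by auto
    have gc: "g y \<in> carrier M" if "y \<in> carrier N" for y using subsetD[OF FSup_hom_funcset g(1)] that by (rule PiE_mem)
    have "e z \<sqsubseteq>\<^bsub>N\<^esub> y" if "y \<in> carrier N" for y
      using FSup_hom_mono[OF sl e, of z "g y"] gc[OF that] g(3) z that by (auto simp: least_iff)
    moreover have "e z \<in> carrier N" using subsetD[OF FSup_hom_funcset e] z by (auto simp: least_iff)
    ultimately show ?thesis by (simp add: least_iff)
  qed
  have uniq: "z = w" if "M \<in> Obj DMS_FSup" "least M z (carrier M)" "least M w (carrier M)"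
    for M :: "'u gorder" and z w
    using partial_order.least_unique[OF semilattice_partial_order[OF Obj_DMS_semilattice[OF that(1)]] that(2,3)] .
  show ?thesis
    unfolding iso_stable_def
  proof (intro conjI ballI allI impI)
    fix M N :: "'u gorder" and e
    assume MN: "M \<in> Obj DMS_FSup" "N \<in> Obj DMS_FSup" and iso: "iso_in DMS_FSup M N e"
    note sl = Obj_DMS_semilattice[OF MN(1)] Obj_DMS_semilattice[OF MN(2)]
    show "e \<in> FSupB_hom M N"
      using iso_in_hom[OF iso] uniq[OF MN(2) least_transfer[OF MN iso]]
      by (simp add: Hom_DMS FSupB_hom_iff[OF sl])
  next
    fix M N P :: "'u gorder" and f e
    assume Ob: "M \<in> Obj DMS_FSup" "N \<in> Obj DMS_FSup" "P \<in> Obj DMS_FSup"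
      and "f \<in> FSupB_hom M N \<and> iso_in DMS_FSup N P e"
    then have f: "f \<in> FSupB_hom M N" and iso: "iso_in DMS_FSup N P e" by auto
    note sl = Ob[THEN Obj_DMS_semilattice]
    obtain g where g: "iso_in DMS_FSup P N g" "Comp DMS_FSup P N P e g = Id DMS_FSup P"
      using iso_in_sym[OF iso] by metis
    have "compose (carrier M) e f z = w" if "least M z (carrier M)" "least P w (carrier P)" for z w
    proof -
      have "f z = g w"
        using f that least_transfer[OF Ob(3,2) g(1)] by (simp add: FSupB_hom_iff[OF sl(1,2)])
      then have "compose (carrier M) e f z = compose (carrier P) e g w"
        using that by (simp add: compose_def least_iff)
      then show ?thesis using g(2) that(2) by (simp add: Comp_DMS Id_DMS least_iff)
    qed
    moreover have "compose (carrier M) e f \<in> FSup_hom M P"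
      using f iso_in_hom[OF iso] by (auto simp: Hom_DMS FSupB_hom_def intro: FSup_hom_compose[OF _ _ sl(1)])
    ultimately show "Comp DMS_FSup M N P e f \<in> FSupB_hom M P"
      by (simp add: Comp_DMS FSupB_hom_iff[OF sl(1,3)])
  next
    fix M N P :: "'u gorder" and f e
    assume Ob: "M \<in> Obj DMS_FSup" "N \<in> Obj DMS_FSup" "P \<in> Obj DMS_FSup"
      and "iso_in DMS_FSup M N e \<and> f \<in> FSupB_hom N P"
    then have f: "f \<in> FSupB_hom N P" and iso: "iso_in DMS_FSup M N e" by auto
    note sl = Ob[THEN Obj_DMS_semilattice]
    have "compose (carrier M) f e z = w" if "least M z (carrier M)" "least P w (carrier P)" for z w
      using f that least_transfer[OF Ob(1,2) iso that(1)]
      by (simp add: FSupB_hom_iff[OF sl(2,3)] compose_def least_iff)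
    moreover have "compose (carrier M) f e \<in> FSup_hom M P"
      using f iso_in_hom[OF iso] by (auto simp: Hom_DMS FSupB_hom_def intro: FSup_hom_compose[OF _ _ sl(1)])
    ultimately show "Comp DMS_FSup M N P f e \<in> FSupB_hom M P"
      by (simp add: Comp_DMS FSupB_hom_iff[OF sl(1,3)])
  qed
qed

text \<open>
  Filters of a semilattice and admissible sets of a space are sets of elements of the universe, and
  have to be represented by elements of it. Here \<open>P\<close> consists of names for certain sets and \<open>d\<close>
  decodes a name.
\<close>

definition set_order :: "'p set \<Rightarrow> ('p \<Rightarrow> 'a set) \<Rightarrow> 'p gorder" where
  "set_order P d = \<lparr>carrier = P, eq = (=), le = (\<lambda>x y. d x \<subseteq> d y)\<rparr>"

lemma set_order_simps [simp]:
  "carrier (set_order P d) = P" "x \<sqsubseteq>\<^bsub>set_order P d\<^esub> y \<longleftrightarrow> d x \<subseteq> d y"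
  by (simp_all add: set_order_def)

lemma partial_order_set_order: "inj_on d P \<Longrightarrow> partial_order (set_order P d)"
  by (rule partial_orderI) (auto simp: set_order_def dest: inj_onD)

lemma lepoll_bij_betw:
  fixes A :: "'b set"
  assumes "A \<lesssim> (UNIV :: 'u set)"
  obtains P d where "bij_betw d (P :: 'u set) A"
proof -
  obtain f :: "'b \<Rightarrow> 'u" where "inj_on f A" using assms by (auto simp: lepoll_def)
  then have "bij_betw (inv_into A f) (f ` A) A" by (intro bij_betw_inv_into) (simp add: bij_betw_def)
  then show ?thesis using that by blast
qed

lemma small_subset_Pow: "small TYPE('u) A \<Longrightarrow> S \<subseteq> Pow A \<Longrightarrow> S \<lesssim> (UNIV :: 'u set)"
  unfolding small_def by (meson lepoll_trans subset_imp_lepoll)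

lemma small_lepoll:
  assumes "small TYPE('u) A" "B \<lesssim> A" shows "small TYPE('u) B"
proof -
  obtain f where "inj_on f B" "f ` B \<subseteq> A" using assms(2) by (auto simp: lepoll_def)
  then have "Pow B \<lesssim> Pow A"
    unfolding lepoll_def by (intro exI[of _ "image f"]) (auto intro: inj_on_image_Pow)
  then show ?thesis using assms(1) lepoll_trans unfolding small_def by blast
qed

lemma small_self: "small TYPE('u) A \<Longrightarrow> A \<lesssim> (UNIV :: 'u set)"
  unfolding small_def using lepoll_Pow_self lepoll_trans by blast

section \<open>Compact elements of an algebraic frame\<close>

lemma complete_lattice_partial_order: "complete_lattice L \<Longrightarrow> partial_order L"
  by (simp add: complete_lattice_def)

lemma complete_lattice_weak: "complete_lattice L \<Longrightarrow> weak_complete_lattice L"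
  by (simp add: complete_lattice.axioms partial_order_def weak_complete_lattice_def
      weak_complete_lattice_axioms_def complete_lattice_def complete_lattice_axioms_def)

lemma complete_lattice_sup_closed: "complete_lattice L \<Longrightarrow> S \<subseteq> carrier L \<Longrightarrow> \<Squnion>\<^bsub>L\<^esub> S \<in> carrier L"
  and complete_lattice_sup_upper:
    "complete_lattice L \<Longrightarrow> S \<subseteq> carrier L \<Longrightarrow> x \<in> S \<Longrightarrow> x \<sqsubseteq>\<^bsub>L\<^esub> \<Squnion>\<^bsub>L\<^esub> S"
  and complete_lattice_sup_least:
    "complete_lattice L \<Longrightarrow> S \<subseteq> carrier L \<Longrightarrow> y \<in> carrier L \<Longrightarrow> (\<And>x. x \<in> S \<Longrightarrow> x \<sqsubseteq>\<^bsub>L\<^esub> y)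
      \<Longrightarrow> \<Squnion>\<^bsub>L\<^esub> S \<sqsubseteq>\<^bsub>L\<^esub> y"
  and complete_lattice_inf: "complete_lattice L \<Longrightarrow> S \<subseteq> carrier L \<Longrightarrow> is_glb L (\<Sqinter>\<^bsub>L\<^esub> S) S"
  using weak_complete_lattice.sup_closed[of L S] weak_complete_lattice.sup_upper[of L S x]
    weak_complete_lattice.sup_least[of L S y] weak_complete_lattice.inf_glb[of L S]
  by (simp_all add: complete_lattice_weak)

lemma complete_lattice_sup_mono:
  assumes L: "complete_lattice L" and S: "S \<subseteq> carrier L" "T \<subseteq> carrier L"
    and le: "\<And>x. x \<in> S \<Longrightarrow> \<exists>y\<in>T. x \<sqsubseteq>\<^bsub>L\<^esub> y"
  shows "\<Squnion>\<^bsub>L\<^esub> S \<sqsubseteq>\<^bsub>L\<^esub> \<Squnion>\<^bsub>L\<^esub> T"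
proof (rule complete_lattice_sup_least[OF L S(1) complete_lattice_sup_closed[OF L S(2)]])
  fix x assume "x \<in> S"
  then obtain y where "y \<in> T" "x \<sqsubseteq>\<^bsub>L\<^esub> y" using le by blast
  then show "x \<sqsubseteq>\<^bsub>L\<^esub> \<Squnion>\<^bsub>L\<^esub> T"
    using complete_lattice_sup_upper[OF L S(2), of y] complete_lattice_sup_closed[OF L S(2)]
      subsetD[OF S(1) \<open>x \<in> S\<close>] subsetD[OF S(2)]
      partial_order_trans[OF complete_lattice_partial_order[OF L], of x y "\<Squnion>\<^bsub>L\<^esub> T"] by simp
qed

lemma algebraic_frame_complete: "algebraic_frame L \<Longrightarrow> complete_lattice L"
  by (simp add: algebraic_frame_def frame_def)

lemma compact_elements_subset: "compact_elements L \<subseteq> carrier L"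
  by (auto simp: compact_elements_def)

lemma compact_elementsD:
  assumes "k \<in> compact_elements L" "S \<subseteq> carrier L" "k \<sqsubseteq>\<^bsub>L\<^esub> \<Squnion>\<^bsub>L\<^esub> S"
  shows "\<exists>T\<subseteq>S. finite T \<and> k \<sqsubseteq>\<^bsub>L\<^esub> \<Squnion>\<^bsub>L\<^esub> T"
  using assms unfolding compact_elements_def by simp

lemma compact_elementsI:
  assumes "k \<in> carrier L"
    and "\<And>S. \<lbrakk>S \<subseteq> carrier L; k \<sqsubseteq>\<^bsub>L\<^esub> \<Squnion>\<^bsub>L\<^esub> S\<rbrakk> \<Longrightarrow> \<exists>T\<subseteq>S. finite T \<and> k \<sqsubseteq>\<^bsub>L\<^esub> \<Squnion>\<^bsub>L\<^esub> T"
  shows "k \<in> compact_elements L"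
  using assms unfolding compact_elements_def by simp

lemma compact_elements_sup:
  assumes L: "complete_lattice L" and F: "F \<subseteq> compact_elements L" "finite F"
  shows "\<Squnion>\<^bsub>L\<^esub> F \<in> compact_elements L"
proof -
  have Fc: "F \<subseteq> carrier L" using F(1) compact_elements_subset[of L] by (rule subset_trans)
  note cl = complete_lattice_sup_closed[OF L]
  note tr = partial_order_trans[OF complete_lattice_partial_order[OF L]]
  have "\<exists>T\<subseteq>S. finite T \<and> \<Squnion>\<^bsub>L\<^esub> F \<sqsubseteq>\<^bsub>L\<^esub> \<Squnion>\<^bsub>L\<^esub> T" if S: "S \<subseteq> carrier L" and le: "\<Squnion>\<^bsub>L\<^esub> F \<sqsubseteq>\<^bsub>L\<^esub> \<Squnion>\<^bsub>L\<^esub> S" for S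
  proof -
    have "\<exists>T\<subseteq>S. finite T \<and> k \<sqsubseteq>\<^bsub>L\<^esub> \<Squnion>\<^bsub>L\<^esub> T" if "k \<in> F" for k
    proof -
      have "k \<sqsubseteq>\<^bsub>L\<^esub> \<Squnion>\<^bsub>L\<^esub> S"
        using tr[OF subsetD[OF Fc that] cl[OF Fc] cl[OF S] complete_lattice_sup_upper[OF L Fc that] le] .
      then show ?thesis using compact_elementsD[OF _ S] F(1) that by blast
    qed
    then have "\<forall>k\<in>F. \<exists>T. T \<subseteq> S \<and> finite T \<and> k \<sqsubseteq>\<^bsub>L\<^esub> \<Squnion>\<^bsub>L\<^esub> T" by simp
    from bchoice[OF this] obtain T
      where T: "\<And>k. k \<in> F \<Longrightarrow> T k \<subseteq> S \<and> finite (T k) \<and> k \<sqsubseteq>\<^bsub>L\<^esub> \<Squnion>\<^bsub>L\<^esub> (T k)"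
      by auto
    have TS: "(\<Union>k\<in>F. T k) \<subseteq> S" using T by blast
    then have Tc: "(\<Union>k\<in>F. T k) \<subseteq> carrier L" using S by blast
    have "k \<sqsubseteq>\<^bsub>L\<^esub> \<Squnion>\<^bsub>L\<^esub> (\<Union>k\<in>F. T k)" if "k \<in> F" for k
    proof -
      have Tk: "T k \<subseteq> carrier L" using T[OF that] S by blast
      have "\<Squnion>\<^bsub>L\<^esub> (T k) \<sqsubseteq>\<^bsub>L\<^esub> \<Squnion>\<^bsub>L\<^esub> (\<Union>k\<in>F. T k)"
        using that by (intro complete_lattice_sup_least[OF L Tk cl[OF Tc]]
            complete_lattice_sup_upper[OF L Tc]) (rule UN_I)
      then show ?thesis using tr[OF subsetD[OF Fc that] cl[OF Tk] cl[OF Tc]] T[OF that] by simp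
    qed
    then have "\<Squnion>\<^bsub>L\<^esub> F \<sqsubseteq>\<^bsub>L\<^esub> \<Squnion>\<^bsub>L\<^esub> (\<Union>k\<in>F. T k)"
      by (rule complete_lattice_sup_least[OF L Fc cl[OF Tc]])
    moreover have "finite (\<Union>k\<in>F. T k)" using T F(2) by simp
    ultimately show ?thesis using TS by blast
  qed
  then show ?thesis by (rule compact_elementsI[OF cl[OF Fc]])
qed

lemma algebraic_frame_sup_compact:
  assumes L: "algebraic_frame L" and a: "a \<in> carrier L"
  shows "\<Squnion>\<^bsub>L\<^esub> {k \<in> compact_elements L. k \<sqsubseteq>\<^bsub>L\<^esub> a} = a"
proof -
  note cl = algebraic_frame_complete[OF L]
  let ?K = "{k \<in> compact_elements L. k \<sqsubseteq>\<^bsub>L\<^esub> a}"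
  obtain S where S: "S \<subseteq> compact_elements L" "a = \<Squnion>\<^bsub>L\<^esub> S" using L a by (auto simp: algebraic_frame_def)
  have Sc: "S \<subseteq> carrier L" and Kc: "?K \<subseteq> carrier L" using S(1) compact_elements_subset[of L] by blast+
  have "S \<subseteq> ?K" using S complete_lattice_sup_upper[OF cl Sc] by auto
  then have "a \<sqsubseteq>\<^bsub>L\<^esub> \<Squnion>\<^bsub>L\<^esub> ?K"
    using complete_lattice_sup_least[OF cl Sc complete_lattice_sup_closed[OF cl Kc]
        complete_lattice_sup_upper[OF cl Kc subsetD]] S(2) by simp
  moreover have "\<Squnion>\<^bsub>L\<^esub> ?K \<sqsubseteq>\<^bsub>L\<^esub> a" by (rule complete_lattice_sup_least[OF cl Kc a]) simp
  ultimately show ?thesis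
    using partial_order_antisym[OF complete_lattice_partial_order[OF cl]]
      complete_lattice_sup_closed[OF cl Kc] a by blast
qed

lemma algebraic_frame_le:
  assumes L: "algebraic_frame L" and a: "a \<in> carrier L" and b: "b \<in> carrier L"
    and "\<And>k. k \<in> compact_elements L \<Longrightarrow> k \<sqsubseteq>\<^bsub>L\<^esub> a \<Longrightarrow> k \<sqsubseteq>\<^bsub>L\<^esub> b"
  shows "a \<sqsubseteq>\<^bsub>L\<^esub> b"
proof -
  have "\<Squnion>\<^bsub>L\<^esub> {k \<in> compact_elements L. k \<sqsubseteq>\<^bsub>L\<^esub> a} \<sqsubseteq>\<^bsub>L\<^esub> b"
    by (rule complete_lattice_sup_least[OF algebraic_frame_complete[OF L] _ b])
      (use assms(4) compact_elements_subset[of L] in auto)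
  then show ?thesis by (simp add: algebraic_frame_sup_compact[OF L a])
qed

text \<open>
  Each element of \<open>S\<close> is the join of the compact elements below it, so the cover of \<open>k\<close> by \<open>S\<close> may be
  refined to a cover by compact elements before a finite part is selected.
\<close>

lemma compact_below_sup:
  assumes L: "algebraic_frame L" and S: "S \<subseteq> carrier L" and k: "k \<in> compact_elements L" "k \<sqsubseteq>\<^bsub>L\<^esub> \<Squnion>\<^bsub>L\<^esub> S"
  obtains T where "finite T" "T \<subseteq> {j \<in> compact_elements L. \<exists>s\<in>S. j \<sqsubseteq>\<^bsub>L\<^esub> s}" "k \<sqsubseteq>\<^bsub>L\<^esub> \<Squnion>\<^bsub>L\<^esub> T"
proof -
  note cl = algebraic_frame_complete[OF L]
  let ?J = "{j \<in> compact_elements L. \<exists>s\<in>S. j \<sqsubseteq>\<^bsub>L\<^esub> s}"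
  have J: "?J \<subseteq> carrier L" using compact_elements_subset[of L] by blast
  have "s \<sqsubseteq>\<^bsub>L\<^esub> \<Squnion>\<^bsub>L\<^esub> ?J" if "s \<in> S" for s
  proof (rule algebraic_frame_le[OF L subsetD[OF S that] complete_lattice_sup_closed[OF cl J]])
    fix k assume "k \<in> compact_elements L" "k \<sqsubseteq>\<^bsub>L\<^esub> s"
    then show "k \<sqsubseteq>\<^bsub>L\<^esub> \<Squnion>\<^bsub>L\<^esub> ?J" using that by (intro complete_lattice_sup_upper[OF cl J]) auto
  qed
  then have "\<Squnion>\<^bsub>L\<^esub> S \<sqsubseteq>\<^bsub>L\<^esub> \<Squnion>\<^bsub>L\<^esub> ?J"
    by (rule complete_lattice_sup_least[OF cl S complete_lattice_sup_closed[OF cl J]])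
  then have "k \<sqsubseteq>\<^bsub>L\<^esub> \<Squnion>\<^bsub>L\<^esub> ?J"
    using partial_order_trans[OF complete_lattice_partial_order[OF cl] subsetD[OF compact_elements_subset k(1)]
        complete_lattice_sup_closed[OF cl S] complete_lattice_sup_closed[OF cl J] k(2)] by simp
  then have "\<exists>T\<subseteq>?J. finite T \<and> k \<sqsubseteq>\<^bsub>L\<^esub> \<Squnion>\<^bsub>L\<^esub> T" by (rule compact_elementsD[OF k(1) J])
  then show ?thesis using that by blast
qed

text \<open>
  By the frame law \<open>c\<close> is the join of \<open>c \<sqinter> a\<close> and \<open>c \<sqinter> b\<close>. Finitely many compact elements below one
  of these two already cover \<open>c\<close>; the join of those below \<open>c \<sqinter> a\<close> is \<open>a'\<close>, the join of the others \<open>b'\<close>.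
  This is distributivity of the semilattice of compact elements.
\<close>

lemma compact_splits:
  assumes L: "algebraic_frame L" and ab: "a \<in> carrier L" "b \<in> carrier L"
    and c: "c \<in> compact_elements L" "c \<sqsubseteq>\<^bsub>L\<^esub> \<Squnion>\<^bsub>L\<^esub> {a, b}"
  obtains a' b' where "a' \<in> compact_elements L" "b' \<in> compact_elements L"
    "a' \<sqsubseteq>\<^bsub>L\<^esub> a" "b' \<sqsubseteq>\<^bsub>L\<^esub> b" "is_lub L c {a', b'}"
proof -
  note cl = algebraic_frame_complete[OF L]
  note po = complete_lattice_partial_order[OF cl]
  have cc: "c \<in> carrier L" using c(1) compact_elements_subset[of L] by blast
  have glb: "is_glb L (c \<sqinter>\<^bsub>L\<^esub> x) {c, x}" if "x \<in> carrier L" for x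
    unfolding meet_def using complete_lattice_inf[OF cl, of "{c, x}"] cc that by blast
  have m: "c \<sqinter>\<^bsub>L\<^esub> x \<in> carrier L" "c \<sqinter>\<^bsub>L\<^esub> x \<sqsubseteq>\<^bsub>L\<^esub> c" "c \<sqinter>\<^bsub>L\<^esub> x \<sqsubseteq>\<^bsub>L\<^esub> x"
    "y \<in> carrier L \<Longrightarrow> y \<sqsubseteq>\<^bsub>L\<^esub> c \<Longrightarrow> y \<sqsubseteq>\<^bsub>L\<^esub> x \<Longrightarrow> y \<sqsubseteq>\<^bsub>L\<^esub> c \<sqinter>\<^bsub>L\<^esub> x" if "x \<in> carrier L" for x y
    using glb[OF that] cc that by (auto simp: is_glb_iff)
  let ?S = "{c \<sqinter>\<^bsub>L\<^esub> a, c \<sqinter>\<^bsub>L\<^esub> b}"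
  have "c \<sqinter>\<^bsub>L\<^esub> \<Squnion>\<^bsub>L\<^esub> {a, b} = \<Squnion>\<^bsub>L\<^esub> ?S"
    using L cc ab by (simp add: algebraic_frame_def frame_def)
  moreover have "c \<sqsubseteq>\<^bsub>L\<^esub> c \<sqinter>\<^bsub>L\<^esub> \<Squnion>\<^bsub>L\<^esub> {a, b}"
    using m(4)[OF complete_lattice_sup_closed[OF cl, of "{a, b}"] cc] ab c(2) partial_order_refl[OF po cc] by simp
  ultimately have "c \<sqsubseteq>\<^bsub>L\<^esub> \<Squnion>\<^bsub>L\<^esub> ?S" by simp
  moreover have "?S \<subseteq> carrier L" using m(1) ab by simp
  ultimately obtain T where T: "finite T" "T \<subseteq> {j \<in> compact_elements L. \<exists>s\<in>?S. j \<sqsubseteq>\<^bsub>L\<^esub> s}" "c \<sqsubseteq>\<^bsub>L\<^esub> \<Squnion>\<^bsub>L\<^esub> T"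
    using compact_below_sup[OF L, of ?S c thesis] c(1) by simp
  have Tc: "T \<subseteq> carrier L" using T(2) compact_elements_subset[of L] by blast
  have part: "\<Squnion>\<^bsub>L\<^esub> {j \<in> T. j \<sqsubseteq>\<^bsub>L\<^esub> c \<sqinter>\<^bsub>L\<^esub> x} \<in> compact_elements L"
    "\<Squnion>\<^bsub>L\<^esub> {j \<in> T. j \<sqsubseteq>\<^bsub>L\<^esub> c \<sqinter>\<^bsub>L\<^esub> x} \<sqsubseteq>\<^bsub>L\<^esub> x" "\<Squnion>\<^bsub>L\<^esub> {j \<in> T. j \<sqsubseteq>\<^bsub>L\<^esub> c \<sqinter>\<^bsub>L\<^esub> x} \<sqsubseteq>\<^bsub>L\<^esub> c" if "x \<in> carrier L" for x
  proof -
    let ?R = "{j \<in> T. j \<sqsubseteq>\<^bsub>L\<^esub> c \<sqinter>\<^bsub>L\<^esub> x}"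
    have R: "?R \<subseteq> carrier L" "?R \<subseteq> compact_elements L" using Tc T(2) by blast+
    then show "\<Squnion>\<^bsub>L\<^esub> ?R \<in> compact_elements L" using compact_elements_sup[OF cl] T(1) by simp
    have "\<Squnion>\<^bsub>L\<^esub> ?R \<sqsubseteq>\<^bsub>L\<^esub> c \<sqinter>\<^bsub>L\<^esub> x" using complete_lattice_sup_least[OF cl R(1) m(1)[OF that]] by simp
    then show "\<Squnion>\<^bsub>L\<^esub> ?R \<sqsubseteq>\<^bsub>L\<^esub> x" "\<Squnion>\<^bsub>L\<^esub> ?R \<sqsubseteq>\<^bsub>L\<^esub> c"
      using partial_order_trans[OF po complete_lattice_sup_closed[OF cl R(1)] m(1)[OF that]] m(2,3)[OF that] that cc
      by simp_all
  qed
  let ?A = "\<Squnion>\<^bsub>L\<^esub> {j \<in> T. j \<sqsubseteq>\<^bsub>L\<^esub> c \<sqinter>\<^bsub>L\<^esub> a}" and ?B = "\<Squnion>\<^bsub>L\<^esub> {j \<in> T. j \<sqsubseteq>\<^bsub>L\<^esub> c \<sqinter>\<^bsub>L\<^esub> b}"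
  have AB: "{?A, ?B} \<subseteq> carrier L" using part(1) ab compact_elements_subset[of L] by blast
  have "c \<sqsubseteq>\<^bsub>L\<^esub> u" if u: "u \<in> carrier L" "?A \<sqsubseteq>\<^bsub>L\<^esub> u" "?B \<sqsubseteq>\<^bsub>L\<^esub> u" for u
  proof -
    have "j \<sqsubseteq>\<^bsub>L\<^esub> u" if "j \<in> T" for j
    proof -
      have "j \<sqsubseteq>\<^bsub>L\<^esub> ?A \<or> j \<sqsubseteq>\<^bsub>L\<^esub> ?B"
        using subsetD[OF T(2) that] that Tc
          complete_lattice_sup_upper[OF cl, of "{j \<in> T. j \<sqsubseteq>\<^bsub>L\<^esub> c \<sqinter>\<^bsub>L\<^esub> a}" j]
          complete_lattice_sup_upper[OF cl, of "{j \<in> T. j \<sqsubseteq>\<^bsub>L\<^esub> c \<sqinter>\<^bsub>L\<^esub> b}" j] by auto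
      then show ?thesis
        using partial_order_trans[OF po subsetD[OF Tc that] _ u(1), of ?A]
          partial_order_trans[OF po subsetD[OF Tc that] _ u(1), of ?B] u AB by auto
    qed
    then have "\<Squnion>\<^bsub>L\<^esub> T \<sqsubseteq>\<^bsub>L\<^esub> u" by (rule complete_lattice_sup_least[OF cl Tc u(1)])
    then show ?thesis
      by (rule partial_order_trans[OF po cc complete_lattice_sup_closed[OF cl Tc] u(1) T(3)])
  qed
  then have "is_lub L c {?A, ?B}" unfolding is_lub_iff[OF AB] using part(3) ab cc by simp
  then show ?thesis using that part ab by blast
qed

text \<open>
  Joins of compact elements are compact while meets need not be, so the order is reversed to obtain a
  meet-semilattice. Its top is the bottom of the frame.
\<close>

definition compact_dual :: "'a gorder \<Rightarrow> 'a gorder" where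
  "compact_dual L = \<lparr>carrier = compact_elements L, eq = (=), le = (\<lambda>x y. y \<sqsubseteq>\<^bsub>L\<^esub> x)\<rparr>"

lemma compact_dual_simps [simp]:
  "carrier (compact_dual L) = compact_elements L" "x \<sqsubseteq>\<^bsub>compact_dual L\<^esub> y \<longleftrightarrow> y \<sqsubseteq>\<^bsub>L\<^esub> x"
  by (simp_all add: compact_dual_def)

lemma compact_dual_partial_order:
  assumes "partial_order L" shows "partial_order (compact_dual L)"
proof (rule partial_orderI)
  show "eq (compact_dual L) = (=)" by (simp add: compact_dual_def)
next
  fix x assume "x \<in> carrier (compact_dual L)"
  then show "x \<sqsubseteq>\<^bsub>compact_dual L\<^esub> x"
    using partial_order_refl[OF assms] subsetD[OF compact_elements_subset[of L]] by simp
next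
  fix x y assume "x \<in> carrier (compact_dual L)" "y \<in> carrier (compact_dual L)"
    "x \<sqsubseteq>\<^bsub>compact_dual L\<^esub> y" "y \<sqsubseteq>\<^bsub>compact_dual L\<^esub> x"
  then show "x = y"
    using partial_order_antisym[OF assms, of x y] subsetD[OF compact_elements_subset[of L]] by simp
next
  fix x y z assume "x \<in> carrier (compact_dual L)" "y \<in> carrier (compact_dual L)" "z \<in> carrier (compact_dual L)"
    "x \<sqsubseteq>\<^bsub>compact_dual L\<^esub> y" "y \<sqsubseteq>\<^bsub>compact_dual L\<^esub> z"
  then show "x \<sqsubseteq>\<^bsub>compact_dual L\<^esub> z"
    using partial_order_trans[OF assms, of z y x] subsetD[OF compact_elements_subset[of L]] by simp
qed

lemma compact_dual_glb:
  assumes L: "complete_lattice L" and F: "F \<subseteq> compact_elements L" "finite F"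
  shows "is_glb (compact_dual L) (\<Squnion>\<^bsub>L\<^esub> F) F"
proof -
  have Fc: "F \<subseteq> carrier L" using F(1) compact_elements_subset[of L] by (rule subset_trans)
  have "\<Squnion>\<^bsub>L\<^esub> F \<sqsubseteq>\<^bsub>L\<^esub> y" if "y \<in> compact_elements L" "\<forall>x\<in>F. x \<sqsubseteq>\<^bsub>L\<^esub> y" for y
    using complete_lattice_sup_least[OF L Fc, of y] that subsetD[OF compact_elements_subset[of L]] by simp
  then show ?thesis
    using compact_elements_sup[OF L F] complete_lattice_sup_upper[OF L Fc] F(1) by (simp add: is_glb_iff)
qed

lemma compact_dual_inf:
  assumes "complete_lattice L" "F \<subseteq> compact_elements L" "finite F"
  shows "\<Sqinter>\<^bsub>compact_dual L\<^esub> F = \<Squnion>\<^bsub>L\<^esub> F"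
  by (rule inf_eqI[OF compact_dual_partial_order[OF complete_lattice_partial_order] compact_dual_glb]) (fact assms)+

text \<open>
  An infimum formed among the compact elements is an infimum in the frame, because every lower bound is
  a join of compact lower bounds. This matches the infima that \<open>FInf_hom\<close> has to preserve with the existing
  suprema that \<open>FSup_hom\<close> has to preserve.
\<close>

lemma compact_dual_lub:
  assumes L: "algebraic_frame L" and F: "F \<subseteq> compact_elements L"
  shows "is_lub (compact_dual L) s F \<longleftrightarrow> s \<in> compact_elements L \<and> s = \<Sqinter>\<^bsub>L\<^esub> F"
proof -
  note cl = algebraic_frame_complete[OF L]
  note po = complete_lattice_partial_order[OF cl]
  have Fc: "F \<subseteq> carrier L" using F compact_elements_subset[of L] by blast
  have glb: "is_glb L (\<Sqinter>\<^bsub>L\<^esub> F) F" by (rule complete_lattice_inf[OF cl Fc])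
  have "is_glb L s F" if s: "is_lub (compact_dual L) s F"
  proof -
    have sc: "s \<in> carrier L" "s \<in> compact_elements L" using s F compact_elements_subset[of L] by (auto simp: is_lub_iff)
    have "y \<sqsubseteq>\<^bsub>L\<^esub> s" if y: "y \<in> carrier L" "\<forall>x\<in>F. y \<sqsubseteq>\<^bsub>L\<^esub> x" for y
    proof (rule algebraic_frame_le[OF L y(1) sc(1)])
      fix k assume k: "k \<in> compact_elements L" "k \<sqsubseteq>\<^bsub>L\<^esub> y"
      then have "k \<in> carrier L" using compact_elements_subset[of L] by blast
      then have "\<forall>x\<in>F. k \<sqsubseteq>\<^bsub>L\<^esub> x"
        using partial_order_trans[OF po _ y(1) _ k(2)] y(2) subsetD[OF Fc] by simp
      then show "k \<sqsubseteq>\<^bsub>L\<^esub> s" using s k(1) F by (simp add: is_lub_iff)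
    qed
    then show ?thesis using s sc F by (simp add: is_lub_iff is_glb_iff[OF Fc])
  qed
  moreover have "is_lub (compact_dual L) (\<Sqinter>\<^bsub>L\<^esub> F) F" if "\<Sqinter>\<^bsub>L\<^esub> F \<in> compact_elements L"
    using glb that F compact_elements_subset[of L] by (auto simp: is_lub_iff is_glb_iff[OF Fc])
  moreover have "s \<in> compact_elements L" if "is_lub (compact_dual L) s F"
    using that F by (simp add: is_lub_iff)
  ultimately show ?thesis using inf_eqI[OF po, of s F] by auto
qed

lemma compact_dual_meet:
  assumes "complete_lattice L" "a \<in> compact_elements L" "b \<in> compact_elements L"
  shows "a \<sqinter>\<^bsub>compact_dual L\<^esub> b = \<Squnion>\<^bsub>L\<^esub> {a, b}"
  unfolding meet_def using assms by (simp add: compact_dual_inf)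

lemma compact_dual_semilattice: 
  assumes "complete_lattice L" shows "meet_semilattice (compact_dual L)"
  using compact_dual_glb[OF assms] compact_dual_partial_order[OF complete_lattice_partial_order[OF assms]]
  unfolding meet_semilattice_def by auto

lemma compact_dual_distributive:
  assumes L: "algebraic_frame L" shows "distributive_semilattice (compact_dual L)"
proof -
  note cl = algebraic_frame_complete[OF L]
  have "\<exists>a'\<in>compact_elements L. \<exists>b'\<in>compact_elements L.
      a' \<sqsubseteq>\<^bsub>L\<^esub> a \<and> b' \<sqsubseteq>\<^bsub>L\<^esub> b \<and> a' \<sqinter>\<^bsub>compact_dual L\<^esub> b' = c"
    if abc: "a \<in> compact_elements L" "b \<in> compact_elements L" "c \<in> compact_elements L"
      and le: "c \<sqsubseteq>\<^bsub>L\<^esub> a \<sqinter>\<^bsub>compact_dual L\<^esub> b" for a b c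
  proof -
    have "a \<in> carrier L" "b \<in> carrier L" using abc compact_elements_subset[of L] by blast+
    moreover have "c \<sqsubseteq>\<^bsub>L\<^esub> \<Squnion>\<^bsub>L\<^esub> {a, b}" using le compact_dual_meet[OF cl abc(1,2)] by simp
    ultimately obtain a' b' where ab': "a' \<in> compact_elements L" "b' \<in> compact_elements L"
      "a' \<sqsubseteq>\<^bsub>L\<^esub> a" "b' \<sqsubseteq>\<^bsub>L\<^esub> b" "is_lub L c {a', b'}"
      using compact_splits[OF L, of a b c thesis] abc(3) by simp
    have "a' \<sqinter>\<^bsub>compact_dual L\<^esub> b' = c"
      using sup_eqI[OF complete_lattice_partial_order[OF cl] ab'(5)] compact_dual_meet[OF cl ab'(1,2)] by simp
    then show ?thesis using ab' by blast
  qed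
  then show ?thesis
    using compact_dual_semilattice[OF cl] unfolding distributive_semilattice_def by auto
qed

lemma Obj_AlgFrm: "Obj AlgFrm_FInf = {L :: 'u gorder. algebraic_frame L \<and> small TYPE('u) (compact_elements L)}"
  and Hom_AlgFrm: "Hom AlgFrm_FInf = (FInf_hom :: 'u gorder \<Rightarrow> 'u gorder \<Rightarrow> _)"
  and Id_AlgFrm: "Id AlgFrm_FInf = (\<lambda>L :: 'u gorder. \<lambda>x\<in>carrier L. x)"
  and Comp_AlgFrm: "Comp AlgFrm_FInf = (\<lambda>L M N :: 'u gorder. \<lambda>g f. compose (carrier L) g f)"
  by (simp_all add: AlgFrm_FInf_def concrete_cat_def)

lemma FInf_hom_id: "algebraic_frame L \<Longrightarrow> (\<lambda>x\<in>carrier L. x) \<in> FInf_hom L L"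
proof -
  assume L: "algebraic_frame L"
  have "(\<lambda>x\<in>carrier L. x) ` S = S" if "S \<subseteq> carrier L" for S
    using that by auto
  then show ?thesis
    using complete_lattice_sup_closed[OF algebraic_frame_complete[OF L]] compact_elements_subset[of L]
    by (auto simp: FInf_hom_def)
qed

lemma FInf_hom_compact: "f \<in> FInf_hom L M \<Longrightarrow> k \<in> compact_elements L \<Longrightarrow> f k \<in> compact_elements M"
  unfolding FInf_hom_def image_subset_iff by simp

lemma FInf_hom_compose:
  assumes f: "f \<in> FInf_hom L M" and g: "g \<in> FInf_hom M N" and L: "algebraic_frame L"
  shows "compose (carrier L) g f \<in> FInf_hom L N"
proof -
  have fM: "f ` S \<subseteq> carrier M" if "S \<subseteq> carrier L" for S
    using f that by (auto simp: FInf_hom_def)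
  have fK: "f ` S \<subseteq> compact_elements M" if "S \<subseteq> compact_elements L" for S
    using FInf_hom_compact[OF f] that by auto
  have im: "compose (carrier L) g f ` S = g ` f ` S" if "S \<subseteq> carrier L" for S
    using that by (auto simp: compose_def image_image subset_iff)
  note Kc = compact_elements_subset[of L]
  have "compose (carrier L) g f \<in> carrier L \<rightarrow>\<^sub>E carrier N"
    using f g by (auto simp: FInf_hom_def compose_def)
  moreover have "compose (carrier L) g f (\<Squnion>\<^bsub>L\<^esub> S) = \<Squnion>\<^bsub>N\<^esub> (compose (carrier L) g f ` S)" if "S \<subseteq> carrier L" for S
    using f g fM[OF that] that complete_lattice_sup_closed[OF algebraic_frame_complete[OF L] that]
    unfolding im[OF that] by (simp add: FInf_hom_def compose_def)
  moreover have "compose (carrier L) g f ` compact_elements L \<subseteq> compact_elements N"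
    unfolding im[OF Kc] using FInf_hom_compact[OF f] FInf_hom_compact[OF g] by auto
  moreover have "compose (carrier L) g f (\<Sqinter>\<^bsub>L\<^esub> S) = \<Sqinter>\<^bsub>N\<^esub> (compose (carrier L) g f ` S)"
    if S: "S \<subseteq> compact_elements L" "S \<noteq> {}" "finite S" "\<Sqinter>\<^bsub>L\<^esub> S \<in> compact_elements L" for S
  proof -
    have fS: "f (\<Sqinter>\<^bsub>L\<^esub> S) = \<Sqinter>\<^bsub>M\<^esub> (f ` S)" using f S by (simp add: FInf_hom_def)
    with FInf_hom_compact[OF f S(4)] have "g (f (\<Sqinter>\<^bsub>L\<^esub> S)) = \<Sqinter>\<^bsub>N\<^esub> (g ` f ` S)"
      using g fK[OF S(1)] S(2,3) by (simp add: FInf_hom_def)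
    moreover have "S \<subseteq> carrier L" "\<Sqinter>\<^bsub>L\<^esub> S \<in> carrier L" using S Kc by blast+
    ultimately show ?thesis unfolding im[OF \<open>S \<subseteq> carrier L\<close>] by (simp add: compose_def)
  qed
  ultimately show ?thesis by (auto simp: FInf_hom_def)
qed

lemma FInf_hom_funcset: "FInf_hom L M \<subseteq> carrier L \<rightarrow>\<^sub>E carrier M"
  by (auto simp: FInf_hom_def)

lemma category_AlgFrm: "category AlgFrm_FInf"
  unfolding AlgFrm_FInf_def
  by (rule category_concrete[OF FInf_hom_funcset]) (simp_all add: FInf_hom_id FInf_hom_compose)

lemma FInf_hom_restrict:
  assumes L: "algebraic_frame L" and M: "algebraic_frame M" and f: "f \<in> FInf_hom L M"
  shows "restrict f (compact_elements L) \<in> FSup_hom (compact_dual L) (compact_dual M)"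
proof -
  note clL = algebraic_frame_complete[OF L] and clM = algebraic_frame_complete[OF M]
  let ?f = "restrict f (compact_elements L)"
  have im: "?f ` F = f ` F" "f ` F \<subseteq> compact_elements M" if "F \<subseteq> compact_elements L" for F
    using FInf_hom_compact[OF f] that by auto
  have "?f (\<Sqinter>\<^bsub>compact_dual L\<^esub> F) = \<Sqinter>\<^bsub>compact_dual M\<^esub> (?f ` F)"
    if F: "F \<subseteq> compact_elements L" "finite F" for F
  proof -
    have "F \<subseteq> carrier L" using F compact_elements_subset[of L] by blast
    then have "f (\<Squnion>\<^bsub>L\<^esub> F) = \<Squnion>\<^bsub>M\<^esub> (f ` F)" using f by (simp add: FInf_hom_def)
    then show ?thesis
      using F im(2)[OF F(1)] compact_elements_sup[OF clL F] unfolding im(1)[OF F(1)]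
      by (simp add: compact_dual_inf[OF clL] compact_dual_inf[OF clM])
  qed
  moreover have "is_lub (compact_dual M) (?f s) (?f ` F)"
    if F: "F \<subseteq> compact_elements L" "finite F" "F \<noteq> {}" "is_lub (compact_dual L) s F" for F s
  proof -
    have s: "s \<in> compact_elements L" "s = \<Sqinter>\<^bsub>L\<^esub> F" using F(4) unfolding compact_dual_lub[OF L F(1)] by blast+
    have "f (\<Sqinter>\<^bsub>L\<^esub> F) = \<Sqinter>\<^bsub>M\<^esub> (f ` F)"
      using f F(1-3) s(1) unfolding s(2) FInf_hom_def by simp
    then have "f s = \<Sqinter>\<^bsub>M\<^esub> (f ` F)" using s(2) by simp
    moreover have "f s \<in> compact_elements M" using im(2)[of "{s}"] s by simp
    ultimately show ?thesis
      using s unfolding im(1)[OF F(1)] by (simp add: compact_dual_lub[OF M im(2)[OF F(1)]])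
  qed
  moreover have "?f \<in> compact_elements L \<rightarrow>\<^sub>E compact_elements M"
    using im(2)[OF subset_refl] by auto
  ultimately show ?thesis by (auto simp: FSup_hom_def)
qed

lemma FInf_hom_sup_compact:
  assumes L: "algebraic_frame L" and f: "f \<in> FInf_hom L M" and x: "x \<in> carrier L"
  shows "f x = \<Squnion>\<^bsub>M\<^esub> (f ` {k \<in> compact_elements L. k \<sqsubseteq>\<^bsub>L\<^esub> x})"
proof -
  have "{k \<in> compact_elements L. k \<sqsubseteq>\<^bsub>L\<^esub> x} \<subseteq> carrier L" using compact_elements_subset[of L] by blast
  then have "f (\<Squnion>\<^bsub>L\<^esub> {k \<in> compact_elements L. k \<sqsubseteq>\<^bsub>L\<^esub> x}) = \<Squnion>\<^bsub>M\<^esub> (f ` {k \<in> compact_elements L. k \<sqsubseteq>\<^bsub>L\<^esub> x})"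
    using f by (simp add: FInf_hom_def)
  then show ?thesis by (simp add: algebraic_frame_sup_compact[OF L x])
qed

lemma FInf_hom_eqI:
  assumes L: "algebraic_frame L" and f: "f \<in> FInf_hom L M" and g: "g \<in> FInf_hom L M"
    and eq: "restrict f (compact_elements L) = restrict g (compact_elements L)"
  shows "f = g"
proof (rule PiE_ext)
  show "f \<in> carrier L \<rightarrow>\<^sub>E carrier M" "g \<in> carrier L \<rightarrow>\<^sub>E carrier M"
    using f g FInf_hom_funcset by blast+
next
  fix x assume x: "x \<in> carrier L"
  have "f ` {k \<in> compact_elements L. k \<sqsubseteq>\<^bsub>L\<^esub> x} = g ` {k \<in> compact_elements L. k \<sqsubseteq>\<^bsub>L\<^esub> x}"
  proof (rule image_cong[OF refl])
    fix k assume "k \<in> {k \<in> compact_elements L. k \<sqsubseteq>\<^bsub>L\<^esub> x}"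
    then show "f k = g k" using fun_cong[OF eq, of k] by simp
  qed
  then show "f x = g x" using FInf_hom_sup_compact[OF L _ x] f g by metis
qed

text \<open>
  The extension sends \<open>x\<close> to the join of the values on compact elements below \<open>x\<close>. It preserves joins
  because a compact element below \<open>\<Squnion> S\<close> lies below a finite join of compact elements, each below a
  member of \<open>S\<close>, and \<open>h\<close> preserves finite joins of compact elements.
\<close>

lemma FInf_hom_extend:
  assumes L: "algebraic_frame L" and M: "algebraic_frame M"
    and h: "h \<in> FSup_hom (compact_dual L) (compact_dual M)"
  obtains f where "f \<in> FInf_hom L M" "restrict f (compact_elements L) = h"
proof -
  note clL = algebraic_frame_complete[OF L] and clM = algebraic_frame_complete[OF M]
  note poM = complete_lattice_partial_order[OF clM]
  note Lc = compact_elements_subset[of L] and Mc = compact_elements_subset[of M]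
  note slL = compact_dual_semilattice[OF clL] and slM = compact_dual_semilattice[OF clM]
  have hK: "h k \<in> compact_elements M" if "k \<in> compact_elements L" for k
    using h that by (auto simp: FSup_hom_def)
  have hc: "h ` S \<subseteq> carrier M" if "S \<subseteq> compact_elements L" for S using hK that Mc by blast
  have mono: "h j \<sqsubseteq>\<^bsub>M\<^esub> h k" if "j \<in> compact_elements L" "k \<in> compact_elements L" "j \<sqsubseteq>\<^bsub>L\<^esub> k" for j k
    using FSup_hom_mono[OF slL slM h, of k j] that by simp
  have hsup: "h (\<Squnion>\<^bsub>L\<^esub> F) = \<Squnion>\<^bsub>M\<^esub> (h ` F)" if "F \<subseteq> compact_elements L" "finite F" for F
  proof -
    have "h (\<Sqinter>\<^bsub>compact_dual L\<^esub> F) = \<Sqinter>\<^bsub>compact_dual M\<^esub> (h ` F)" using h that by (simp add: FSup_hom_def)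
    moreover have "h ` F \<subseteq> compact_elements M" using hK that by blast
    ultimately show ?thesis using that by (simp add: compact_dual_inf[OF clL] compact_dual_inf[OF clM])
  qed
  define B where "B x = {k \<in> compact_elements L. k \<sqsubseteq>\<^bsub>L\<^esub> x}" for x
  have B: "B x \<subseteq> compact_elements L" for x by (auto simp: B_def)
  define f where "f = (\<lambda>x\<in>carrier L. \<Squnion>\<^bsub>M\<^esub> (h ` B x))"
  have fc: "f x \<in> carrier M" if "x \<in> carrier L" for x
    using complete_lattice_sup_closed[OF clM hc[OF B]] that by (simp add: f_def)
  have fk: "f k = h k" if k: "k \<in> compact_elements L" for k
  proof -
    have kc: "k \<in> carrier L" using k Lc by blast
    have "\<Squnion>\<^bsub>M\<^esub> (h ` B k) \<sqsubseteq>\<^bsub>M\<^esub> h k"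
    proof (rule complete_lattice_sup_least[OF clM hc[OF B]])
      show "h k \<in> carrier M" using hK[OF k] Mc by blast
      show "y \<sqsubseteq>\<^bsub>M\<^esub> h k" if "y \<in> h ` B k" for y using that mono k by (auto simp: B_def)
    qed
    moreover have "h k \<sqsubseteq>\<^bsub>M\<^esub> \<Squnion>\<^bsub>M\<^esub> (h ` B k)"
      using k kc partial_order_refl[OF complete_lattice_partial_order[OF clL]]
      by (intro complete_lattice_sup_upper[OF clM hc[OF B]]) (auto simp: B_def)
    ultimately show ?thesis
      using partial_order_antisym[OF poM, of "f k" "h k"] fc[OF kc] kc hK[OF k] Mc by (auto simp: f_def)
  qed
  have fsup: "f (\<Squnion>\<^bsub>L\<^esub> S) = \<Squnion>\<^bsub>M\<^esub> (f ` S)" if S: "S \<subseteq> carrier L" for S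
  proof (rule partial_order_antisym[OF poM])
    have fS: "f ` S \<subseteq> carrier M" using fc S by blast
    note Sc = complete_lattice_sup_closed[OF clL S]
    show fSc: "f (\<Squnion>\<^bsub>L\<^esub> S) \<in> carrier M" using fc[OF Sc] .
    show fS': "\<Squnion>\<^bsub>M\<^esub> (f ` S) \<in> carrier M" using complete_lattice_sup_closed[OF clM fS] .
    have "h k \<sqsubseteq>\<^bsub>M\<^esub> \<Squnion>\<^bsub>M\<^esub> (f ` S)" if k: "k \<in> compact_elements L" "k \<sqsubseteq>\<^bsub>L\<^esub> \<Squnion>\<^bsub>L\<^esub> S" for k
    proof -
      obtain T where T: "finite T" "T \<subseteq> {j \<in> compact_elements L. \<exists>s\<in>S. j \<sqsubseteq>\<^bsub>L\<^esub> s}" "k \<sqsubseteq>\<^bsub>L\<^esub> \<Squnion>\<^bsub>L\<^esub> T"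
        using compact_below_sup[OF L S k] .
      have TK: "T \<subseteq> compact_elements L" using T(2) by blast
      have "h k \<sqsubseteq>\<^bsub>M\<^esub> \<Squnion>\<^bsub>M\<^esub> (h ` T)"
        using mono[OF k(1) compact_elements_sup[OF clL TK T(1)] T(3)] hsup[OF TK T(1)] by simp
      moreover have "\<Squnion>\<^bsub>M\<^esub> (h ` T) \<sqsubseteq>\<^bsub>M\<^esub> \<Squnion>\<^bsub>M\<^esub> (f ` S)"
      proof (rule complete_lattice_sup_mono[OF clM hc[OF TK] fS])
        fix y assume "y \<in> h ` T"
        then obtain j s where js: "j \<in> compact_elements L" "s \<in> S" "j \<sqsubseteq>\<^bsub>L\<^esub> s" "y = h j" using T(2) by blast
        have "y \<sqsubseteq>\<^bsub>M\<^esub> \<Squnion>\<^bsub>M\<^esub> (h ` B s)"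
          using js by (intro complete_lattice_sup_upper[OF clM hc[OF B]]) (auto simp: B_def)
        then show "\<exists>z\<in>f ` S. y \<sqsubseteq>\<^bsub>M\<^esub> z" using js S by (intro bexI[of _ "f s"]) (auto simp: f_def)
      qed
      ultimately show ?thesis
        using partial_order_trans[OF poM subsetD[OF Mc hK[OF k(1)]] complete_lattice_sup_closed[OF clM hc[OF TK]] fS']
        by simp
    qed
    then have "\<Squnion>\<^bsub>M\<^esub> (h ` B (\<Squnion>\<^bsub>L\<^esub> S)) \<sqsubseteq>\<^bsub>M\<^esub> \<Squnion>\<^bsub>M\<^esub> (f ` S)"
      by (intro complete_lattice_sup_least[OF clM hc[OF B] fS']) (auto simp: B_def)
    then show "f (\<Squnion>\<^bsub>L\<^esub> S) \<sqsubseteq>\<^bsub>M\<^esub> \<Squnion>\<^bsub>M\<^esub> (f ` S)" using Sc by (simp add: f_def)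
    show "\<Squnion>\<^bsub>M\<^esub> (f ` S) \<sqsubseteq>\<^bsub>M\<^esub> f (\<Squnion>\<^bsub>L\<^esub> S)"
    proof (rule complete_lattice_sup_least[OF clM fS fSc])
      fix y assume "y \<in> f ` S"
      then obtain s where s: "s \<in> S" "y = f s" by blast
      have "B s \<subseteq> B (\<Squnion>\<^bsub>L\<^esub> S)"
        using partial_order_trans[OF complete_lattice_partial_order[OF clL] _ subsetD[OF S s(1)] Sc]
          complete_lattice_sup_upper[OF clL S s(1)] subsetD[OF Lc] by (auto simp: B_def)
      moreover have "h k \<sqsubseteq>\<^bsub>M\<^esub> h k" if "k \<in> B s" for k
        using partial_order_refl[OF poM, of "h k"] subsetD[OF hc[OF B[of s]]] that by simp
      ultimately have "\<Squnion>\<^bsub>M\<^esub> (h ` B s) \<sqsubseteq>\<^bsub>M\<^esub> \<Squnion>\<^bsub>M\<^esub> (h ` B (\<Squnion>\<^bsub>L\<^esub> S))"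
        by (intro complete_lattice_sup_mono[OF clM hc[OF B] hc[OF B]]) auto
      then show "y \<sqsubseteq>\<^bsub>M\<^esub> f (\<Squnion>\<^bsub>L\<^esub> S)" using s S Sc by (auto simp: f_def)
    qed
  qed
  have finf: "f (\<Sqinter>\<^bsub>L\<^esub> S) = \<Sqinter>\<^bsub>M\<^esub> (f ` S)"
    if S: "S \<subseteq> compact_elements L" "S \<noteq> {}" "finite S" "\<Sqinter>\<^bsub>L\<^esub> S \<in> compact_elements L" for S
  proof -
    have "is_lub (compact_dual M) (h (\<Sqinter>\<^bsub>L\<^esub> S)) (h ` S)"
      using h S compact_dual_lub[OF L S(1), of "\<Sqinter>\<^bsub>L\<^esub> S"] by (simp add: FSup_hom_def)
    moreover have "h ` S \<subseteq> compact_elements M" using hK S(1) by blast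
    moreover have "f ` S = h ` S" using fk S(1) by (intro image_cong) auto
    ultimately show ?thesis using S(4) by (simp add: compact_dual_lub[OF M] fk)
  qed
  have "f ` compact_elements L \<subseteq> compact_elements M" using fk hK by auto
  then have "f \<in> FInf_hom L M" using fc fsup finf by (auto simp: FInf_hom_def f_def)
  moreover have "restrict f (compact_elements L) = h"
    using fk h by (auto simp: FSup_hom_def PiE_def extensional_def)
  ultimately show ?thesis by (rule that)
qed

lemma fully_faithful_compact_dual:
  "fully_faithful (AlgFrm_FInf :: 'u order_cat) DMS_FSup compact_dual (\<lambda>L M f. restrict f (compact_elements L))"
proof -
  have "restrict (\<lambda>x\<in>carrier L. x) (compact_elements L) = (\<lambda>x\<in>compact_elements L. x)" for L :: "'u gorder"
    using subsetD[OF compact_elements_subset[of L]] by auto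
  moreover have "\<forall>f\<in>FInf_hom L M. \<forall>g\<in>FInf_hom M N. restrict (compose (carrier L) g f) (compact_elements L) =
      compose (compact_elements L) (restrict g (compact_elements M)) (restrict f (compact_elements L))"
    for L M N :: "'u gorder"
  proof (intro ballI ext)
    fix f g k assume "f \<in> FInf_hom L M"
    have "f k \<in> compact_elements M" if "k \<in> compact_elements L"
      by (rule FInf_hom_compact[OF \<open>f \<in> FInf_hom L M\<close> that])
    then show "restrict (compose (carrier L) g f) (compact_elements L) k =
      compose (compact_elements L) (restrict g (compact_elements M)) (restrict f (compact_elements L)) k"
      using subsetD[OF compact_elements_subset[of L]] by (auto simp: compose_def)
  qed
  ultimately have "is_functor (AlgFrm_FInf :: 'u order_cat) DMS_FSup compact_dual (\<lambda>L M f. restrict f (compact_elements L))"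
    by (simp add: is_functor_def Obj_AlgFrm Obj_DMS Hom_AlgFrm Hom_DMS Id_AlgFrm Id_DMS Comp_AlgFrm Comp_DMS
        compact_dual_distributive FInf_hom_restrict)
  moreover have "bij_betw (\<lambda>f. restrict f (compact_elements L)) (FInf_hom L M)
      (FSup_hom (compact_dual L) (compact_dual M))"
    if "algebraic_frame L" "algebraic_frame M" for L M :: "'u gorder"
    unfolding bij_betw_def
  proof
    show "inj_on (\<lambda>f. restrict f (compact_elements L)) (FInf_hom L M)"
      by (rule inj_onI) (rule FInf_hom_eqI[OF that(1)])
    have "h \<in> (\<lambda>f. restrict f (compact_elements L)) ` FInf_hom L M"
      if "h \<in> FSup_hom (compact_dual L) (compact_dual M)" for h
      by (rule FInf_hom_extend[OF \<open>algebraic_frame L\<close> \<open>algebraic_frame M\<close> that]) (rule image_eqI[OF sym])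
    then show "(\<lambda>f. restrict f (compact_elements L)) ` FInf_hom L M = FSup_hom (compact_dual L) (compact_dual M)"
      using FInf_hom_restrict[OF that] by auto
  qed
  ultimately show ?thesis by (simp add: fully_faithful_def Obj_AlgFrm Hom_AlgFrm Hom_DMS)
qed

text \<open>
  The top is the join of all compact elements, so a largest compact element can only be the top.
\<close>

lemma compact_dual_least:
  assumes L: "algebraic_frame L"
  shows "least (compact_dual L) z (compact_elements L) \<longleftrightarrow> compact_frame L \<and> z = \<top>\<^bsub>L\<^esub>"
proof -
  note cl = algebraic_frame_complete[OF L]
  note po = complete_lattice_partial_order[OF cl]
  have "greatest L (\<Squnion>\<^bsub>L\<^esub> (carrier L)) (carrier L)"
    using complete_lattice_sup_closed[OF cl, of "carrier L"] complete_lattice_sup_upper[OF cl, of "carrier L"]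
    by (auto simp: greatest_def)
  then have top: "greatest L \<top>\<^bsub>L\<^esub> (carrier L)" unfolding top_def by (rule someI)
  have "z = \<top>\<^bsub>L\<^esub>" if "z \<in> compact_elements L" "\<forall>k\<in>compact_elements L. k \<sqsubseteq>\<^bsub>L\<^esub> z" for z
  proof -
    have zc: "z \<in> carrier L" using that compact_elements_subset[of L] by blast
    have tc: "\<top>\<^bsub>L\<^esub> \<in> carrier L" "z \<sqsubseteq>\<^bsub>L\<^esub> \<top>\<^bsub>L\<^esub>" using top zc by (simp_all add: greatest_def)
    have "\<top>\<^bsub>L\<^esub> \<sqsubseteq>\<^bsub>L\<^esub> z"
      by (rule algebraic_frame_le[OF L tc(1) zc]) (use that in simp)
    then show ?thesis using partial_order_antisym[OF po zc tc(1) tc(2)] by simp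
  qed
  moreover have "k \<sqsubseteq>\<^bsub>L\<^esub> \<top>\<^bsub>L\<^esub>" if "k \<in> compact_elements L" for k
    using top subsetD[OF compact_elements_subset that] by (simp add: greatest_def)
  moreover have "compact_frame L \<longleftrightarrow> \<top>\<^bsub>L\<^esub> \<in> compact_elements L"
    using L unfolding compact_frame_def algebraic_frame_def by blast
  ultimately show ?thesis
    using least_iff[of "compact_dual L" z] by auto
qed

lemma FInfB_hom_iff:
  assumes L: "algebraic_frame L" and M: "algebraic_frame M"
  shows "f \<in> FInfB_hom L M \<longleftrightarrow> f \<in> FInf_hom L M \<and>
    restrict f (compact_elements L) \<in> FSupB_hom (compact_dual L) (compact_dual M)"
proof -
  note sl = compact_dual_semilattice[OF algebraic_frame_complete[OF L]]
    compact_dual_semilattice[OF algebraic_frame_complete[OF M]]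
  have "restrict f (compact_elements L) \<in> FSupB_hom (compact_dual L) (compact_dual M) \<longleftrightarrow>
      (compact_frame L \<and> compact_frame M \<longrightarrow> f \<top>\<^bsub>L\<^esub> = \<top>\<^bsub>M\<^esub>)" if "f \<in> FInf_hom L M"
    using FInf_hom_restrict[OF L M that]
    unfolding FSupB_hom_iff[OF sl] compact_dual_simps compact_dual_least[OF L] compact_dual_least[OF M]
    by (auto simp: compact_frame_def)
  then show ?thesis unfolding FInfB_hom_def by auto
qed

section \<open>The frame of filters of a distributive semilattice\<close>

definition meet_filter :: "'a gorder \<Rightarrow> 'a set \<Rightarrow> bool" where
  "meet_filter M F \<longleftrightarrow> F \<subseteq> carrier M \<and> F \<noteq> {} \<and>
     (\<forall>a\<in>F. \<forall>b\<in>carrier M. a \<sqsubseteq>\<^bsub>M\<^esub> b \<longrightarrow> b \<in> F) \<and> (\<forall>a\<in>F. \<forall>b\<in>F. a \<sqinter>\<^bsub>M\<^esub> b \<in> F)"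

definition principal_filter :: "'a gorder \<Rightarrow> 'a \<Rightarrow> 'a set" where
  "principal_filter M a = {b \<in> carrier M. a \<sqsubseteq>\<^bsub>M\<^esub> b}"

definition generated_filter :: "'a gorder \<Rightarrow> 'a set \<Rightarrow> 'a set" where
  "generated_filter M S = \<Inter>{F. meet_filter M F \<and> S \<subseteq> F}"

lemma meet_filter_carrier: "meet_filter M F \<Longrightarrow> a \<in> F \<Longrightarrow> a \<in> carrier M"
  and meet_filter_up: "meet_filter M F \<Longrightarrow> a \<in> F \<Longrightarrow> b \<in> carrier M \<Longrightarrow> a \<sqsubseteq>\<^bsub>M\<^esub> b \<Longrightarrow> b \<in> F"
  and meet_filter_meet: "meet_filter M F \<Longrightarrow> a \<in> F \<Longrightarrow> b \<in> F \<Longrightarrow> a \<sqinter>\<^bsub>M\<^esub> b \<in> F"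
  by (auto simp: meet_filter_def)

lemma meet_filterI:
  assumes "F \<subseteq> carrier M" "x \<in> F" "\<And>a b. \<lbrakk>a \<in> F; b \<in> carrier M; a \<sqsubseteq>\<^bsub>M\<^esub> b\<rbrakk> \<Longrightarrow> b \<in> F"
    "\<And>a b. \<lbrakk>a \<in> F; b \<in> F\<rbrakk> \<Longrightarrow> a \<sqinter>\<^bsub>M\<^esub> b \<in> F"
  shows "meet_filter M F"
  using assms by (auto simp: meet_filter_def)

lemma semilattice_top:
  assumes M: "meet_semilattice M"
  shows "\<Sqinter>\<^bsub>M\<^esub> {} \<in> carrier M" "x \<in> carrier M \<Longrightarrow> x \<sqsubseteq>\<^bsub>M\<^esub> \<Sqinter>\<^bsub>M\<^esub> {}"
  using semilattice_inf_closed[OF M, of "{}"] semilattice_inf_greatest[OF M, of "{}" x] by simp_all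

lemma meet_filter_top:
  assumes M: "meet_semilattice M" and F: "meet_filter M F" shows "\<Sqinter>\<^bsub>M\<^esub> {} \<in> F"
proof -
  obtain x where x: "x \<in> F" using F by (auto simp: meet_filter_def)
  show ?thesis
    using meet_filter_up[OF F x semilattice_top(1)[OF M] semilattice_top(2)[OF M meet_filter_carrier[OF F x]]] .
qed

lemma meet_filter_lower_bound:
  assumes M: "meet_semilattice M" and F: "meet_filter M F" and T: "finite T" "T \<subseteq> F"
  shows "\<exists>z\<in>F. \<forall>t\<in>T. z \<sqsubseteq>\<^bsub>M\<^esub> t"
  using T
proof (induction T)
  case empty
  then show ?case using meet_filter_top[OF M F] by blast
next
  case (insert t T)
  then obtain z where z: "z \<in> F" "\<forall>t\<in>T. z \<sqsubseteq>\<^bsub>M\<^esub> t" by auto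
  have t: "t \<in> F" using insert.prems by simp
  have c: "z \<in> carrier M" "t \<in> carrier M" using meet_filter_carrier[OF F] z(1) t by simp_all
  have "z \<sqinter>\<^bsub>M\<^esub> t \<sqsubseteq>\<^bsub>M\<^esub> u" if "u \<in> T" for u
  proof -
    have "u \<in> carrier M" using meet_filter_carrier[OF F, of u] insert.prems that by auto
    then show ?thesis
      using partial_order_trans[OF semilattice_partial_order[OF M] semilattice_meet_closed[OF M c] c(1) _
          semilattice_meet_left[OF M c]] z(2) that by simp
  qed
  then show ?case
    using meet_filter_meet[OF F z(1) t] semilattice_meet_right[OF M c] by auto
qed

lemma meet_filter_whole: "meet_semilattice M \<Longrightarrow> meet_filter M (carrier M)"
  by (rule meet_filterI[OF subset_refl semilattice_top(1)]) (simp_all add: semilattice_meet_closed)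

lemma meet_filter_principal:
  assumes M: "meet_semilattice M" and a: "a \<in> carrier M"
  shows "meet_filter M (principal_filter M a)"
proof (rule meet_filterI)
  note po = semilattice_partial_order[OF M]
  show "principal_filter M a \<subseteq> carrier M" by (auto simp: principal_filter_def)
  show "a \<in> principal_filter M a" using a partial_order_refl[OF po a] by (simp add: principal_filter_def)
  show "c \<in> principal_filter M a" if "b \<in> principal_filter M a" "c \<in> carrier M" "b \<sqsubseteq>\<^bsub>M\<^esub> c" for b c
    using partial_order_trans[OF po a, of b c] that by (simp add: principal_filter_def)
  show "b \<sqinter>\<^bsub>M\<^esub> c \<in> principal_filter M a" if "b \<in> principal_filter M a" "c \<in> principal_filter M a" for b c
    using semilattice_meet_greatest[OF M, of b c a] semilattice_meet_closed[OF M, of b c] that a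
    by (simp add: principal_filter_def)
qed

lemma principal_least: "meet_filter M F \<Longrightarrow> a \<in> F \<Longrightarrow> principal_filter M a \<subseteq> F"
  by (auto simp: principal_filter_def intro: meet_filter_up)

lemma principal_self: "meet_semilattice M \<Longrightarrow> a \<in> carrier M \<Longrightarrow> a \<in> principal_filter M a"
  by (simp add: principal_filter_def partial_order_refl semilattice_partial_order)

lemma meet_filter_Inter:
  assumes M: "meet_semilattice M" and C: "C \<noteq> {}" "\<And>F. F \<in> C \<Longrightarrow> meet_filter M F"
  shows "meet_filter M (\<Inter>C)"
proof (rule meet_filterI)
  show "\<Inter>C \<subseteq> carrier M" using C meet_filter_carrier by fast
  show "\<Sqinter>\<^bsub>M\<^esub> {} \<in> \<Inter>C" using meet_filter_top[OF M C(2)] by simp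
  show "b \<in> \<Inter>C" if "a \<in> \<Inter>C" "b \<in> carrier M" "a \<sqsubseteq>\<^bsub>M\<^esub> b" for a b
    using meet_filter_up[OF C(2) _ that(2,3)] that(1) by simp
  show "a \<sqinter>\<^bsub>M\<^esub> b \<in> \<Inter>C" if "a \<in> \<Inter>C" "b \<in> \<Inter>C" for a b
    using meet_filter_meet[OF C(2)] that by simp
qed

lemma meet_filter_generated:
  assumes M: "meet_semilattice M" and S: "S \<subseteq> carrier M"
  shows "meet_filter M (generated_filter M S)"
  unfolding generated_filter_def using meet_filter_whole[OF M] S by (intro meet_filter_Inter[OF M]) auto

lemma generated_filter_subset: "S \<subseteq> generated_filter M S"
  by (auto simp: generated_filter_def)

lemma generated_filter_least: "meet_filter M F \<Longrightarrow> S \<subseteq> F \<Longrightarrow> generated_filter M S \<subseteq> F"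
  by (auto simp: generated_filter_def)

text \<open>
  The proof uses the relative pseudocomplement: the elements \<open>y\<close> such that every element of \<open>F\<close> above \<open>y\<close>
  lies in the right-hand filter form a filter, by distributivity of \<open>M\<close>. It contains every member of \<open>C\<close>,
  hence the filter generated by \<open>C\<close>, which gives the inclusion from left to right.
\<close>

lemma generated_filter_distrib:
  assumes M: "distributive_semilattice M" and F: "meet_filter M F"
    and C: "\<And>G. G \<in> C \<Longrightarrow> meet_filter M G"
  shows "F \<inter> generated_filter M (\<Union>C) = generated_filter M (\<Union>G\<in>C. F \<inter> G)"
proof -
  have sl: "meet_semilattice M" using M by (simp add: distributive_semilattice_def)
  note po = semilattice_partial_order[OF sl]
  have Fc: "F \<subseteq> carrier M" using F by (simp add: meet_filter_def)
  have Cc: "\<Union>C \<subseteq> carrier M" using meet_filter_carrier C by fast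
  let ?R = "generated_filter M (\<Union>G\<in>C. F \<inter> G)"
  have "(\<Union>G\<in>C. F \<inter> G) \<subseteq> carrier M" using Fc by blast
  then have R: "meet_filter M ?R" by (rule meet_filter_generated[OF sl])
  \<comment> \<open>The residual of the right-hand filter by \<open>F\<close>.\<close>
  let ?H = "{y \<in> carrier M. \<forall>x\<in>F. y \<sqsubseteq>\<^bsub>M\<^esub> x \<longrightarrow> x \<in> ?R}"
  have "meet_filter M ?H"
  proof (rule meet_filterI)
    show "?H \<subseteq> carrier M" by blast
    have "x = \<Sqinter>\<^bsub>M\<^esub> {}" if "x \<in> carrier M" "\<Sqinter>\<^bsub>M\<^esub> {} \<sqsubseteq>\<^bsub>M\<^esub> x" for x
      by (rule partial_order_antisym[OF po that(1) semilattice_top(1)[OF sl] semilattice_top(2)[OF sl that(1)] that(2)])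
    then show "\<Sqinter>\<^bsub>M\<^esub> {} \<in> ?H"
      using semilattice_top(1)[OF sl] meet_filter_top[OF sl R] Fc by auto
    show "b \<in> ?H" if "a \<in> ?H" "b \<in> carrier M" "a \<sqsubseteq>\<^bsub>M\<^esub> b" for a b
      using that partial_order_trans[OF po _ that(2) _ that(3)] subsetD[OF Fc] by simp
    show "a \<sqinter>\<^bsub>M\<^esub> b \<in> ?H" if ab: "a \<in> ?H" "b \<in> ?H" for a b
    proof -
      have c: "a \<in> carrier M" "b \<in> carrier M" using ab by simp_all
      have "x \<in> ?R" if x: "x \<in> F" "a \<sqinter>\<^bsub>M\<^esub> b \<sqsubseteq>\<^bsub>M\<^esub> x" for x
      proof -
        have xc: "x \<in> carrier M" using x Fc by blast
        obtain a' b' where ab': "a' \<in> carrier M" "b' \<in> carrier M" "a \<sqsubseteq>\<^bsub>M\<^esub> a'" "b \<sqsubseteq>\<^bsub>M\<^esub> b'" "a' \<sqinter>\<^bsub>M\<^esub> b' = x"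
          using M c xc x(2) unfolding distributive_semilattice_def by metis
        have "x \<sqsubseteq>\<^bsub>M\<^esub> a'" "x \<sqsubseteq>\<^bsub>M\<^esub> b'"
          using semilattice_meet_left[OF sl ab'(1,2)] semilattice_meet_right[OF sl ab'(1,2)] ab'(5) by simp_all
        then have "a' \<in> F" "b' \<in> F" using meet_filter_up[OF F x(1)] ab'(1,2) by simp_all
        then have "a' \<in> ?R" "b' \<in> ?R" using ab ab' by simp_all
        then show ?thesis using meet_filter_meet[OF R] ab'(5) by metis
      qed
      then show ?thesis using semilattice_meet_closed[OF sl c] by simp
    qed
  qed
  moreover have "\<Union>C \<subseteq> ?H"
  proof
    fix y assume "y \<in> \<Union>C"
    then obtain G where G: "G \<in> C" "y \<in> G" by blast
    have "x \<in> ?R" if "x \<in> F" "y \<sqsubseteq>\<^bsub>M\<^esub> x" for x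
    proof -
      have "x \<in> G" using meet_filter_up[OF C[OF G(1)] G(2) _ that(2)] that(1) Fc by blast
      then show ?thesis using subsetD[OF generated_filter_subset, of x "\<Union>G\<in>C. F \<inter> G"] G(1) that(1) by auto
    qed
    then show "y \<in> ?H" using meet_filter_carrier[OF C[OF G(1)] G(2)] by simp
  qed
  ultimately have "generated_filter M (\<Union>C) \<subseteq> ?H" by (rule generated_filter_least)
  moreover have "x \<sqsubseteq>\<^bsub>M\<^esub> x" if "x \<in> F" for x using partial_order_refl[OF po] Fc that by blast
  ultimately have "F \<inter> generated_filter M (\<Union>C) \<subseteq> ?R" by auto
  moreover have "?R \<subseteq> F \<inter> generated_filter M (\<Union>C)"
  proof (rule generated_filter_least)
    show "meet_filter M (F \<inter> generated_filter M (\<Union>C))"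
      using meet_filter_Inter[OF sl, of "{F, generated_filter M (\<Union>C)}"] F meet_filter_generated[OF sl Cc] by auto
    show "(\<Union>G\<in>C. F \<inter> G) \<subseteq> F \<inter> generated_filter M (\<Union>C)"
      using generated_filter_subset[of "\<Union>C" M] by auto
  qed
  ultimately show ?thesis by blast
qed

text \<open>
  The filters generated by finite subfamilies are directed, so their union is already a filter.
\<close>

lemma generated_filter_finitely:
  assumes M: "meet_semilattice M" and C: "\<And>G. G \<in> C \<Longrightarrow> meet_filter M G" and a: "a \<in> generated_filter M (\<Union>C)"
  shows "\<exists>T\<subseteq>C. finite T \<and> a \<in> generated_filter M (\<Union>T)"
proof -
  have Tc: "\<Union>T \<subseteq> carrier M" if "T \<subseteq> C" for T using meet_filter_carrier[OF C] that by blast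
  note gen = meet_filter_generated[OF M Tc]
  let ?H = "\<Union>{generated_filter M (\<Union>T) |T. T \<subseteq> C \<and> finite T}"
  have mono: "generated_filter M (\<Union>T) \<subseteq> generated_filter M (\<Union>U)" if "T \<subseteq> U" "U \<subseteq> C" for T U
    using generated_filter_least[OF gen[OF that(2)], of "\<Union>T"] generated_filter_subset[of "\<Union>U" M] that(1) by blast
  have "meet_filter M ?H"
  proof (rule meet_filterI)
    show "?H \<subseteq> carrier M" using meet_filter_carrier[OF gen] by blast
    show "\<Sqinter>\<^bsub>M\<^esub> {} \<in> ?H" using meet_filter_top[OF M gen[of "{}"]] by blast
    show "c \<in> ?H" if "b \<in> ?H" "c \<in> carrier M" "b \<sqsubseteq>\<^bsub>M\<^esub> c" for b c
      using meet_filter_up[OF gen _ that(2,3)] that(1) by blast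
    show "b \<sqinter>\<^bsub>M\<^esub> c \<in> ?H" if bc: "b \<in> ?H" "c \<in> ?H" for b c
    proof -
      obtain T U where TU: "T \<subseteq> C" "finite T" "b \<in> generated_filter M (\<Union>T)"
        "U \<subseteq> C" "finite U" "c \<in> generated_filter M (\<Union>U)" using bc by blast
      have s: "T \<union> U \<subseteq> C" using TU by blast
      have "b \<in> generated_filter M (\<Union>(T \<union> U))" "c \<in> generated_filter M (\<Union>(T \<union> U))"
        using mono[OF Un_upper1 s] mono[OF Un_upper2 s] TU(3,6) by auto
      then have "b \<sqinter>\<^bsub>M\<^esub> c \<in> generated_filter M (\<Union>(T \<union> U))" by (rule meet_filter_meet[OF gen[OF s]])
      moreover have "finite (T \<union> U)" using TU by simp
      ultimately show ?thesis using s by blast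
    qed
  qed
  moreover have "\<Union>C \<subseteq> ?H"
  proof
    fix x assume "x \<in> \<Union>C"
    then obtain G where "G \<in> C" "x \<in> G" by blast
    then have "{G} \<subseteq> C" "x \<in> generated_filter M (\<Union>{G})" using generated_filter_subset[of G M] by auto
    then show "x \<in> ?H" by blast
  qed
  ultimately have "generated_filter M (\<Union>C) \<subseteq> ?H" by (rule generated_filter_least)
  then show ?thesis using a by blast
qed

text \<open>
  The elements of the frame are names for filters; \<open>d\<close> decodes them.
\<close>

locale filter_frame =
  fixes M :: "'a gorder" and P :: "'p set" and d :: "'p \<Rightarrow> 'a set"
  assumes distributive: "distributive_semilattice M"
    and bij: "bij_betw d P {F. meet_filter M F}"
begin

abbreviation "L \<equiv> set_order P d"

lemma semilattice: "meet_semilattice M"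
  using distributive by (simp add: distributive_semilattice_def)

lemma inj: "inj_on d P"
  using bij by (simp add: bij_betw_def)

lemma filter: "x \<in> P \<Longrightarrow> meet_filter M (d x)"
  using bij by (auto simp: bij_betw_def)

definition code :: "'a set \<Rightarrow> 'p" where
  "code = inv_into P d"

lemma code: assumes "meet_filter M F" shows "code F \<in> P" "d (code F) = F"
proof -
  have "F \<in> d ` P" using assms bij by (simp add: bij_betw_def)
  then show "code F \<in> P" "d (code F) = F" unfolding code_def by (rule inv_into_into, rule f_inv_into_f)
qed

lemma partial_order_L: "partial_order L"
  by (rule partial_order_set_order[OF inj])

lemma Union_carrier: "S \<subseteq> P \<Longrightarrow> \<Union>(d ` S) \<subseteq> carrier M"
  using meet_filter_carrier[OF filter] by blast

lemma lub: assumes S: "S \<subseteq> P" shows "is_lub L (code (generated_filter M (\<Union>(d ` S)))) S"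
proof -
  note g = code[OF meet_filter_generated[OF semilattice Union_carrier[OF S]]]
  have "generated_filter M (\<Union>(d ` S)) \<subseteq> d y" if "y \<in> P" "\<forall>x\<in>S. d x \<subseteq> d y" for y
    using that by (intro generated_filter_least filter) auto
  then show ?thesis
    using S g generated_filter_subset[of "\<Union>(d ` S)" M] by (auto simp: is_lub_iff)
qed

lemma glb: assumes S: "S \<subseteq> P" shows "is_glb L (code (carrier M \<inter> \<Inter>(d ` S))) S"
proof -
  have "meet_filter M (\<Inter>(insert (carrier M) (d ` S)))"
    using S filter meet_filter_whole[OF semilattice] by (intro meet_filter_Inter[OF semilattice]) auto
  then have "meet_filter M (carrier M \<inter> \<Inter>(d ` S))" by simp
  note g = code[OF this]
  have "d y \<subseteq> carrier M" if "y \<in> P" for y using filter[OF that] by (simp add: meet_filter_def)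
  then show ?thesis using S g by (auto simp: is_glb_iff)
qed

lemma d_sup: "S \<subseteq> P \<Longrightarrow> d (\<Squnion>\<^bsub>L\<^esub> S) = generated_filter M (\<Union>(d ` S))"
  and sup_P: "S \<subseteq> P \<Longrightarrow> \<Squnion>\<^bsub>L\<^esub> S \<in> P"
  using sup_eqI[OF partial_order_L lub, of S] code[OF meet_filter_generated[OF semilattice Union_carrier[of S]]]
  by simp_all

lemma d_meet: assumes "x \<in> P" "y \<in> P" shows "d (x \<sqinter>\<^bsub>L\<^esub> y) = d x \<inter> d y" "x \<sqinter>\<^bsub>L\<^esub> y \<in> P"
proof -
  have "meet_filter M (\<Inter>{d x, d y})"
    using assms filter by (intro meet_filter_Inter[OF semilattice]) auto
  then have f: "meet_filter M (d x \<inter> d y)" by simp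
  have "carrier M \<inter> \<Inter>(d ` {x, y}) = d x \<inter> d y"
    using filter[OF assms(1)] by (auto simp: meet_filter_def)
  then have "x \<sqinter>\<^bsub>L\<^esub> y = code (d x \<inter> d y)"
    unfolding meet_def using inf_eqI[OF partial_order_L glb, of "{x, y}"] assms by simp
  then show "d (x \<sqinter>\<^bsub>L\<^esub> y) = d x \<inter> d y" "x \<sqinter>\<^bsub>L\<^esub> y \<in> P" using code[OF f] by simp_all
qed

lemma complete: "complete_lattice L"
  by (rule partial_order.complete_latticeI[OF partial_order_L]) (use lub glb in auto)

lemma frame: "frame L"
proof -
  have "a \<sqinter>\<^bsub>L\<^esub> \<Squnion>\<^bsub>L\<^esub> S = \<Squnion>\<^bsub>L\<^esub> ((\<lambda>s. a \<sqinter>\<^bsub>L\<^esub> s) ` S)" if a: "a \<in> P" and S: "S \<subseteq> P" for a S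
  proof (rule inj_onD[OF inj])
    have aS: "(\<lambda>s. a \<sqinter>\<^bsub>L\<^esub> s) ` S \<subseteq> P" using d_meet(2)[OF a] S by blast
    have "(\<Union>G\<in>d ` S. d a \<inter> G) = \<Union>(d ` (\<lambda>s. a \<sqinter>\<^bsub>L\<^esub> s) ` S)"
      using d_meet(1)[OF a] S by (simp add: image_image subset_iff cong: image_cong)
    moreover have "d a \<inter> generated_filter M (\<Union>(d ` S)) = generated_filter M (\<Union>G\<in>d ` S. d a \<inter> G)"
      using S filter by (intro generated_filter_distrib[OF distributive filter[OF a]]) auto
    ultimately show "d (a \<sqinter>\<^bsub>L\<^esub> \<Squnion>\<^bsub>L\<^esub> S) = d (\<Squnion>\<^bsub>L\<^esub> ((\<lambda>s. a \<sqinter>\<^bsub>L\<^esub> s) ` S))"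
      using d_meet(1)[OF a sup_P[OF S]] d_sup[OF S] d_sup[OF aS] by simp
    show "a \<sqinter>\<^bsub>L\<^esub> \<Squnion>\<^bsub>L\<^esub> S \<in> P" using d_meet(2)[OF a sup_P[OF S]] .
    show "\<Squnion>\<^bsub>L\<^esub> ((\<lambda>s. a \<sqinter>\<^bsub>L\<^esub> s) ` S) \<in> P" using sup_P[OF aS] .
  qed
  then show ?thesis using complete by (simp add: frame_def)
qed

lemma compact_principal:
  assumes a: "a \<in> carrier M" shows "code (principal_filter M a) \<in> compact_elements L"
proof (rule compact_elementsI)
  note c = code[OF meet_filter_principal[OF semilattice a]]
  show "code (principal_filter M a) \<in> carrier L" using c(1) by simp
  fix S assume "S \<subseteq> carrier L" and le: "code (principal_filter M a) \<sqsubseteq>\<^bsub>L\<^esub> \<Squnion>\<^bsub>L\<^esub> S"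
  then have S: "S \<subseteq> P" by simp
  have "a \<in> generated_filter M (\<Union>(d ` S))"
    using le c(2) d_sup[OF S] principal_self[OF semilattice a] by auto
  then have "\<exists>T\<subseteq>d ` S. finite T \<and> a \<in> generated_filter M (\<Union>T)"
    using S filter by (intro generated_filter_finitely[OF semilattice]) auto
  then obtain T where T: "T \<subseteq> S" "finite T" "a \<in> generated_filter M (\<Union>(d ` T))"
    by (metis finite_subset_image)
  have TP: "T \<subseteq> P" using T(1) S by blast
  have "principal_filter M a \<subseteq> d (\<Squnion>\<^bsub>L\<^esub> T)"
    unfolding d_sup[OF TP]
    by (rule principal_least[OF meet_filter_generated[OF semilattice Union_carrier[OF TP]] T(3)])
  then show "\<exists>T\<subseteq>S. finite T \<and> code (principal_filter M a) \<sqsubseteq>\<^bsub>L\<^esub> \<Squnion>\<^bsub>L\<^esub> T" using T c(2) by auto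
qed

lemma sup_principals:
  assumes x: "x \<in> P" shows "x = \<Squnion>\<^bsub>L\<^esub> ((\<lambda>a. code (principal_filter M a)) ` d x)"
proof (rule inj_onD[OF inj _ x])
  note cx = meet_filter_carrier[OF filter[OF x]]
  note c = code[OF meet_filter_principal[OF semilattice cx]]
  let ?S = "(\<lambda>a. code (principal_filter M a)) ` d x"
  have S: "?S \<subseteq> P" using c(1) by blast
  show "\<Squnion>\<^bsub>L\<^esub> ?S \<in> P" by (rule sup_P[OF S])
  have "d ` ?S = principal_filter M ` d x" using c(2) by (simp add: image_image)
  then have "\<Union>(d ` ?S) = d x"
    using principal_self[OF semilattice cx] subsetD[OF principal_least[OF filter[OF x]]] by auto
  then have "d (\<Squnion>\<^bsub>L\<^esub> ?S) = generated_filter M (d x)" by (simp only: d_sup[OF S])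
  also have "\<dots> = d x"
    using generated_filter_subset[of "d x" M] generated_filter_least[OF filter[OF x] subset_refl] by simp
  finally show "d x = d (\<Squnion>\<^bsub>L\<^esub> ?S)" ..
qed

text \<open>
  A filter is the join of the principal filters of its elements. If it is compact, finitely many of
  them suffice, and a lower bound of their generators inside the filter generates all of it.
\<close>

lemma compact_is_principal:
  assumes k: "k \<in> compact_elements L" shows "\<exists>a\<in>carrier M. k = code (principal_filter M a)"
proof -
  have kP: "k \<in> P" using k by (simp add: compact_elements_def)
  let ?S = "(\<lambda>a. code (principal_filter M a)) ` d k"
  note ck = meet_filter_carrier[OF filter[OF kP]]
  note c = code[OF meet_filter_principal[OF semilattice ck]]
  have S: "?S \<subseteq> P" using c(1) by blast
  have "k \<sqsubseteq>\<^bsub>L\<^esub> \<Squnion>\<^bsub>L\<^esub> ?S" using sup_principals[OF kP] by simp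
  then have "\<exists>T\<subseteq>?S. finite T \<and> k \<sqsubseteq>\<^bsub>L\<^esub> \<Squnion>\<^bsub>L\<^esub> T" using S by (intro compact_elementsD[OF k]) simp_all
  then obtain B where B: "B \<subseteq> d k" "finite B" "k \<sqsubseteq>\<^bsub>L\<^esub> \<Squnion>\<^bsub>L\<^esub> ((\<lambda>a. code (principal_filter M a)) ` B)"
    by (metis finite_subset_image)
  obtain z where z: "z \<in> d k" "\<forall>b\<in>B. z \<sqsubseteq>\<^bsub>M\<^esub> b"
    using meet_filter_lower_bound[OF semilattice filter[OF kP] B(2,1)] by blast
  let ?T = "(\<lambda>a. code (principal_filter M a)) ` B"
  have T: "?T \<subseteq> P" using B(1) S by blast
  note zf = meet_filter_principal[OF semilattice ck[OF z(1)]]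
  have "principal_filter M b \<subseteq> principal_filter M z" if "b \<in> B" for b
    using z(2) B(1) ck that by (intro principal_least[OF zf]) (auto simp: principal_filter_def)
  then have "\<Union>(d ` ?T) \<subseteq> principal_filter M z" using c(2) B(1) by auto
  then have "d (\<Squnion>\<^bsub>L\<^esub> ?T) \<subseteq> principal_filter M z"
    unfolding d_sup[OF T] by (rule generated_filter_least[OF zf])
  then have "d k = principal_filter M z"
    using B(3) principal_least[OF filter[OF kP] z(1)] by auto
  then have "k = code (principal_filter M z)"
    using inj_onD[OF inj _ kP code(1)[OF zf]] code(2)[OF zf] by simp
  then show ?thesis using ck[OF z(1)] by blast
qed

lemma algebraic: "algebraic_frame L"
proof -
  have "\<exists>S\<subseteq>compact_elements L. a = \<Squnion>\<^bsub>L\<^esub> S" if "a \<in> P" for a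
    using sup_principals[OF that] compact_principal meet_filter_carrier[OF filter[OF that]]
    by (intro exI[of _ "(\<lambda>b. code (principal_filter M b)) ` d a"]) auto
  then show ?thesis using frame by (simp add: algebraic_frame_def)
qed

lemma principal_bij: "bij_betw (\<lambda>a. code (principal_filter M a)) (carrier M) (compact_elements L)"
  and principal_order: "a \<in> carrier M \<Longrightarrow> b \<in> carrier M \<Longrightarrow>
    code (principal_filter M a) \<sqsubseteq>\<^bsub>compact_dual L\<^esub> code (principal_filter M b) \<longleftrightarrow> a \<sqsubseteq>\<^bsub>M\<^esub> b"
proof -
  have order: "code (principal_filter M a) \<sqsubseteq>\<^bsub>compact_dual L\<^esub> code (principal_filter M b) \<longleftrightarrow> a \<sqsubseteq>\<^bsub>M\<^esub> b"
    if a: "a \<in> carrier M" and b: "b \<in> carrier M" for a b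
  proof -
    have "principal_filter M b \<subseteq> principal_filter M a \<longleftrightarrow> b \<in> principal_filter M a"
      using principal_self[OF semilattice b] principal_least[OF meet_filter_principal[OF semilattice a]] by blast
    also have "\<dots> \<longleftrightarrow> a \<sqsubseteq>\<^bsub>M\<^esub> b" using b by (simp add: principal_filter_def)
    finally show ?thesis by (simp add: code(2)[OF meet_filter_principal[OF semilattice]] a b)
  qed
  then show "a \<in> carrier M \<Longrightarrow> b \<in> carrier M \<Longrightarrow>
    code (principal_filter M a) \<sqsubseteq>\<^bsub>compact_dual L\<^esub> code (principal_filter M b) \<longleftrightarrow> a \<sqsubseteq>\<^bsub>M\<^esub> b" .
  note po = semilattice_partial_order[OF semilattice]
  have "a = b" if "a \<in> carrier M" "b \<in> carrier M" "code (principal_filter M a) = code (principal_filter M b)" for a b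
    using order[OF that(1,2)] order[OF that(2,1)] order[OF that(1,1)] partial_order_refl[OF po that(1)]
      partial_order_antisym[OF po that(1,2)] that(3) by metis
  then show "bij_betw (\<lambda>a. code (principal_filter M a)) (carrier M) (compact_elements L)"
    using compact_principal compact_is_principal
    by (intro bij_betw_imageI inj_onI equalityI subsetI) (auto simp: image_iff)
qed

end

lemma compact_dual_essentially_surjective:
  assumes M: "M \<in> Obj (DMS_FSup :: 'u order_cat)"
  shows "\<exists>L\<in>Obj (AlgFrm_FInf :: 'u order_cat). \<exists>e. iso_in DMS_FSup (compact_dual L) M e"
proof -
  have dM: "distributive_semilattice M" and sM: "small TYPE('u) (carrier M)" using M by (simp_all add: Obj_DMS)
  have "{F. meet_filter M F} \<subseteq> Pow (carrier M)" by (auto simp: meet_filter_def)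
  from small_subset_Pow[OF sM this]
  obtain P :: "'u set" and d where Pd: "bij_betw d P {F. meet_filter M F}" by (rule lepoll_bij_betw)
  interpret filter_frame M P d using dM Pd by unfold_locales
  have "compact_elements L \<lesssim> carrier M"
    using principal_bij eqpoll_def eqpoll_sym eqpoll_imp_lepoll by metis
  then have sL: "small TYPE('u) (compact_elements L)" by (rule small_lepoll[OF sM])
  have L: "L \<in> Obj AlgFrm_FInf" using algebraic sL by (simp add: Obj_AlgFrm)
  moreover have dual: "compact_dual L \<in> Obj DMS_FSup"
    using compact_dual_distributive[OF algebraic] sL by (simp add: Obj_DMS)
  moreover obtain e where "iso_in DMS_FSup M (compact_dual L) e"
    using iso_in_DMS[OF M dual, of "\<lambda>a. code (principal_filter M a)"] principal_bij principal_order by auto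
  ultimately show ?thesis by (meson iso_in_sym)
qed

section \<open>Admissible sets of a pointed generalized Priestley space\<close>

lemma compact_space_common_point:
  assumes "compact_space T" "\<And>C. C \<in> \<C> \<Longrightarrow> closedin T C"
    and "\<And>\<F>. \<lbrakk>finite \<F>; \<F> \<subseteq> \<C>\<rbrakk> \<Longrightarrow> \<exists>x. \<forall>C\<in>\<F>. x \<in> C"
  shows "\<exists>x. \<forall>C\<in>\<C>. x \<in> C"
proof -
  have "\<Inter>\<F> \<noteq> {}" if "finite \<F> \<and> \<F> \<subseteq> \<C>" for \<F>
    using assms(3)[of \<F>] that by auto
  then have "\<Inter>\<C> \<noteq> {}"
    using assms(1,2) unfolding compact_space_fip by simp
  then show ?thesis by auto
qed

text \<open>
  The contrapositive of \<open>compact_space_common_point\<close>, which extracts a finite subfamily.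
\<close>

lemma compact_space_no_common_point:
  assumes "compact_space T" "\<And>C. C \<in> \<C> \<Longrightarrow> closedin T C" "\<not> (\<exists>x. \<forall>C\<in>\<C>. x \<in> C)"
  shows "\<exists>\<F>. finite \<F> \<and> \<F> \<subseteq> \<C> \<and> \<not> (\<exists>x. \<forall>C\<in>\<F>. x \<in> C)"
proof (rule ccontr)
  assume *: "\<not> ?thesis"
  have "\<exists>x. \<forall>C\<in>\<C>. x \<in> C"
    by (rule compact_space_common_point[OF assms(1,2)]) (use * in blast)+
  then show False using assms(3) by simp
qed

lemma finite_chain_max:
  assumes "partial_order P" "finite T" "T \<noteq> {}" "T \<subseteq> carrier P"
    and "\<And>a b. \<lbrakk>a \<in> T; b \<in> T\<rbrakk> \<Longrightarrow> a \<sqsubseteq>\<^bsub>P\<^esub> b \<or> b \<sqsubseteq>\<^bsub>P\<^esub> a"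
  shows "\<exists>m\<in>T. \<forall>t\<in>T. t \<sqsubseteq>\<^bsub>P\<^esub> m"
  using assms(2-)
proof (induction T rule: finite_ne_induct)
  case (singleton x)
  then show ?case using partial_order_refl[OF assms(1)] by simp
next
  case (insert x F)
  then obtain m where m: "m \<in> F" "\<forall>t\<in>F. t \<sqsubseteq>\<^bsub>P\<^esub> m" by auto
  have c: "x \<in> carrier P" "m \<in> carrier P" "F \<subseteq> carrier P" using insert.prems m(1) by auto
  consider "x \<sqsubseteq>\<^bsub>P\<^esub> m" | "m \<sqsubseteq>\<^bsub>P\<^esub> x" using insert.prems(2)[of x m] m(1) by auto
  then show ?case
  proof cases
    case 1
    then show ?thesis using m by auto
  next
    case 2
    then have "\<forall>t\<in>F. t \<sqsubseteq>\<^bsub>P\<^esub> x"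
      using m(2) partial_order_trans[OF assms(1) _ c(2,1) _ 2] subsetD[OF c(3)] by simp
    then show ?thesis using partial_order_refl[OF assms(1) c(1)] by auto
  qed
qed

lemma clopen_upset_subset: "clopen_upset X U \<Longrightarrow> U \<subseteq> points X"
  by (auto simp: clopen_upset_def dest: openin_subset)

lemma clopen_upset_points: "clopen_upset X (points X)"
  by (simp add: clopen_upset_def)

lemma clopen_upset_Int: "clopen_upset X U \<Longrightarrow> clopen_upset X V \<Longrightarrow> clopen_upset X (U \<inter> V)"
  unfolding clopen_upset_def by (auto intro: openin_Int closedin_Int)

lemma priestley_closedin_up:
  assumes X: "priestley_space X" and x: "x \<in> points X"
  shows "closedin (topo X) {y \<in> points X. x \<sqsubseteq>\<^bsub>ordr X\<^esub> y}"
proof -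
  let ?\<U> = "{U. clopen_upset X U \<and> x \<in> U}"
  have "{y \<in> points X. x \<sqsubseteq>\<^bsub>ordr X\<^esub> y} = \<Inter>?\<U>"
  proof (intro equalityI subsetI)
    fix y assume "y \<in> {y \<in> points X. x \<sqsubseteq>\<^bsub>ordr X\<^esub> y}"
    then show "y \<in> \<Inter>?\<U>" by (auto simp: clopen_upset_def)
  next
    fix y assume y: "y \<in> \<Inter>?\<U>"
    then have "y \<in> points X" using clopen_upset_points[of X] x by auto
    then show "y \<in> {y \<in> points X. x \<sqsubseteq>\<^bsub>ordr X\<^esub> y}"
      using X x y unfolding priestley_space_def by blast
  qed
  moreover have "closedin (topo X) (\<Inter>?\<U>)"
  proof (rule closedin_Inter)
    show "?\<U> \<noteq> {}" using clopen_upset_points[of X] x by blast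
  qed (simp add: clopen_upset_def)
  ultimately show ?thesis by simp
qed

text \<open>
  By Zorn's lemma. The upper sets of the members of a chain are closed and any finitely many of them
  contain a common member of the chain, so by compactness the chain has an upper bound in \<open>K\<close>.
\<close>

lemma priestley_below_maximal:
  assumes X: "priestley_space X" and K: "closedin (topo X) K" and x: "x \<in> K"
  shows "\<exists>y\<in>maximal_points (ordr X) K. x \<sqsubseteq>\<^bsub>ordr X\<^esub> y"
proof -
  have po: "partial_order (ordr X)" and c: "carrier (ordr X) = points X" and comp: "compact_space (topo X)"
    using X by (simp_all add: priestley_space_def)
  have Kp: "K \<subseteq> points X" using closedin_subset[OF K] .
  have xp: "x \<in> points X" using x Kp by blast
  let ?K = "{y \<in> K. x \<sqsubseteq>\<^bsub>ordr X\<^esub> y}"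
  note refl = partial_order_refl[OF po, unfolded c] and trans = partial_order_trans[OF po, unfolded c]
    and antisym = partial_order_antisym[OF po, unfolded c]
  have "\<exists>m\<in>?K. \<forall>a\<in>?K. m \<sqsubseteq>\<^bsub>ordr X\<^esub> a \<longrightarrow> a = m"
  proof (rule predicate_Zorn)
    show "partial_order_on ?K (relation_of (\<lambda>a b. a \<sqsubseteq>\<^bsub>ordr X\<^esub> b) ?K)"
    proof (rule partial_order_on_relation_ofI)
      show "a \<sqsubseteq>\<^bsub>ordr X\<^esub> a" if "a \<in> ?K" for a using refl that Kp by auto
      show "a \<sqsubseteq>\<^bsub>ordr X\<^esub> e" if "a \<in> ?K" "b \<in> ?K" "e \<in> ?K" "a \<sqsubseteq>\<^bsub>ordr X\<^esub> b" "b \<sqsubseteq>\<^bsub>ordr X\<^esub> e" for a b e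
        using trans[of a b e] that Kp by auto
      show "a = b" if "a \<in> ?K" "b \<in> ?K" "a \<sqsubseteq>\<^bsub>ordr X\<^esub> b" "b \<sqsubseteq>\<^bsub>ordr X\<^esub> a" for a b
        using antisym[of a b] that Kp by auto
    qed
    fix C assume C: "C \<in> Chains (relation_of (\<lambda>a b. a \<sqsubseteq>\<^bsub>ordr X\<^esub> b) ?K)"
    have CK: "C \<subseteq> ?K" using Chains_relation_of[OF C] .
    have chain: "a \<sqsubseteq>\<^bsub>ordr X\<^esub> b \<or> b \<sqsubseteq>\<^bsub>ordr X\<^esub> a" if "a \<in> C" "b \<in> C" for a b
      using C that by (auto simp: Chains_def relation_of_def)
    define up where "up a = {y \<in> points X. a \<sqsubseteq>\<^bsub>ordr X\<^esub> y}" for a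
    have "\<exists>u. \<forall>D\<in>insert K (up ` insert x C). u \<in> D"
    proof (rule compact_space_common_point[OF comp])
      fix D assume "D \<in> insert K (up ` insert x C)"
      then show "closedin (topo X) D"
        using K priestley_closedin_up[OF X] xp CK Kp by (auto simp: up_def)
    next
      fix \<F> assume "finite \<F>" "\<F> \<subseteq> insert K (up ` insert x C)"
      then have "finite (\<F> - {K})" "\<F> - {K} \<subseteq> up ` insert x C" by auto
      then obtain T where T: "T \<subseteq> insert x C" "finite T" "\<F> - {K} = up ` T"
        by (metis finite_subset_image)
      have xT: "insert x T \<subseteq> points X" using T(1) xp CK Kp by auto
      have "\<exists>m\<in>insert x T. \<forall>t\<in>insert x T. t \<sqsubseteq>\<^bsub>ordr X\<^esub> m"
      proof (rule finite_chain_max[OF po])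
        show "finite (insert x T)" "insert x T \<noteq> {}" "insert x T \<subseteq> carrier (ordr X)"
          using T(2) xT by (simp_all add: c)
        have xa: "x \<sqsubseteq>\<^bsub>ordr X\<^esub> a" if "a \<in> insert x T" for a
          using that T(1) CK refl[OF xp] by auto
        fix a b assume ab: "a \<in> insert x T" "b \<in> insert x T"
        show "a \<sqsubseteq>\<^bsub>ordr X\<^esub> b \<or> b \<sqsubseteq>\<^bsub>ordr X\<^esub> a"
        proof (cases "a = x \<or> b = x")
          case True
          then show ?thesis using xa ab by auto
        next
          case False
          then show ?thesis using chain[of a b] ab T(1) by auto
        qed
      qed
      then obtain m where m: "m \<in> insert x T" "\<forall>t\<in>insert x T. t \<sqsubseteq>\<^bsub>ordr X\<^esub> m" by blast
      have "m \<in> K" using m(1) T(1) CK x by auto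
      moreover have "m \<in> up t" if "t \<in> T" for t using m xT that by (auto simp: up_def)
      ultimately have "\<forall>D\<in>\<F>. m \<in> D" using T(3) by blast
      then show "\<exists>u. \<forall>D\<in>\<F>. u \<in> D" by blast
    qed
    then obtain u where "u \<in> K" "u \<in> up x" "\<forall>a\<in>C. u \<in> up a" by auto
    then show "\<exists>u\<in>?K. \<forall>a\<in>C. a \<sqsubseteq>\<^bsub>ordr X\<^esub> u" by (auto simp: up_def)
  qed
  then obtain m where m: "m \<in> ?K" "\<forall>a\<in>?K. m \<sqsubseteq>\<^bsub>ordr X\<^esub> a \<longrightarrow> a = m" by blast
  have "y = m" if "y \<in> K" "m \<sqsubseteq>\<^bsub>ordr X\<^esub> y" for y
    using trans[of x m y] m that Kp xp by auto
  then show ?thesis using m(1) by (auto simp: maximal_points_def)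
qed

lemma directed_finite:
  assumes "directed_by_inclusion \<U>" "\<U> \<noteq> {}" "finite \<F>" "\<F> \<subseteq> \<U>"
  shows "\<exists>W\<in>\<U>. \<forall>U\<in>\<F>. U \<subseteq> W"
  using assms(3,4)
proof (induction \<F>)
  case empty
  then show ?case using assms(2) by auto
next
  case (insert U \<F>)
  then obtain W where "W \<in> \<U>" "\<forall>U\<in>\<F>. U \<subseteq> W" by auto
  moreover obtain V where "V \<in> \<U>" "U \<subseteq> V" "W \<subseteq> V"
    using assms(1) insert.prems \<open>W \<in> \<U>\<close> unfolding directed_by_inclusion_def by (metis insert_subset)
  ultimately show ?case by (intro bexI[of _ V]) auto
qed

locale pgps_space =
  fixes X :: "'a pspace"
  assumes pgps: "pgps X"
begin

lemma priestley: "priestley_space X"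
  using pgps by (simp add: pgps_def)

lemma compact: "compact_space (topo X)"
  and po: "partial_order (ordr X)"
  and carrier: "carrier (ordr X) = points X"
  using priestley by (simp_all add: priestley_space_def)

lemmas ord_antisym = partial_order_antisym[OF po, unfolded carrier]

lemma pt: "pt X \<in> points X" "x \<in> points X \<Longrightarrow> x \<sqsubseteq>\<^bsub>ordr X\<^esub> pt X"
proof -
  have "greatest (ordr X) (pt X) (points X)" using pgps unfolding pgps_def by blast
  then show "pt X \<in> points X" "x \<in> points X \<Longrightarrow> x \<sqsubseteq>\<^bsub>ordr X\<^esub> pt X"
    by (simp_all add: greatest_def carrier)
qed

lemma pt_unique: "x \<in> points X \<Longrightarrow> pt X \<sqsubseteq>\<^bsub>ordr X\<^esub> x \<Longrightarrow> x = pt X"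
  using ord_antisym pt by simp

lemma base: "base X \<subseteq> points X - {pt X}"
  using pgps unfolding pgps_def by blast

lemma base_directed: "x \<in> base X \<Longrightarrow> admissible_avoiding X x \<noteq> {} \<and> directed_by_inclusion (admissible_avoiding X x)"
  using pgps base unfolding pgps_def by blast

lemma base_dense:
  assumes "openin (topo X) D" "x \<in> D" "pt X \<notin> D"
  obtains y where "y \<in> base X" "y \<in> D"
proof -
  let ?S = "subtopology (topo X) (points X - {pt X})"
  have D: "D \<subseteq> points X - {pt X}" using openin_subset[OF assms(1)] assms(3) by blast
  have "?S closure_of base X = points X - {pt X}" using pgps unfolding pgps_def by blast
  then have "x \<in> ?S closure_of base X" using D assms(2) by blast
  moreover have "openin ?S D"
    unfolding openin_subtopology using assms(1) D by (intro exI[of _ D]) auto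
  ultimately show ?thesis using assms(2) that unfolding in_closure_of by metis
qed

lemma ord_iff: "x \<in> points X \<Longrightarrow> y \<in> points X \<Longrightarrow> x \<sqsubseteq>\<^bsub>ordr X\<^esub> y \<longleftrightarrow> (\<forall>U\<in>admissible X. x \<in> U \<longrightarrow> y \<in> U)"
  using pgps unfolding pgps_def by blast

lemma admissible_clopen_upset: "U \<in> admissible X \<Longrightarrow> clopen_upset X U"
  by (simp add: admissible_def)

lemma admissible_subset: "U \<in> admissible X \<Longrightarrow> U \<subseteq> points X"
  using clopen_upset_subset[OF admissible_clopen_upset] .

lemma admissible_open: "U \<in> admissible X \<Longrightarrow> openin (topo X) U"
  and admissible_closed: "U \<in> admissible X \<Longrightarrow> closedin (topo X) U"
  and admissible_up: "U \<in> admissible X \<Longrightarrow> x \<in> U \<Longrightarrow> y \<in> points X \<Longrightarrow> x \<sqsubseteq>\<^bsub>ordr X\<^esub> y \<Longrightarrow> y \<in> U"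
  using admissible_clopen_upset[of U] by (auto simp: clopen_upset_def)

lemma admissible_points: "points X \<in> admissible X"
  by (simp add: admissible_def clopen_upset_points maximal_points_def)

lemma admissible_Int: "U \<in> admissible X \<Longrightarrow> V \<in> admissible X \<Longrightarrow> U \<inter> V \<in> admissible X"
proof -
  assume "U \<in> admissible X" "V \<in> admissible X"
  moreover have "maximal_points (ordr X) (points X - U \<inter> V) \<subseteq>
      maximal_points (ordr X) (points X - U) \<union> maximal_points (ordr X) (points X - V)"
    by (auto simp: maximal_points_def)
  ultimately show ?thesis using clopen_upset_Int[of X U V] unfolding admissible_def by blast
qed

lemma admissible_finite_Inter:
  assumes "finite \<F>" "\<F> \<subseteq> admissible X" shows "points X \<inter> \<Inter>\<F> \<in> admissible X"
  using assms
proof (induction \<F>)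
  case empty
  then show ?case using admissible_points by simp
next
  case (insert U \<F>)
  then have "U \<in> admissible X" "points X \<inter> \<Inter>\<F> \<in> admissible X" by simp_all
  then have "U \<inter> (points X \<inter> \<Inter>\<F>) \<in> admissible X" by (rule admissible_Int)
  moreover have "U \<inter> (points X \<inter> \<Inter>\<F>) = points X \<inter> \<Inter>(insert U \<F>)" by auto
  ultimately show ?case by simp
qed

text \<open>
  Otherwise \<open>pt X\<close>, being the maximum, would be a maximal point of the complement, but it is not in
  \<open>base X\<close>. In particular the empty set is not admissible.
\<close>

lemma admissible_pt: assumes U: "U \<in> admissible X" shows "pt X \<in> U"
proof (rule ccontr)
  assume "pt X \<notin> U"
  then have "pt X \<in> maximal_points (ordr X) (points X - U)"
    using pt(1) pt_unique by (auto simp: maximal_points_def)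
  then have "pt X \<in> base X" using U unfolding admissible_def by blast
  then show False using base by blast
qed

text \<open>
  Existing nonempty finite suprema of admissible sets are unions. Otherwise \<open>W - \<Union>\<U>\<close> is a nonempty open set, and
  it misses \<open>pt X\<close> since \<open>\<U>\<close> is nonempty. By density it contains a point \<open>y\<close> of \<open>base X\<close>. The admissible
  sets avoiding \<open>y\<close> are directed, so one of them contains all of \<open>\<U>\<close>; it is an upper bound of \<open>\<U>\<close> that
  fails to contain \<open>W\<close>.
\<close>

lemma admissible_covered:
  assumes W: "W \<in> admissible X" and \<U>: "finite \<U>" "\<U> \<noteq> {}" "\<U> \<subseteq> admissible X"
    and bound: "\<And>V. \<lbrakk>V \<in> admissible X; \<And>U. U \<in> \<U> \<Longrightarrow> U \<subseteq> V\<rbrakk> \<Longrightarrow> W \<subseteq> V"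
  shows "W \<subseteq> \<Union>\<U>"
proof (rule ccontr)
  assume "\<not> W \<subseteq> \<Union>\<U>"
  then obtain x where x: "x \<in> W - \<Union>\<U>" by blast
  have "closedin (topo X) (\<Union>\<U>)"
    using \<U>(1,3) admissible_closed by (intro closedin_Union) auto
  then have D: "openin (topo X) (W - \<Union>\<U>)" using admissible_open[OF W] by (rule openin_diff[rotated])
  have "pt X \<notin> W - \<Union>\<U>" using \<U>(2,3) admissible_pt by auto
  then obtain y where y: "y \<in> base X" "y \<in> W - \<Union>\<U>" using base_dense[OF D x] by blast
  have "\<U> \<subseteq> admissible_avoiding X y" using y(2) \<U>(3) by (auto simp: admissible_avoiding_def)
  then obtain V where V: "V \<in> admissible_avoiding X y" "\<forall>U\<in>\<U>. U \<subseteq> V"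
    using directed_finite[of "admissible_avoiding X y" \<U>] base_directed[OF y(1)] \<U>(1) by blast
  then have "W \<subseteq> V" using bound[of V] by (simp add: admissible_avoiding_def)
  then show False using V(1) y(2) by (auto simp: admissible_avoiding_def)
qed

text \<open>
  A point \<open>x\<close> outside \<open>W\<close> lies below a maximal point \<open>y\<close> outside \<open>W\<close>, and \<open>y\<close> belongs to \<open>base X\<close>. It misses
  \<open>U\<close> or \<open>V\<close>, so by directedness some admissible set above \<open>W\<close> and above this set avoids \<open>y\<close>, hence also \<open>x\<close>.
  Thus \<open>W\<close> is the intersection of the admissible sets that contain \<open>W\<close> together with \<open>U\<close> or with \<open>V\<close>; by
  compactness finitely many suffice, and \<open>U'\<close>, \<open>V'\<close> collect those of either kind.
\<close>

lemma admissible_distributive: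
  assumes UVW: "U \<in> admissible X" "V \<in> admissible X" "W \<in> admissible X" "U \<inter> V \<subseteq> W"
  shows "\<exists>U'\<in>admissible X. \<exists>V'\<in>admissible X. U \<subseteq> U' \<and> V \<subseteq> V' \<and> U' \<inter> V' = W"
proof -
  \<comment> \<open>For \<open>A\<close> equal to \<open>U\<close> or \<open>V\<close>, the candidates for the factors of \<open>U'\<close> or \<open>V'\<close>.\<close>
  define \<G> where "\<G> A = {B \<in> admissible X. A \<subseteq> B \<and> W \<subseteq> B}" for A
  let ?C = "insert (points X - W) (\<G> U \<union> \<G> V)"
  have "\<exists>\<F>. finite \<F> \<and> \<F> \<subseteq> ?C \<and> \<not> (\<exists>x. \<forall>C\<in>\<F>. x \<in> C)"
  proof (rule ccontr)
    assume *: "\<not> ?thesis"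
    have "\<exists>x. \<forall>C\<in>?C. x \<in> C"
    proof (rule compact_space_common_point[OF compact])
      show "closedin (topo X) C" if "C \<in> ?C" for C
        using that admissible_closed admissible_open[OF UVW(3)] by (auto simp: \<G>_def intro: closedin_diff)
    qed (use * in blast)
    then obtain x where x: "x \<in> points X - W" "\<forall>C\<in>\<G> U \<union> \<G> V. x \<in> C" by blast
    have "closedin (topo X) (points X - W)"
      using admissible_open[OF UVW(3)] by (intro closedin_diff) auto
    then obtain y where y: "y \<in> maximal_points (ordr X) (points X - W)" "x \<sqsubseteq>\<^bsub>ordr X\<^esub> y"
      using priestley_below_maximal[OF priestley _ x(1)] by blast
    have yp: "y \<in> points X - W" using y(1) by (simp add: maximal_points_def)
    have "y \<in> base X" using y(1) UVW(3) unfolding admissible_def by blast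
    note dir = base_directed[OF this]
    obtain A where A: "A \<in> {U, V}" "y \<notin> A" using yp UVW(4) by blast
    have "A \<in> admissible_avoiding X y" "W \<in> admissible_avoiding X y"
      using A UVW yp by (auto simp: admissible_avoiding_def)
    then obtain B where B: "B \<in> admissible_avoiding X y" "A \<subseteq> B" "W \<subseteq> B"
      using dir unfolding directed_by_inclusion_def by blast
    then have "B \<in> \<G> U \<union> \<G> V" using A(1) by (auto simp: \<G>_def admissible_avoiding_def)
    then have "x \<in> B" using x(2) by blast
    then have "y \<in> B" using admissible_up[of B x y] B(1) y(2) yp by (simp add: admissible_avoiding_def)
    then show False using B(1) by (simp add: admissible_avoiding_def)
  qed
  then obtain \<F> where \<F>: "finite \<F>" "\<F> \<subseteq> ?C" "\<not> (\<exists>x. \<forall>C\<in>\<F>. x \<in> C)" by blast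
  define meet where "meet A = points X \<inter> \<Inter>(\<F> \<inter> \<G> A)" for A
  have m: "meet A \<in> admissible X" "W \<subseteq> meet A" if "A \<in> admissible X" for A
  proof -
    show "meet A \<in> admissible X"
      unfolding meet_def using \<F>(1) by (intro admissible_finite_Inter) (auto simp: \<G>_def)
    show "W \<subseteq> meet A" using admissible_subset[OF UVW(3)] by (auto simp: meet_def \<G>_def)
  qed
  have U': "A \<subseteq> meet A" if "A \<in> admissible X" for A
    using admissible_subset[OF that] by (auto simp: meet_def \<G>_def)
  have "x \<in> W" if "x \<in> meet U \<inter> meet V" for x
  proof (rule ccontr)
    assume "x \<notin> W"
    then have "\<forall>C\<in>\<F>. x \<in> C" using that \<F>(2) by (auto simp: meet_def)
    then show False using \<F>(3) by blast
  qed
  then have "meet U \<inter> meet V = W" using m(2)[OF UVW(1)] m(2)[OF UVW(2)] by auto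
  then show ?thesis
    using m(1)[OF UVW(1)] m(1)[OF UVW(2)] U'[OF UVW(1)] U'[OF UVW(2)] by blast
qed

text \<open>
  A point with the prescribed admissible neighbourhoods exists by compactness: as \<open>G\<close> is closed under
  finite intersections, the primeness condition is the finite intersection property of \<open>G\<close> together with the complements of the admissible sets outside \<open>G\<close>.
  When no complement occurs, \<open>pt X\<close> is a common point.
\<close>

lemma point_of_filter:
  assumes G: "G \<subseteq> admissible X" "points X \<in> G" "\<And>U V. \<lbrakk>U \<in> G; V \<in> G\<rbrakk> \<Longrightarrow> U \<inter> V \<in> G"
    and prime: "\<And>U \<V>. \<lbrakk>U \<in> G; finite \<V>; \<V> \<noteq> {}; \<V> \<subseteq> admissible X - G\<rbrakk> \<Longrightarrow> \<not> U \<subseteq> \<Union>\<V>"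
  shows "\<exists>x\<in>points X. \<forall>U\<in>admissible X. x \<in> U \<longleftrightarrow> U \<in> G"
proof -
  let ?D = "(\<lambda>V. points X - V) ` (admissible X - G)"
  have Gfin: "points X \<inter> \<Inter>\<F> \<in> G" if "finite \<F>" "\<F> \<subseteq> G" for \<F>
    using that
  proof (induction \<F>)
    case empty
    then show ?case using G(2) by simp
  next
    case (insert U \<F>)
    then have "U \<in> G" "points X \<inter> \<Inter>\<F> \<in> G" by simp_all
    then have "U \<inter> (points X \<inter> \<Inter>\<F>) \<in> G" by (rule G(3))
    moreover have "U \<inter> (points X \<inter> \<Inter>\<F>) = points X \<inter> \<Inter>(insert U \<F>)" by auto
    ultimately show ?case by simp
  qed
  have "\<exists>x. \<forall>C\<in>G \<union> ?D. x \<in> C"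
  proof (rule compact_space_common_point[OF compact])
    show "closedin (topo X) C" if "C \<in> G \<union> ?D" for C
      using that G(1) admissible_closed admissible_open by (auto intro!: closedin_diff)
  next
    fix \<F> assume \<F>: "finite \<F>" "\<F> \<subseteq> G \<union> ?D"
    have "finite (\<F> - G)" "\<F> - G \<subseteq> ?D" using \<F> by auto
    then obtain \<V> where \<V>: "\<V> \<subseteq> admissible X - G" "finite \<V>" "\<F> - G = (\<lambda>V. points X - V) ` \<V>"
      by (metis finite_subset_image)
    let ?U = "points X \<inter> \<Inter>(\<F> \<inter> G)"
    have U: "?U \<in> G" using \<F>(1) by (intro Gfin) simp_all
    have "\<exists>x. x \<in> ?U - \<Union>\<V>"
    proof (cases "\<V> = {}")
      case True
      then show ?thesis using admissible_pt[OF subsetD[OF G(1) U]] by auto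
    next
      case False
      then show ?thesis using prime[OF U \<V>(2) _ \<V>(1)] by auto
    qed
    then obtain x where x: "x \<in> ?U - \<Union>\<V>" by blast
    have "x \<in> C" if "C \<in> \<F>" for C
    proof (cases "C \<in> G")
      case True
      then have "C \<in> \<F> \<inter> G" using that by simp
      then show ?thesis using x by simp
    next
      case False
      then have "C \<in> (\<lambda>V. points X - V) ` \<V>" unfolding \<V>(3)[symmetric] using that by simp
      then obtain V where "V \<in> \<V>" "C = points X - V" by (rule imageE)
      then show ?thesis using x by simp
    qed
    then show "\<exists>x. \<forall>C\<in>\<F>. x \<in> C" by blast
  qed
  then obtain x where x: "\<forall>C\<in>G \<union> ?D. x \<in> C" by blast
  have xG: "x \<in> C" if "C \<in> G" for C using x that by simp
  have xD: "x \<notin> V" if "V \<in> admissible X - G" for V using bspec[OF x, of "points X - V"] that by simp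
  have "x \<in> U \<longleftrightarrow> U \<in> G" if "U \<in> admissible X" for U using xG[of U] xD[of U] that by auto
  then show ?thesis using xG[OF G(2)] by auto
qed

text \<open>
  The admissible sets have \<open>pt X\<close> as their only common point, since they determine the order. If
  \<open>{pt X}\<close> is open, compactness makes it a finite intersection of admissible sets.
\<close>

lemma isolated_iff:
  "openin (topo X) {pt X} \<longleftrightarrow> {pt X} \<in> admissible X"
proof
  assume op: "openin (topo X) {pt X}"
  let ?C = "insert (points X - {pt X}) (admissible X)"
  have "\<exists>\<F>. finite \<F> \<and> \<F> \<subseteq> ?C \<and> \<not> (\<exists>x. \<forall>C\<in>\<F>. x \<in> C)"
  proof (rule ccontr)
    assume *: "\<not> ?thesis"
    have "\<exists>x. \<forall>C\<in>?C. x \<in> C"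
    proof (rule compact_space_common_point[OF compact])
      show "closedin (topo X) C" if "C \<in> ?C" for C
        using that admissible_closed op by (auto intro: closedin_diff)
    qed (use * in blast)
    then obtain x where x: "x \<in> points X - {pt X}" "\<forall>U\<in>admissible X. x \<in> U" by blast
    then have "pt X \<sqsubseteq>\<^bsub>ordr X\<^esub> x" using ord_iff[OF pt(1), of x] by blast
    then show False using pt_unique x(1) by blast
  qed
  then obtain \<F> where \<F>: "finite \<F>" "\<F> \<subseteq> ?C" "\<not> (\<exists>x. \<forall>C\<in>\<F>. x \<in> C)" by blast
  let ?U = "points X \<inter> \<Inter>(\<F> \<inter> admissible X)"
  have U: "?U \<in> admissible X" using \<F>(1) by (intro admissible_finite_Inter) auto
  have "x = pt X" if "x \<in> ?U" for x
  proof (rule ccontr)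
    assume "x \<noteq> pt X"
    then have "\<forall>C\<in>\<F>. x \<in> C" using that \<F>(2) by auto
    then show False using \<F>(3) by blast
  qed
  then have "?U = {pt X}" using admissible_pt[OF U] by blast
  then show "{pt X} \<in> admissible X" using U by simp
qed (rule admissible_open)

lemma least_admissible:
  assumes Z: "Z \<in> admissible X" "\<And>U. U \<in> admissible X \<Longrightarrow> Z \<subseteq> U"
  shows "Z = {pt X}"
proof -
  have "x = pt X" if "x \<in> Z" for x
  proof (rule pt_unique)
    show "x \<in> points X" using that admissible_subset[OF Z(1)] by blast
    then show "pt X \<sqsubseteq>\<^bsub>ordr X\<^esub> x" using ord_iff[OF pt(1), of x] Z(2) that by blast
  qed
  then show ?thesis using admissible_pt[OF Z(1)] by blast
qed

end

section \<open>The duality functor on spaces\<close>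

text \<open>
  Admissible sets, being subsets of the universe, are named by its elements through an arbitrary
  injection; it exists for spaces that are small in the sense of \<open>small\<close>.
\<close>

definition enc :: "'u pspace \<Rightarrow> 'u set \<Rightarrow> 'u" where
  "enc X = (SOME e. inj_on e (admissible X))"

definition dec :: "'u pspace \<Rightarrow> 'u \<Rightarrow> 'u set" where
  "dec X = inv_into (admissible X) (enc X)"

definition admissible_order :: "'u pspace \<Rightarrow> 'u gorder" where
  "admissible_order X = set_order (enc X ` admissible X) (dec X)"

definition inverse_image :: "'u pspace \<Rightarrow> 'u pspace \<Rightarrow> ('u \<Rightarrow> 'u) \<Rightarrow> 'u \<Rightarrow> 'u" where
  "inverse_image X Y f = (\<lambda>u\<in>carrier (admissible_order Y). enc X (f -` dec Y u \<inter> points X))"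

lemma admissible_order_le [simp]: "u \<sqsubseteq>\<^bsub>admissible_order X\<^esub> v \<longleftrightarrow> dec X u \<subseteq> dec X v"
  by (simp add: admissible_order_def)

locale small_pgps = pgps_space X for X :: "'u pspace" +
  assumes small: "small TYPE('u) (admissible X)"
begin

abbreviation "M \<equiv> admissible_order X"

lemma inj_enc: "inj_on (enc X) (admissible X)"
proof -
  have "\<exists>e :: 'u set \<Rightarrow> 'u. inj_on e (admissible X)"
    using small_self[OF small] by (auto simp: lepoll_def)
  then show ?thesis unfolding enc_def by (rule someI_ex)
qed

lemma carrier_M: "carrier M = enc X ` admissible X"
  by (simp add: admissible_order_def)

lemma enc_in: "U \<in> admissible X \<Longrightarrow> enc X U \<in> carrier M"
  by (simp add: carrier_M)

lemma dec_enc: "U \<in> admissible X \<Longrightarrow> dec X (enc X U) = U"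
  unfolding dec_def by (rule inv_into_f_f[OF inj_enc])

lemma dec_in: "u \<in> carrier M \<Longrightarrow> dec X u \<in> admissible X"
  unfolding dec_def carrier_M by (rule inv_into_into)

lemma enc_dec: "u \<in> carrier M \<Longrightarrow> enc X (dec X u) = u"
  unfolding dec_def carrier_M by (rule f_inv_into_f)

lemma dec_eqD: "u \<in> carrier M \<Longrightarrow> v \<in> carrier M \<Longrightarrow> dec X u = dec X v \<Longrightarrow> u = v"
  using enc_dec by metis

lemma partial_order_M: "partial_order M"
  unfolding admissible_order_def
  by (rule partial_order_set_order) (rule inj_onI, rule dec_eqD, simp_all add: carrier_M)

lemma dec_image: "F \<subseteq> carrier M \<Longrightarrow> dec X ` F \<subseteq> admissible X"
  using dec_in by blast

lemma M_glb:
  assumes F: "F \<subseteq> carrier M" "finite F"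
  shows "is_glb M (enc X (points X \<inter> \<Inter>(dec X ` F))) F"
proof -
  have A: "points X \<inter> \<Inter>(dec X ` F) \<in> admissible X"
    using F dec_image by (intro admissible_finite_Inter) auto
  have "dec X y \<subseteq> points X" if "y \<in> carrier M" for y
    by (rule admissible_subset[OF dec_in[OF that]])
  then show ?thesis
    using enc_in[OF A] dec_enc[OF A] unfolding is_glb_iff[OF F(1)] by auto
qed

lemma semilattice: "meet_semilattice M"
  unfolding meet_semilattice_def using partial_order_M M_glb by auto

lemma dec_inf:
  assumes F: "F \<subseteq> carrier M" "finite F"
  shows "dec X (\<Sqinter>\<^bsub>M\<^esub> F) = points X \<inter> \<Inter>(dec X ` F)"
proof -
  have "points X \<inter> \<Inter>(dec X ` F) \<in> admissible X"
    using F dec_image by (intro admissible_finite_Inter) auto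
  then show ?thesis unfolding inf_eqI[OF partial_order_M M_glb[OF F]] by (rule dec_enc)
qed

lemma dec_meet:
  assumes "u \<in> carrier M" "v \<in> carrier M"
  shows "dec X (u \<sqinter>\<^bsub>M\<^esub> v) = dec X u \<inter> dec X v"
  unfolding meet_def using dec_inf[of "{u, v}"] admissible_subset[OF dec_in[OF assms(1)]] assms by auto

lemma distributive: "distributive_semilattice M"
  unfolding distributive_semilattice_def
proof (intro conjI ballI impI)
  fix a b c assume abc: "a \<in> carrier M" "b \<in> carrier M" "c \<in> carrier M" and le: "a \<sqinter>\<^bsub>M\<^esub> b \<sqsubseteq>\<^bsub>M\<^esub> c"
  have "dec X a \<inter> dec X b \<subseteq> dec X c" using le dec_meet[OF abc(1,2)] by simp
  then obtain U V where UV: "U \<in> admissible X" "V \<in> admissible X" "dec X a \<subseteq> U" "dec X b \<subseteq> V" "U \<inter> V = dec X c"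
    using admissible_distributive[OF dec_in[OF abc(1)] dec_in[OF abc(2)] dec_in[OF abc(3)]] by auto
  have "dec X (enc X U \<sqinter>\<^bsub>M\<^esub> enc X V) = dec X c"
    using UV by (simp add: dec_meet enc_in dec_enc)
  then have "enc X U \<sqinter>\<^bsub>M\<^esub> enc X V = c"
    using dec_eqD[OF semilattice_meet_closed[OF semilattice enc_in[OF UV(1)] enc_in[OF UV(2)]] abc(3)] by simp
  then show "\<exists>a'\<in>carrier M. \<exists>b'\<in>carrier M. a \<sqsubseteq>\<^bsub>M\<^esub> a' \<and> b \<sqsubseteq>\<^bsub>M\<^esub> b' \<and> a' \<sqinter>\<^bsub>M\<^esub> b' = c"
    using UV by (intro bexI[of _ "enc X U"] bexI[of _ "enc X V"]) (simp_all add: enc_in dec_enc)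
qed (rule semilattice)

lemma M_lub_iff:
  assumes F: "F \<subseteq> carrier M" "finite F" "F \<noteq> {}"
  shows "is_lub M s F \<longleftrightarrow> s \<in> carrier M \<and> dec X s = \<Union>(dec X ` F)"
proof
  assume s: "is_lub M s F"
  then have sc: "s \<in> carrier M" and up: "\<And>u. u \<in> F \<Longrightarrow> dec X u \<subseteq> dec X s"
    and least: "\<And>y. \<lbrakk>y \<in> carrier M; \<And>u. u \<in> F \<Longrightarrow> dec X u \<subseteq> dec X y\<rbrakk> \<Longrightarrow> dec X s \<subseteq> dec X y"
    unfolding is_lub_iff[OF F(1)] by simp_all
  have "dec X s \<subseteq> \<Union>(dec X ` F)"
  proof (rule admissible_covered[OF dec_in[OF sc]])
    show "finite (dec X ` F)" "dec X ` F \<noteq> {}" "dec X ` F \<subseteq> admissible X" using F dec_image by simp_all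
    fix V assume V: "V \<in> admissible X" "\<And>U. U \<in> dec X ` F \<Longrightarrow> U \<subseteq> V"
    then show "dec X s \<subseteq> V" using least[OF enc_in[OF V(1)]] by (simp add: dec_enc)
  qed
  then show "s \<in> carrier M \<and> dec X s = \<Union>(dec X ` F)" using sc up by auto
next
  assume "s \<in> carrier M \<and> dec X s = \<Union>(dec X ` F)"
  then show "is_lub M s F" unfolding is_lub_iff[OF F(1)] by auto
qed

lemma M_least_iff:
  "least M z (carrier M) \<longleftrightarrow> openin (topo X) {pt X} \<and> z = enc X {pt X}"
proof
  assume z: "least M z (carrier M)"
  then have zc: "z \<in> carrier M" by (simp add: least_iff)
  have "dec X z = {pt X}"
  proof (rule least_admissible[OF dec_in[OF zc]])
    fix U assume "U \<in> admissible X"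
    then show "dec X z \<subseteq> U" using z enc_in[of U] dec_enc[of U] by (auto simp: least_iff)
  qed
  then show "openin (topo X) {pt X} \<and> z = enc X {pt X}"
    using isolated_iff dec_in[OF zc] enc_dec[OF zc] by simp
next
  assume "openin (topo X) {pt X} \<and> z = enc X {pt X}"
  then have A: "{pt X} \<in> admissible X" and z: "z = enc X {pt X}" using isolated_iff by simp_all
  have "pt X \<in> dec X y" if "y \<in> carrier M" for y
    by (rule admissible_pt[OF dec_in[OF that]])
  then show "least M z (carrier M)" by (simp add: least_iff z enc_in[OF A] dec_enc[OF A])
qed

lemma Obj_M: "M \<in> Obj (DMS_FSup :: 'u order_cat)"
proof -
  have "carrier M \<lesssim> admissible X" unfolding carrier_M by (rule image_lepoll)
  then show ?thesis using distributive small_lepoll[OF small] by (simp add: Obj_DMS)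
qed

end

lemma Obj_PGPS: "Obj PGPS_S = {X :: 'u pspace. small_pgps X}"
  and Hom_PGPS: "Hom PGPS_S = (strong_hom :: 'u pspace \<Rightarrow> 'u pspace \<Rightarrow> _)"
  and Id_PGPS: "Id PGPS_S = (\<lambda>X :: 'u pspace. \<lambda>x\<in>points X. x)"
  and Comp_PGPS: "Comp PGPS_S = (\<lambda>X Y Z :: 'u pspace. \<lambda>g f. compose (points X) g f)"
  by (simp_all add: PGPS_S_def concrete_cat_def small_pgps_def small_pgps_axioms_def pgps_space_def)

lemma strong_hom_funcset: "strong_hom X Y \<subseteq> points X \<rightarrow>\<^sub>E points Y"
  by (auto simp: strong_hom_def)

lemma strong_hom_point: "f \<in> strong_hom X Y \<Longrightarrow> x \<in> points X \<Longrightarrow> f x \<in> points Y"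
  by (auto simp: strong_hom_def)

lemma strong_hom_vimage: "f \<in> strong_hom X Y \<Longrightarrow> U \<in> admissible Y \<Longrightarrow> f -` U \<inter> points X \<in> admissible X"
  by (simp add: strong_hom_def)

lemma strong_hom_id: "(\<lambda>x\<in>points X. x) \<in> strong_hom X X"
proof -
  have "(\<lambda>x\<in>points X. x) -` U \<inter> points X = U" if "U \<in> admissible X" for U
    using that clopen_upset_subset[of X U] by (auto simp: admissible_def)
  then show ?thesis by (auto simp: strong_hom_def)
qed

lemma strong_hom_compose:
  assumes f: "f \<in> strong_hom X Y" and g: "g \<in> strong_hom Y Z"
  shows "compose (points X) g f \<in> strong_hom X Z"
proof -
  have "compose (points X) g f -` U \<inter> points X = f -` (g -` U \<inter> points Y) \<inter> points X" for U
    using strong_hom_point[OF f] by (auto simp: compose_def)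
  then have "compose (points X) g f -` U \<inter> points X \<in> admissible X" if "U \<in> admissible Z" for U
    using strong_hom_vimage[OF f strong_hom_vimage[OF g that]] by simp
  moreover have "compose (points X) g f x \<sqsubseteq>\<^bsub>ordr Z\<^esub> compose (points X) g f y"
    if "x \<in> points X" "y \<in> points X" "x \<sqsubseteq>\<^bsub>ordr X\<^esub> y" for x y
    using f g that strong_hom_point[OF f] unfolding strong_hom_def by (simp add: compose_def)
  moreover have "compose (points X) g f \<in> points X \<rightarrow>\<^sub>E points Z"
    using strong_hom_point[OF f] strong_hom_point[OF g] by (auto simp: compose_def)
  ultimately show ?thesis by (simp add: strong_hom_def)
qed

lemma category_PGPS: "category PGPS_S"
  unfolding PGPS_S_def
  by (rule category_concrete[OF strong_hom_funcset]) (simp_all add: strong_hom_id strong_hom_compose)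

locale small_pgps_pair = X: small_pgps X + Y: small_pgps Y for X Y :: "'u pspace"
begin

lemma dec_inverse_image:
  assumes f: "f \<in> strong_hom X Y" and u: "u \<in> carrier Y.M"
  shows "dec X (inverse_image X Y f u) = f -` dec Y u \<inter> points X" "inverse_image X Y f u \<in> carrier X.M"
  using X.dec_enc[OF strong_hom_vimage[OF f Y.dec_in[OF u]]]
    X.enc_in[OF strong_hom_vimage[OF f Y.dec_in[OF u]]] u by (simp_all add: inverse_image_def)

lemma inverse_image_FSup:
  assumes f: "f \<in> strong_hom X Y"
  shows "inverse_image X Y f \<in> FSup_hom Y.M X.M"
proof -
  let ?h = "inverse_image X Y f"
  note d = dec_inverse_image[OF f]
  have hF: "?h ` F \<subseteq> carrier X.M" if "F \<subseteq> carrier Y.M" for F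
    using d(2) that by blast
  have dF: "dec X ` ?h ` F = (\<lambda>u. f -` dec Y u \<inter> points X) ` F" if "F \<subseteq> carrier Y.M" for F
    unfolding image_image using d(1) that by (intro image_cong) auto
  have "?h (\<Sqinter>\<^bsub>Y.M\<^esub> F) = \<Sqinter>\<^bsub>X.M\<^esub> (?h ` F)" if F: "F \<subseteq> carrier Y.M" "finite F" for F
  proof (rule X.dec_eqD)
    note i = semilattice_inf_closed[OF Y.semilattice F]
    show "?h (\<Sqinter>\<^bsub>Y.M\<^esub> F) \<in> carrier X.M" by (rule d(2)[OF i])
    show "\<Sqinter>\<^bsub>X.M\<^esub> (?h ` F) \<in> carrier X.M"
      using F hF[OF F(1)] by (intro semilattice_inf_closed[OF X.semilattice]) simp_all
    have "dec X (\<Sqinter>\<^bsub>X.M\<^esub> (?h ` F)) = points X \<inter> (\<Inter>u\<in>F. f -` dec Y u \<inter> points X)"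
      using F hF[OF F(1)] dF[OF F(1)] by (simp add: X.dec_inf)
    also have "\<dots> = f -` (points Y \<inter> \<Inter>(dec Y ` F)) \<inter> points X"
      using strong_hom_point[OF f] by auto
    also have "\<dots> = dec X (?h (\<Sqinter>\<^bsub>Y.M\<^esub> F))" using d(1)[OF i] Y.dec_inf[OF F] by simp
    finally show "dec X (?h (\<Sqinter>\<^bsub>Y.M\<^esub> F)) = dec X (\<Sqinter>\<^bsub>X.M\<^esub> (?h ` F))" ..
  qed
  moreover have "is_lub X.M (?h s) (?h ` F)"
    if F: "F \<subseteq> carrier Y.M" "finite F" "F \<noteq> {}" and s: "is_lub Y.M s F" for F s
  proof -
    have sc: "s \<in> carrier Y.M" "dec Y s = \<Union>(dec Y ` F)" using s Y.M_lub_iff[OF F] by simp_all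
    have "\<Union>(dec X ` ?h ` F) = f -` \<Union>(dec Y ` F) \<inter> points X" unfolding dF[OF F(1)] by auto
    then show ?thesis using d[OF sc(1)] sc(2) F hF[OF F(1)] by (simp add: X.M_lub_iff)
  qed
  moreover have "?h \<in> carrier Y.M \<rightarrow>\<^sub>E carrier X.M"
    using d(2) by (auto simp: inverse_image_def)
  ultimately show ?thesis by (simp add: FSup_hom_def)
qed

lemma inverse_image_eqD:
  assumes f: "f \<in> strong_hom X Y" and g: "g \<in> strong_hom X Y"
    and eq: "inverse_image X Y f = inverse_image X Y g"
  shows "f = g"
proof (rule PiE_ext)
  show "f \<in> points X \<rightarrow>\<^sub>E points Y" "g \<in> points X \<rightarrow>\<^sub>E points Y"
    using subsetD[OF strong_hom_funcset f] subsetD[OF strong_hom_funcset g] .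
  fix x assume x: "x \<in> points X"
  have "f x \<in> U \<longleftrightarrow> g x \<in> U" if U: "U \<in> admissible Y" for U
  proof -
    have "f -` U \<inter> points X = g -` U \<inter> points X"
      using dec_inverse_image(1)[OF f Y.enc_in[OF U]] dec_inverse_image(1)[OF g Y.enc_in[OF U]] eq
      by (simp add: Y.dec_enc[OF U])
    then show ?thesis using x by auto
  qed
  then show "f x = g x"
    using Y.ord_iff[of "f x" "g x"] Y.ord_iff[of "g x" "f x"] Y.ord_antisym[of "f x" "g x"]
      strong_hom_point[OF f x] strong_hom_point[OF g x] by blast
qed

text \<open>
  Read on admissible sets, \<open>h\<close> is a map \<open>H\<close> preserving finite intersections. For finite nonempty \<open>\<V>\<close> it also
  satisfies \<open>H U \<subseteq> \<Union>(H ` \<V>)\<close> whenever \<open>U \<subseteq> \<Union>\<V>\<close>, as \<open>U\<close> is then the supremum of the sets \<open>U \<inter> V\<close>. Therefore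
  the sets \<open>U\<close> with \<open>x \<in> H U\<close> are the admissible neighbourhoods of a point, which is taken as \<open>f x\<close>.
\<close>

lemma FSup_hom_inverse_image:
  assumes h: "h \<in> FSup_hom Y.M X.M"
  obtains f where "f \<in> strong_hom X Y" "inverse_image X Y f = h"
proof -
  define H where "H U = dec X (h (enc Y U))" for U
  have hc: "h u \<in> carrier X.M" if "u \<in> carrier Y.M" for u
    using PiE_mem[OF subsetD[OF FSup_hom_funcset h] that] .
  have HA: "H U \<in> admissible X" if "U \<in> admissible Y" for U
    unfolding H_def by (rule X.dec_in[OF hc[OF Y.enc_in[OF that]]])
  have Hdec: "H (dec Y u) = dec X (h u)" if "u \<in> carrier Y.M" for u
    by (simp add: H_def Y.enc_dec[OF that])
  have Hmono: "H U \<subseteq> H V" if "U \<in> admissible Y" "V \<in> admissible Y" "U \<subseteq> V" for U V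
    using FSup_hom_mono[OF Y.semilattice X.semilattice h Y.enc_in[OF that(1)] Y.enc_in[OF that(2)]] that
    by (simp add: H_def Y.dec_enc)
  have hinf: "h (\<Sqinter>\<^bsub>Y.M\<^esub> F) = \<Sqinter>\<^bsub>X.M\<^esub> (h ` F)" if "F \<subseteq> carrier Y.M" "finite F" for F
    using h that by (simp add: FSup_hom_def)
  have Hpoints: "H (points Y) = points X"
    using Hdec[OF semilattice_inf_closed[OF Y.semilattice, of "{}"]] hinf[of "{}"] Y.dec_inf[of "{}"] X.dec_inf[of "{}"]
    by simp
  have HInt: "H (U \<inter> V) = H U \<inter> H V" if UV: "U \<in> admissible Y" "V \<in> admissible Y" for U V
  proof -
    let ?F = "{enc Y U, enc Y V}"
    have F: "?F \<subseteq> carrier Y.M" "finite ?F" using UV Y.enc_in by simp_all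
    have "dec Y (\<Sqinter>\<^bsub>Y.M\<^esub> ?F) = U \<inter> V"
      using Y.dec_meet[OF Y.enc_in[OF UV(1)] Y.enc_in[OF UV(2)]] UV by (simp add: meet_def Y.dec_enc)
    then have "H (U \<inter> V) = dec X (\<Sqinter>\<^bsub>X.M\<^esub> (h ` ?F))"
      using Hdec[OF semilattice_inf_closed[OF Y.semilattice F]] hinf[OF F] by simp
    also have "\<dots> = H U \<inter> H V"
      using X.dec_meet[OF hc[OF Y.enc_in[OF UV(1)]] hc[OF Y.enc_in[OF UV(2)]]] by (simp add: meet_def H_def)
    finally show ?thesis .
  qed
  have HUn: "H U \<subseteq> \<Union>(H ` \<V>)"
    if U: "U \<in> admissible Y" and \<V>: "finite \<V>" "\<V> \<noteq> {}" "\<V> \<subseteq> admissible Y" and le: "U \<subseteq> \<Union>\<V>" for U \<V>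
  proof -
    \<comment> \<open>Intersecting with \<open>U\<close> turns the cover into an existing supremum.\<close>
    let ?F = "(\<lambda>V. enc Y (U \<inter> V)) ` \<V>"
    have A: "U \<inter> V \<in> admissible Y" if "V \<in> \<V>" for V
      using Y.admissible_Int[OF U] \<V>(3) that by blast
    have F: "?F \<subseteq> carrier Y.M" "finite ?F" "?F \<noteq> {}" using Y.enc_in[OF A] \<V> by auto
    have "\<Union>(dec Y ` ?F) = (\<Union>V\<in>\<V>. U \<inter> V)" using Y.dec_enc[OF A] by (simp add: image_image)
    also have "\<dots> = U" using le by auto
    finally have "is_lub Y.M (enc Y U) ?F"
      unfolding Y.M_lub_iff[OF F] using U by (simp add: Y.enc_in Y.dec_enc)
    then have "is_lub X.M (h (enc Y U)) (h ` ?F)" using h F by (simp add: FSup_hom_def)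
    moreover have "h ` ?F \<subseteq> carrier X.M" using hc F(1) by blast
    ultimately have "dec X (h (enc Y U)) = \<Union>(dec X ` h ` ?F)" using F X.M_lub_iff[of "h ` ?F"] by simp
    then have "H U = (\<Union>V\<in>\<V>. H (U \<inter> V))" by (simp add: H_def image_image)
    moreover have "H (U \<inter> V) \<subseteq> H V" if "V \<in> \<V>" for V
      using Hmono[OF A[OF that]] \<V>(3) that by blast
    ultimately show ?thesis by blast
  qed
  have "\<exists>y\<in>points Y. \<forall>U\<in>admissible Y. y \<in> U \<longleftrightarrow> x \<in> H U" if x: "x \<in> points X" for x
  proof -
    let ?G = "{U \<in> admissible Y. x \<in> H U}"
    have "\<exists>y\<in>points Y. \<forall>U\<in>admissible Y. y \<in> U \<longleftrightarrow> U \<in> ?G"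
    proof (rule Y.point_of_filter)
      show "?G \<subseteq> admissible Y" by blast
      show "points Y \<in> ?G" using x Y.admissible_points Hpoints by simp
      show "U \<inter> V \<in> ?G" if "U \<in> ?G" "V \<in> ?G" for U V using that HInt[of U V] Y.admissible_Int by simp
      fix U \<V> assume U: "U \<in> ?G" and \<V>: "finite \<V>" "\<V> \<noteq> {}" "\<V> \<subseteq> admissible Y - ?G"
      have U': "U \<in> admissible Y" "x \<in> H U" and \<V>': "\<V> \<subseteq> admissible Y" "\<And>V. V \<in> \<V> \<Longrightarrow> x \<notin> H V"
        using U \<V>(3) by auto
      show "\<not> U \<subseteq> \<Union>\<V>"
        using HUn[OF U'(1) \<V>(1,2) \<V>'(1)] U'(2) \<V>'(2) by blast
    qed
    then show ?thesis by simp
  qed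
  then obtain f0 where f0: "\<And>x. x \<in> points X \<Longrightarrow> f0 x \<in> points Y"
    "\<And>x U. x \<in> points X \<Longrightarrow> U \<in> admissible Y \<Longrightarrow> f0 x \<in> U \<longleftrightarrow> x \<in> H U"
    by metis
  define f where "f = restrict f0 (points X)"
  have vim: "f -` U \<inter> points X = H U" if "U \<in> admissible Y" for U
    using f0(2)[OF _ that] X.admissible_subset[OF HA[OF that]] by (auto simp: f_def)
  have mono: "f x \<sqsubseteq>\<^bsub>ordr Y\<^esub> f y" if xy: "x \<in> points X" "y \<in> points X" "x \<sqsubseteq>\<^bsub>ordr X\<^esub> y" for x y
  proof -
    have "f0 y \<in> U" if U: "U \<in> admissible Y" "f0 x \<in> U" for U
      using X.admissible_up[OF HA[OF U(1)] _ xy(2,3)] f0(2)[OF xy(1) U(1)] f0(2)[OF xy(2) U(1)] U(2) by simp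
    then show ?thesis using Y.ord_iff[OF f0(1)[OF xy(1)] f0(1)[OF xy(2)]] xy by (simp add: f_def)
  qed
  have f: "f \<in> strong_hom X Y"
    using f0(1) mono vim HA by (simp add: strong_hom_def f_def)
  have "inverse_image X Y f = h"
  proof (rule PiE_ext)
    show "inverse_image X Y f \<in> carrier Y.M \<rightarrow>\<^sub>E carrier X.M" "h \<in> carrier Y.M \<rightarrow>\<^sub>E carrier X.M"
      using subsetD[OF FSup_hom_funcset inverse_image_FSup[OF f]] subsetD[OF FSup_hom_funcset h] .
    fix u assume u: "u \<in> carrier Y.M"
    show "inverse_image X Y f u = h u"
      using dec_inverse_image[OF f u] vim[OF Y.dec_in[OF u]] Hdec[OF u]
        X.dec_eqD[OF _ hc[OF u], of "inverse_image X Y f u"] by simp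
  qed
  with f show ?thesis by (rule that)
qed

text \<open>
  If both maxima are isolated, their singletons are the least admissible sets. Since preimages of
  admissible sets contain the maximum, the preimage of \<open>{pt Y}\<close> equals \<open>{pt X}\<close> iff no other point is sent to
  \<open>pt Y\<close>.
\<close>

lemma strong_top_hom_iff:
  "f \<in> strong_top_hom X Y \<longleftrightarrow> f \<in> strong_hom X Y \<and> inverse_image X Y f \<in> FSupB_hom Y.M X.M"
proof -
  have "(openin (topo X) {pt X} \<and> openin (topo Y) {pt Y} \<longrightarrow> f ` (points X - {pt X}) \<subseteq> points Y - {pt Y}) \<longleftrightarrow>
      inverse_image X Y f \<in> FSupB_hom Y.M X.M" if f: "f \<in> strong_hom X Y"
  proof -
    have "inverse_image X Y f (enc Y {pt Y}) = enc X {pt X} \<longleftrightarrow> f ` (points X - {pt X}) \<subseteq> points Y - {pt Y}"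
      if iso: "openin (topo X) {pt X}" "openin (topo Y) {pt Y}"
    proof -
      have A: "{pt X} \<in> admissible X" "{pt Y} \<in> admissible Y" using iso X.isolated_iff Y.isolated_iff by simp_all
      note d = dec_inverse_image[OF f Y.enc_in[OF A(2)], unfolded Y.dec_enc[OF A(2)]]
      have "inverse_image X Y f (enc Y {pt Y}) = enc X {pt X} \<longleftrightarrow> f -` {pt Y} \<inter> points X = {pt X}"
        using d X.dec_eqD[OF d(2) X.enc_in[OF A(1)]] X.dec_enc[OF A(1)] by auto
      also have "\<dots> \<longleftrightarrow> f ` (points X - {pt X}) \<subseteq> points Y - {pt Y}"
        using X.admissible_pt[OF strong_hom_vimage[OF f A(2)]] strong_hom_point[OF f] by auto
      finally show ?thesis .
    qed
    then show ?thesis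
      unfolding FSupB_hom_iff[OF Y.semilattice X.semilattice] X.M_least_iff Y.M_least_iff
      using inverse_image_FSup[OF f] by auto
  qed
  then show ?thesis unfolding strong_top_hom_def by auto
qed

end

lemma fully_faithful_admissible:
  "fully_faithful (PGPS_S :: 'u space_cat) (op_cat DMS_FSup) admissible_order inverse_image"
proof -
  have "inverse_image X X (\<lambda>x\<in>points X. x) = (\<lambda>u\<in>carrier (admissible_order X). u)"
    if "small_pgps X" for X :: "'u pspace"
  proof
    interpret small_pgps X by fact
    fix u
    have "(\<lambda>x\<in>points X. x) -` dec X u \<inter> points X = dec X u" if "u \<in> carrier M"
      using admissible_subset[OF dec_in[OF that]] by auto
    then show "inverse_image X X (\<lambda>x\<in>points X. x) u = (\<lambda>u\<in>carrier M. u) u"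
      by (simp add: inverse_image_def enc_dec)
  qed
  moreover have "inverse_image X Z (compose (points X) g f) =
      compose (carrier (admissible_order Z)) (inverse_image X Y f) (inverse_image Y Z g)"
    if X: "small_pgps X" and Y: "small_pgps Y" and Z: "small_pgps Z"
      and f: "f \<in> strong_hom X Y" and g: "g \<in> strong_hom Y Z" for X Y Z :: "'u pspace" and f g
  proof
    interpret XY: small_pgps_pair X Y using X Y by (simp add: small_pgps_pair_def)
    interpret YZ: small_pgps_pair Y Z using Y Z by (simp add: small_pgps_pair_def)
    fix u
    have "compose (points X) g f -` dec Z u \<inter> points X = f -` (g -` dec Z u \<inter> points Y) \<inter> points X"
      using strong_hom_point[OF f] by (auto simp: compose_def)
    then show "inverse_image X Z (compose (points X) g f) u =
      compose (carrier (admissible_order Z)) (inverse_image X Y f) (inverse_image Y Z g) u"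
      using YZ.dec_inverse_image[OF g, of u] by (simp add: inverse_image_def compose_def)
  qed
  ultimately have "is_functor (PGPS_S :: 'u space_cat) (op_cat DMS_FSup) admissible_order inverse_image"
    by (simp add: is_functor_def Obj_PGPS Hom_PGPS Id_PGPS Comp_PGPS op_cat_def Hom_DMS Id_DMS Comp_DMS
        small_pgps_pair_def small_pgps.Obj_M small_pgps_pair.inverse_image_FSup)
  moreover have "bij_betw (inverse_image X Y) (strong_hom X Y) (FSup_hom (admissible_order Y) (admissible_order X))"
    if "small_pgps X" "small_pgps Y" for X Y :: "'u pspace"
  proof -
    interpret small_pgps_pair X Y using that by (simp add: small_pgps_pair_def)
    show ?thesis
    proof (rule bij_betw_imageI)
      show "inj_on (inverse_image X Y) (strong_hom X Y)" by (rule inj_onI) (rule inverse_image_eqD)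
      have "h \<in> inverse_image X Y ` strong_hom X Y" if "h \<in> FSup_hom Y.M X.M" for h
        by (rule FSup_hom_inverse_image[OF that]) (rule image_eqI[OF sym])
      then show "inverse_image X Y ` strong_hom X Y = FSup_hom Y.M X.M"
        using inverse_image_FSup by auto
    qed
  qed
  ultimately show ?thesis
    by (simp add: fully_faithful_def Obj_PGPS Hom_PGPS op_cat_def Hom_DMS)
qed

section \<open>The space of optimal filters\<close>

definition prime_filter :: "'a gorder \<Rightarrow> 'a set \<Rightarrow> bool" where
  "prime_filter M F \<longleftrightarrow> meet_filter M F \<and> F \<noteq> carrier M \<and>
     (\<forall>a\<in>carrier M - F. \<forall>b\<in>carrier M - F. \<exists>c\<in>carrier M - F. a \<sqsubseteq>\<^bsub>M\<^esub> c \<and> b \<sqsubseteq>\<^bsub>M\<^esub> c)"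

text \<open>
  The complement is closed under the weak form of finite joins available in \<open>M\<close> (a Frink ideal): \<open>c\<close> is
  outside \<open>F\<close> whenever it lies below all common upper bounds of finitely many elements outside \<open>F\<close>. Only
  nonempty \<open>S\<close> are considered, so that \<open>carrier M\<close> itself is optimal; it becomes the maximum of the space.
\<close>

definition optimal_filter :: "'a gorder \<Rightarrow> 'a set \<Rightarrow> bool" where
  "optimal_filter M F \<longleftrightarrow> meet_filter M F \<and>
     (\<forall>S c. finite S \<and> S \<noteq> {} \<and> S \<subseteq> carrier M - F \<and> c \<in> F \<longrightarrow>
        (\<exists>u\<in>carrier M. (\<forall>s\<in>S. s \<sqsubseteq>\<^bsub>M\<^esub> u) \<and> \<not> c \<sqsubseteq>\<^bsub>M\<^esub> u))"

lemma optimal_filter_bound: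
  assumes "optimal_filter M F" "finite S" "S \<noteq> {}" "S \<subseteq> carrier M - F" "c \<in> F"
  obtains u where "u \<in> carrier M" "\<And>s. s \<in> S \<Longrightarrow> s \<sqsubseteq>\<^bsub>M\<^esub> u" "\<not> c \<sqsubseteq>\<^bsub>M\<^esub> u"
proof -
  have "\<exists>u\<in>carrier M. (\<forall>s\<in>S. s \<sqsubseteq>\<^bsub>M\<^esub> u) \<and> \<not> c \<sqsubseteq>\<^bsub>M\<^esub> u"
    using assms unfolding optimal_filter_def by simp
  then show ?thesis using that by auto
qed

lemma meet_filter_chain_Union:
  assumes "C \<noteq> {}" "\<And>F. F \<in> C \<Longrightarrow> meet_filter M F" "\<And>F G. \<lbrakk>F \<in> C; G \<in> C\<rbrakk> \<Longrightarrow> F \<subseteq> G \<or> G \<subseteq> F"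
  shows "meet_filter M (\<Union>C)"
proof -
  obtain F x where F: "F \<in> C" "x \<in> F" using assms(1,2) unfolding meet_filter_def by (metis ex_in_conv)
  show ?thesis
  proof (rule meet_filterI)
    show "\<Union>C \<subseteq> carrier M" using meet_filter_carrier[OF assms(2)] by blast
    show "x \<in> \<Union>C" using F by blast
    show "b \<in> \<Union>C" if "a \<in> \<Union>C" "b \<in> carrier M" "a \<sqsubseteq>\<^bsub>M\<^esub> b" for a b
      using meet_filter_up[OF assms(2) _ that(2,3)] that(1) by blast
    show "a \<sqinter>\<^bsub>M\<^esub> b \<in> \<Union>C" if ab: "a \<in> \<Union>C" "b \<in> \<Union>C" for a b
    proof -
      obtain G H where GH: "G \<in> C" "H \<in> C" "a \<in> G" "b \<in> H" using ab by blast
      then have "\<exists>K\<in>C. a \<in> K \<and> b \<in> K" using assms(3)[OF GH(1,2)] by blast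
      then show ?thesis using meet_filter_meet[OF assms(2)] by blast
    qed
  qed
qed

text \<open>
  The filter generated by \<open>F\<close> and \<open>b\<close>.
\<close>

lemma meet_filter_adjoin:
  assumes M: "meet_semilattice M" and F: "meet_filter M F" and b: "b \<in> carrier M"
  shows "meet_filter M {x \<in> carrier M. \<exists>g\<in>F. g \<sqinter>\<^bsub>M\<^esub> b \<sqsubseteq>\<^bsub>M\<^esub> x}" (is "meet_filter M ?H")
    and "F \<subseteq> {x \<in> carrier M. \<exists>g\<in>F. g \<sqinter>\<^bsub>M\<^esub> b \<sqsubseteq>\<^bsub>M\<^esub> x}"
    and "b \<in> {x \<in> carrier M. \<exists>g\<in>F. g \<sqinter>\<^bsub>M\<^esub> b \<sqsubseteq>\<^bsub>M\<^esub> x}"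
proof -
  note po = semilattice_partial_order[OF M]
  note Fc = meet_filter_carrier[OF F]
  note mc = semilattice_meet_closed[OF M]
  obtain g0 where g0: "g0 \<in> F" using F by (auto simp: meet_filter_def)
  show bH: "b \<in> ?H" using semilattice_meet_right[OF M Fc[OF g0] b] g0 b by blast
  show "F \<subseteq> ?H" using semilattice_meet_left[OF M Fc b] Fc by blast
  show "meet_filter M ?H"
  proof (rule meet_filterI[OF _ bH])
    show "?H \<subseteq> carrier M" by blast
    show "y \<in> ?H" if xy: "x \<in> ?H" "y \<in> carrier M" "x \<sqsubseteq>\<^bsub>M\<^esub> y" for x y
    proof -
      obtain g where g: "g \<in> F" "g \<sqinter>\<^bsub>M\<^esub> b \<sqsubseteq>\<^bsub>M\<^esub> x" using xy(1) by blast
      have "g \<sqinter>\<^bsub>M\<^esub> b \<sqsubseteq>\<^bsub>M\<^esub> y"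
        using partial_order_trans[OF po mc[OF Fc[OF g(1)] b] _ xy(2) g(2) xy(3)] xy(1) by simp
      then show ?thesis using g(1) xy(2) by blast
    qed
    show "x \<sqinter>\<^bsub>M\<^esub> y \<in> ?H" if xy: "x \<in> ?H" "y \<in> ?H" for x y
    proof -
      obtain g h where gh: "g \<in> F" "g \<sqinter>\<^bsub>M\<^esub> b \<sqsubseteq>\<^bsub>M\<^esub> x" "h \<in> F" "h \<sqinter>\<^bsub>M\<^esub> b \<sqsubseteq>\<^bsub>M\<^esub> y" using xy by blast
      have c: "x \<in> carrier M" "y \<in> carrier M" using xy by simp_all
      let ?k = "g \<sqinter>\<^bsub>M\<^esub> h"
      have k: "?k \<in> F" using meet_filter_meet[OF F gh(1,3)] .
      note kb = mc[OF Fc[OF k] b]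
      have below: "?k \<sqinter>\<^bsub>M\<^esub> b \<sqsubseteq>\<^bsub>M\<^esub> e \<sqinter>\<^bsub>M\<^esub> b" if "e \<in> carrier M" "?k \<sqsubseteq>\<^bsub>M\<^esub> e" for e
        using semilattice_meet_greatest[OF M that(1) b kb _ semilattice_meet_right[OF M Fc[OF k] b]]
          partial_order_trans[OF po kb Fc[OF k] that(1) semilattice_meet_left[OF M Fc[OF k] b] that(2)] by simp
      have "?k \<sqinter>\<^bsub>M\<^esub> b \<sqsubseteq>\<^bsub>M\<^esub> x"
        using partial_order_trans[OF po kb mc[OF Fc[OF gh(1)] b] c(1)
            below[OF Fc[OF gh(1)] semilattice_meet_left[OF M Fc[OF gh(1)] Fc[OF gh(3)]]] gh(2)] .
      moreover have "?k \<sqinter>\<^bsub>M\<^esub> b \<sqsubseteq>\<^bsub>M\<^esub> y"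
        using partial_order_trans[OF po kb mc[OF Fc[OF gh(3)] b] c(2)
            below[OF Fc[OF gh(3)] semilattice_meet_right[OF M Fc[OF gh(1)] Fc[OF gh(3)]]] gh(4)] .
      ultimately have "?k \<sqinter>\<^bsub>M\<^esub> b \<sqsubseteq>\<^bsub>M\<^esub> x \<sqinter>\<^bsub>M\<^esub> y" by (rule semilattice_meet_greatest[OF M c kb])
      then show ?thesis using k mc[OF c] by blast
    qed
  qed
qed

text \<open>
  Let \<open>G\<close> be maximal among the filters that extend \<open>F\<close> and avoid \<open>a\<close>. For \<open>b1\<close>, \<open>b2\<close> outside \<open>G\<close>,
  maximality gives \<open>g1\<close>, \<open>g2\<close> in \<open>G\<close> with \<open>g1 \<sqinter> b1\<close> and \<open>g2 \<sqinter> b2\<close> below \<open>a\<close>. By distributivity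
  \<open>a\<close> is the meet of an element above \<open>g1\<close> and some \<open>b1'\<close> above \<open>b1\<close>, and \<open>b1'\<close> is outside \<open>G\<close>. Since
  \<open>g2 \<sqinter> b2\<close> is below \<open>b1'\<close>, distributivity applied again writes \<open>b1'\<close> as the meet of an element above \<open>g2\<close>
  and some \<open>c\<close> above \<open>b2\<close>. This \<open>c\<close> is outside \<open>G\<close> and above both \<open>b1\<close> and \<open>b2\<close>.
\<close>

lemma prime_filter_extension:
  assumes M: "distributive_semilattice M" and F: "meet_filter M F" and a: "a \<in> carrier M" "a \<notin> F"
  obtains G where "prime_filter M G" "F \<subseteq> G" "a \<notin> G"
proof -
  have sl: "meet_semilattice M" using M by (simp add: distributive_semilattice_def)
  note po = semilattice_partial_order[OF sl]
  let ?\<A> = "{G. meet_filter M G \<and> F \<subseteq> G \<and> a \<notin> G}"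
  have "\<exists>G\<in>?\<A>. \<forall>H\<in>?\<A>. G \<subseteq> H \<longrightarrow> H = G"
  proof (rule subset_Zorn_nonempty)
    show "?\<A> \<noteq> {}" using F a(2) by blast
    fix C assume C: "C \<noteq> {}" "subset.chain ?\<A> C"
    have sub: "C \<subseteq> ?\<A>" and ch: "\<And>G H. \<lbrakk>G \<in> C; H \<in> C\<rbrakk> \<Longrightarrow> G \<subseteq> H \<or> H \<subseteq> G"
      using C(2) unfolding subset_chain_def by auto
    have "meet_filter M (\<Union>C)" using sub by (intro meet_filter_chain_Union[OF C(1) _ ch]) auto
    moreover have "F \<subseteq> \<Union>C" "a \<notin> \<Union>C" using sub C(1) by auto
    ultimately show "\<Union>C \<in> ?\<A>" by simp
  qed
  then obtain G where G: "meet_filter M G" "F \<subseteq> G" "a \<notin> G"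
    and max: "\<And>H. \<lbrakk>meet_filter M H; G \<subseteq> H; a \<notin> H\<rbrakk> \<Longrightarrow> H = G" by auto
  note Gc = meet_filter_carrier[OF G(1)]
  have reach: "\<exists>g\<in>G. g \<sqinter>\<^bsub>M\<^esub> b \<sqsubseteq>\<^bsub>M\<^esub> a" if b: "b \<in> carrier M - G" for b
  proof (rule ccontr)
    assume "\<not> ?thesis"
    moreover have bc: "b \<in> carrier M" using b by simp
    ultimately have "{x \<in> carrier M. \<exists>g\<in>G. g \<sqinter>\<^bsub>M\<^esub> b \<sqsubseteq>\<^bsub>M\<^esub> x} = G"
      by (intro max meet_filter_adjoin[OF sl G(1) bc]) simp
    then show False using meet_filter_adjoin(3)[OF sl G(1) bc] b by simp
  qed
  have dist: "\<exists>p'\<in>G. \<exists>e'\<in>carrier M. e \<sqsubseteq>\<^bsub>M\<^esub> e' \<and> p' \<sqinter>\<^bsub>M\<^esub> e' = x"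
    if prem: "p \<in> G" "e \<in> carrier M" "x \<in> carrier M" "p \<sqinter>\<^bsub>M\<^esub> e \<sqsubseteq>\<^bsub>M\<^esub> x" for p e x
  proof -
    obtain p' e' where "p' \<in> carrier M" "e' \<in> carrier M" "p \<sqsubseteq>\<^bsub>M\<^esub> p'" "e \<sqsubseteq>\<^bsub>M\<^esub> e'" "p' \<sqinter>\<^bsub>M\<^esub> e' = x"
      using M Gc[OF prem(1)] prem(2-4) unfolding distributive_semilattice_def by metis
    then show ?thesis using meet_filter_up[OF G(1) prem(1)] by blast
  qed
  have "\<exists>c\<in>carrier M - G. b1 \<sqsubseteq>\<^bsub>M\<^esub> c \<and> b2 \<sqsubseteq>\<^bsub>M\<^esub> c" if b: "b1 \<in> carrier M - G" "b2 \<in> carrier M - G" for b1 b2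
  proof -
    have bc: "b1 \<in> carrier M" "b2 \<in> carrier M" using b by simp_all
    obtain g1 g2 where g: "g1 \<in> G" "g1 \<sqinter>\<^bsub>M\<^esub> b1 \<sqsubseteq>\<^bsub>M\<^esub> a" "g2 \<in> G" "g2 \<sqinter>\<^bsub>M\<^esub> b2 \<sqsubseteq>\<^bsub>M\<^esub> a"
      using reach[OF b(1)] reach[OF b(2)] by blast
    obtain p1 b1' where 1: "p1 \<in> G" "b1' \<in> carrier M" "b1 \<sqsubseteq>\<^bsub>M\<^esub> b1'" "p1 \<sqinter>\<^bsub>M\<^esub> b1' = a"
      using dist[OF g(1) bc(1) a(1) g(2)] by blast
    have b1': "b1' \<notin> G" using meet_filter_meet[OF G(1) 1(1)] 1(4) G(3) by blast
    have "a \<sqsubseteq>\<^bsub>M\<^esub> b1'" using semilattice_meet_right[OF sl Gc[OF 1(1)] 1(2)] 1(4) by simp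
    then have "g2 \<sqinter>\<^bsub>M\<^esub> b2 \<sqsubseteq>\<^bsub>M\<^esub> b1'"
      using partial_order_trans[OF po semilattice_meet_closed[OF sl Gc[OF g(3)] bc(2)] a(1) 1(2) g(4)] by simp
    then obtain p2 c where 2: "p2 \<in> G" "c \<in> carrier M" "b2 \<sqsubseteq>\<^bsub>M\<^esub> c" "p2 \<sqinter>\<^bsub>M\<^esub> c = b1'"
      using dist[OF g(3) bc(2) 1(2)] by blast
    have "c \<notin> G" using meet_filter_meet[OF G(1) 2(1)] 2(4) b1' by blast
    moreover have "b1' \<sqsubseteq>\<^bsub>M\<^esub> c" using semilattice_meet_right[OF sl Gc[OF 2(1)] 2(2)] 2(4) by simp
    then have "b1 \<sqsubseteq>\<^bsub>M\<^esub> c" using partial_order_trans[OF po bc(1) 1(2) 2(2) 1(3)] by simp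
    ultimately show ?thesis using 2 by blast
  qed
  then have "prime_filter M G" using G(1,3) a(1) by (auto simp: prime_filter_def)
  then show ?thesis using G(2,3) by (rule that)
qed

lemma prime_filter_separates:
  assumes M: "distributive_semilattice M" and ab: "a \<in> carrier M" "b \<in> carrier M" "\<not> a \<sqsubseteq>\<^bsub>M\<^esub> b"
  obtains G where "prime_filter M G" "a \<in> G" "b \<notin> G"
proof -
  have sl: "meet_semilattice M" using M by (simp add: distributive_semilattice_def)
  have "b \<notin> principal_filter M a" using ab(3) by (simp add: principal_filter_def)
  then obtain G where "prime_filter M G" "principal_filter M a \<subseteq> G" "b \<notin> G"
    using prime_filter_extension[OF M meet_filter_principal[OF sl ab(1)] ab(2)] by blast
  then show ?thesis using that principal_self[OF sl ab(1)] by blast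
qed

lemma prime_filter_bound:
  assumes F: "prime_filter M F" and S: "finite S" "S \<noteq> {}" "S \<subseteq> carrier M - F" and po: "partial_order M"
  shows "\<exists>u\<in>carrier M - F. \<forall>s\<in>S. s \<sqsubseteq>\<^bsub>M\<^esub> u"
  using S
proof (induction S rule: finite_ne_induct)
  case (singleton x)
  then show ?case using partial_order_refl[OF po, of x] by auto
next
  case (insert x S)
  then obtain u where u: "u \<in> carrier M - F" "\<forall>s\<in>S. s \<sqsubseteq>\<^bsub>M\<^esub> u" by auto
  have x: "x \<in> carrier M - F" using insert.prems by simp
  obtain v where v: "v \<in> carrier M - F" "x \<sqsubseteq>\<^bsub>M\<^esub> v" "u \<sqsubseteq>\<^bsub>M\<^esub> v"
    using F x u(1) unfolding prime_filter_def by blast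
  have "s \<sqsubseteq>\<^bsub>M\<^esub> v" if "s \<in> S" for s
  proof (rule partial_order_trans[OF po _ _ _ _ v(3)])
    show "s \<in> carrier M" using insert.prems that by auto
    show "s \<sqsubseteq>\<^bsub>M\<^esub> u" using u(2) that by simp
  qed (use u(1) v(1) in simp_all)
  then show ?case using v by auto
qed

lemma prime_filter_optimal:
  assumes F: "prime_filter M F" and po: "partial_order M" shows "optimal_filter M F"
  unfolding optimal_filter_def
proof (intro conjI allI impI)
  show f: "meet_filter M F" using F by (simp add: prime_filter_def)
  fix S c assume S: "finite S \<and> S \<noteq> {} \<and> S \<subseteq> carrier M - F \<and> c \<in> F"
  then obtain u where u: "u \<in> carrier M - F" "\<forall>s\<in>S. s \<sqsubseteq>\<^bsub>M\<^esub> u"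
    using prime_filter_bound[OF F _ _ _ po] by blast
  then have "\<not> c \<sqsubseteq>\<^bsub>M\<^esub> u" using meet_filter_up[OF f, of c u] S by auto
  then show "\<exists>u\<in>carrier M. (\<forall>s\<in>S. s \<sqsubseteq>\<^bsub>M\<^esub> u) \<and> \<not> c \<sqsubseteq>\<^bsub>M\<^esub> u" using u by blast
qed

lemma optimal_filter_whole: "meet_semilattice M \<Longrightarrow> optimal_filter M (carrier M)"
  by (auto simp: optimal_filter_def meet_filter_whole)

text \<open>
  Each condition defining optimal filters concerns finitely many elements at a time, so a violation is
  visible on a finite set \<open>J\<close>. Hence the optimal filters form a closed subset of the power set with its
  product topology.
\<close>

lemma optimal_filter_finitary:
  assumes M: "meet_semilattice M" and F: "\<not> optimal_filter M F"
  shows "\<exists>J. finite J \<and> (\<forall>G. (\<forall>j\<in>J. j \<in> G \<longleftrightarrow> j \<in> F) \<longrightarrow> \<not> optimal_filter M G)"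
proof -
  note top = semilattice_top[OF M]
  consider a where "a \<in> F" "a \<notin> carrier M" | "F \<subseteq> carrier M" "\<Sqinter>\<^bsub>M\<^esub> {} \<notin> F"
    | a b where "F \<subseteq> carrier M" "a \<in> F" "b \<in> carrier M" "a \<sqsubseteq>\<^bsub>M\<^esub> b" "b \<notin> F"
    | a b where "F \<subseteq> carrier M" "a \<in> F" "b \<in> F" "a \<sqinter>\<^bsub>M\<^esub> b \<notin> F"
    | S c where "F \<subseteq> carrier M" "finite S" "S \<noteq> {}" "S \<subseteq> carrier M - F" "c \<in> F"
        "\<And>u. \<lbrakk>u \<in> carrier M; \<And>s. s \<in> S \<Longrightarrow> s \<sqsubseteq>\<^bsub>M\<^esub> u\<rbrakk> \<Longrightarrow> c \<sqsubseteq>\<^bsub>M\<^esub> u"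
  proof (cases "meet_filter M F")
    case True
    then have "F \<subseteq> carrier M" by (simp add: meet_filter_def)
    moreover obtain S c where "finite S" "S \<noteq> {}" "S \<subseteq> carrier M - F" "c \<in> F"
      "\<not> (\<exists>u\<in>carrier M. (\<forall>s\<in>S. s \<sqsubseteq>\<^bsub>M\<^esub> u) \<and> \<not> c \<sqsubseteq>\<^bsub>M\<^esub> u)"
      using F True unfolding optimal_filter_def by auto
    ultimately show ?thesis using that(5)[of S c] by blast
  next
    case False
    show ?thesis
    proof (rule ccontr)
      assume not: "\<not> thesis"
      have "meet_filter M F"
      proof (rule meet_filterI)
        show sub: "F \<subseteq> carrier M" using that(1) not by blast
        show "\<Sqinter>\<^bsub>M\<^esub> {} \<in> F" using that(2)[OF sub] not by blast
        show "b \<in> F" if "a \<in> F" "b \<in> carrier M" "a \<sqsubseteq>\<^bsub>M\<^esub> b" for a b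
          using \<open>\<And>b a. \<lbrakk>F \<subseteq> carrier M; a \<in> F; b \<in> carrier M; a \<sqsubseteq>\<^bsub>M\<^esub> b; b \<notin> F\<rbrakk> \<Longrightarrow> thesis\<close>[OF sub that] not by blast
        show "a \<sqinter>\<^bsub>M\<^esub> b \<in> F" if "a \<in> F" "b \<in> F" for a b
          using \<open>\<And>b a. \<lbrakk>F \<subseteq> carrier M; a \<in> F; b \<in> F; a \<sqinter>\<^bsub>M\<^esub> b \<notin> F\<rbrakk> \<Longrightarrow> thesis\<close>[OF sub that] not by blast
      qed
      then show False using False by simp
    qed
  qed
  then show ?thesis
  proof cases
    case (1 a)
    have "\<not> optimal_filter M G" if "\<forall>j\<in>{a}. j \<in> G \<longleftrightarrow> j \<in> F" for G
      using 1 that meet_filter_carrier[of M G a] by (auto simp: optimal_filter_def)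
    then show ?thesis by (intro exI[of _ "{a}"]) simp
  next
    case 2
    have "\<not> optimal_filter M G" if "\<forall>j\<in>{\<Sqinter>\<^bsub>M\<^esub> {}}. j \<in> G \<longleftrightarrow> j \<in> F" for G
      using 2 that meet_filter_top[OF M, of G] by (auto simp: optimal_filter_def)
    then show ?thesis by (intro exI[of _ "{\<Sqinter>\<^bsub>M\<^esub> {}}"]) simp
  next
    case (3 a b)
    have "\<not> optimal_filter M G" if "\<forall>j\<in>{a, b}. j \<in> G \<longleftrightarrow> j \<in> F" for G
      using 3 that meet_filter_up[of M G a b] by (auto simp: optimal_filter_def)
    then show ?thesis by (intro exI[of _ "{a, b}"]) simp
  next
    case (4 a b)
    have "\<not> optimal_filter M G" if "\<forall>j\<in>{a, b, a \<sqinter>\<^bsub>M\<^esub> b}. j \<in> G \<longleftrightarrow> j \<in> F" for G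
      using 4 that meet_filter_meet[of M G a b] by (auto simp: optimal_filter_def)
    then show ?thesis by (intro exI[of _ "{a, b, a \<sqinter>\<^bsub>M\<^esub> b}"]) simp
  next
    case (5 S c)
    have "\<not> optimal_filter M G" if G: "\<forall>j\<in>insert c S. j \<in> G \<longleftrightarrow> j \<in> F" for G
    proof
      assume o: "optimal_filter M G"
      have "S \<subseteq> carrier M - G" "c \<in> G" using 5(4,5) G by auto
      then obtain u where "u \<in> carrier M" "\<And>s. s \<in> S \<Longrightarrow> s \<sqsubseteq>\<^bsub>M\<^esub> u" "\<not> c \<sqsubseteq>\<^bsub>M\<^esub> u"
        using optimal_filter_bound[OF o 5(2,3)] by blast
      then show False using 5(6) by blast
    qed
    then show ?thesis using 5(2) by (intro exI[of _ "insert c S"]) simp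
  qed
qed

text \<open>
  The points of the space are names for optimal filters; \<open>d\<close> decodes them.
\<close>

locale spectrum =
  fixes M :: "'a gorder" and P :: "'p set" and d :: "'p \<Rightarrow> 'a set"
  assumes distributive: "distributive_semilattice M"
    and bij: "bij_betw d P {F. optimal_filter M F}"
begin

lemma semilattice: "meet_semilattice M"
  using distributive by (simp add: distributive_semilattice_def)

lemmas po = semilattice_partial_order[OF semilattice]

lemma inj: "inj_on d P"
  using bij by (simp add: bij_betw_def)

lemma optimal: "p \<in> P \<Longrightarrow> optimal_filter M (d p)"
  using bij by (auto simp: bij_betw_def)

lemma filter: "p \<in> P \<Longrightarrow> meet_filter M (d p)"
  using optimal by (simp add: optimal_filter_def)

definition code :: "'a set \<Rightarrow> 'p" where
  "code = inv_into P d"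

lemma code: assumes "optimal_filter M F" shows "code F \<in> P" "d (code F) = F"
proof -
  have "F \<in> d ` P" using assms bij by (simp add: bij_betw_def)
  then show "code F \<in> P" "d (code F) = F" unfolding code_def by (rule inv_into_into, rule f_inv_into_f)
qed

lemma prime_code: "prime_filter M F \<Longrightarrow> code F \<in> P" "prime_filter M F \<Longrightarrow> d (code F) = F"
  using code prime_filter_optimal[OF _ po] by blast+

definition cube :: "('a \<Rightarrow> bool) topology" where
  "cube = product_topology (\<lambda>_. discrete_topology UNIV) UNIV"

definition filter_topology :: "'p topology" where
  "filter_topology = pullback_topology P (\<lambda>p a. a \<in> d p) cube"

lemma openin_cube: "openin cube U \<longleftrightarrow> (\<forall>x\<in>U. \<exists>J. finite J \<and> {y. \<forall>j\<in>J. y j = x j} \<subseteq> U)"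
proof
  assume U: "openin cube U"
  show "\<forall>x\<in>U. \<exists>J. finite J \<and> {y. \<forall>j\<in>J. y j = x j} \<subseteq> U"
  proof
    fix x assume "x \<in> U"
    then obtain V where V: "finite {i. V i \<noteq> UNIV}" "x \<in> Pi\<^sub>E UNIV V" "Pi\<^sub>E UNIV V \<subseteq> U"
      using U unfolding cube_def openin_product_topology_alt by auto
    have "{y. \<forall>j\<in>{i. V i \<noteq> UNIV}. y j = x j} \<subseteq> Pi\<^sub>E UNIV V"
    proof
      fix y assume y: "y \<in> {y. \<forall>j\<in>{i. V i \<noteq> UNIV}. y j = x j}"
      have "y i \<in> V i" for i
        using y V(2) by (cases "V i = UNIV") (auto simp: PiE_iff)
      then show "y \<in> Pi\<^sub>E UNIV V" by (simp add: PiE_iff)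
    qed
    from this V(3) have "{y. \<forall>j\<in>{i. V i \<noteq> UNIV}. y j = x j} \<subseteq> U" by (rule subset_trans)
    then show "\<exists>J. finite J \<and> {y. \<forall>j\<in>J. y j = x j} \<subseteq> U" using V(1) by (intro exI conjI)
  qed
next
  assume U: "\<forall>x\<in>U. \<exists>J. finite J \<and> {y. \<forall>j\<in>J. y j = x j} \<subseteq> U"
  show "openin cube U"
    unfolding cube_def openin_product_topology_alt
  proof
    fix x assume "x \<in> U"
    then obtain J where J: "finite J" "{y. \<forall>j\<in>J. y j = x j} \<subseteq> U" using U by blast
    let ?V = "\<lambda>i. if i \<in> J then {x i} else UNIV"
    have "{i. ?V i \<noteq> UNIV} \<subseteq> J" by auto
    then have "finite {i. ?V i \<noteq> UNIV}" using J(1) finite_subset by blast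
    moreover have "Pi\<^sub>E UNIV ?V \<subseteq> U"
    proof
      fix y assume y: "y \<in> Pi\<^sub>E UNIV ?V"
      have "y j = x j" if "j \<in> J" for j using PiE_mem[OF y, of j] that by simp
      then show "y \<in> U" using J(2) by auto
    qed
    ultimately show "\<exists>V. finite {i \<in> UNIV. V i \<noteq> topspace (discrete_topology UNIV)} \<and>
        (\<forall>i\<in>UNIV. openin (discrete_topology UNIV) (V i)) \<and> x \<in> Pi\<^sub>E UNIV V \<and> Pi\<^sub>E UNIV V \<subseteq> U"
      by (intro exI[of _ ?V]) (simp add: PiE_iff)
  qed
qed

text \<open>
  In this form of the topology a basic neighbourhood of \<open>p\<close> consists of the points that agree with \<open>p\<close>
  on a finite set of elements of \<open>M\<close>.
\<close>

lemma openin_filter_topology: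
  "openin filter_topology W \<longleftrightarrow>
    W \<subseteq> P \<and> (\<forall>p\<in>W. \<exists>J. finite J \<and> (\<forall>q\<in>P. (\<forall>j\<in>J. j \<in> d q \<longleftrightarrow> j \<in> d p) \<longrightarrow> q \<in> W))"
proof
  assume "openin filter_topology W"
  then obtain U where U: "openin cube U" "W = (\<lambda>p a. a \<in> d p) -` U \<inter> P"
    unfolding filter_topology_def openin_pullback_topology by blast
  have "\<exists>J. finite J \<and> (\<forall>q\<in>P. (\<forall>j\<in>J. j \<in> d q \<longleftrightarrow> j \<in> d p) \<longrightarrow> q \<in> W)" if "p \<in> W" for p
  proof -
    have "(\<lambda>a. a \<in> d p) \<in> U" using that U(2) by simp
    from bspec[OF U(1)[unfolded openin_cube] this]
    obtain J where J: "finite J" "{y. \<forall>j\<in>J. y j = (j \<in> d p)} \<subseteq> U" by (elim exE conjE)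
    have "q \<in> W" if "q \<in> P" "\<forall>j\<in>J. j \<in> d q \<longleftrightarrow> j \<in> d p" for q
      using subsetD[OF J(2), of "\<lambda>a. a \<in> d q"] that U(2) by simp
    then show ?thesis using J(1) by (intro exI[of _ J]) simp
  qed
  then show "W \<subseteq> P \<and> (\<forall>p\<in>W. \<exists>J. finite J \<and> (\<forall>q\<in>P. (\<forall>j\<in>J. j \<in> d q \<longleftrightarrow> j \<in> d p) \<longrightarrow> q \<in> W))"
    using U(2) by blast
next
  assume W: "W \<subseteq> P \<and> (\<forall>p\<in>W. \<exists>J. finite J \<and> (\<forall>q\<in>P. (\<forall>j\<in>J. j \<in> d q \<longleftrightarrow> j \<in> d p) \<longrightarrow> q \<in> W))"
  from bchoice[OF conjunct2[OF this]] obtain J where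
    J': "\<forall>p\<in>W. finite (J p) \<and> (\<forall>q\<in>P. (\<forall>j\<in>J p. j \<in> d q \<longleftrightarrow> j \<in> d p) \<longrightarrow> q \<in> W)" by (elim exE)
  then have J: "\<And>p. p \<in> W \<Longrightarrow> finite (J p)"
    "\<And>p q. \<lbrakk>p \<in> W; q \<in> P; \<forall>j\<in>J p. j \<in> d q \<longleftrightarrow> j \<in> d p\<rbrakk> \<Longrightarrow> q \<in> W" by simp_all
  let ?U = "{y. \<exists>p\<in>W. \<forall>j\<in>J p. y j = (j \<in> d p)}"
  have "openin cube ?U"
    unfolding openin_cube
  proof
    fix x assume "x \<in> ?U"
    then obtain p where p: "p \<in> W" "\<forall>j\<in>J p. x j = (j \<in> d p)" by blast
    then have "{y. \<forall>j\<in>J p. y j = x j} \<subseteq> ?U" by auto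
    then show "\<exists>J. finite J \<and> {y. \<forall>j\<in>J. y j = x j} \<subseteq> ?U" using J(1)[OF p(1)] by (intro exI conjI)
  qed
  moreover have "W = (\<lambda>p a. a \<in> d p) -` ?U \<inter> P"
  proof (intro equalityI subsetI)
    fix q assume "q \<in> W"
    then show "q \<in> (\<lambda>p a. a \<in> d p) -` ?U \<inter> P" using W by auto
  next
    fix q assume q: "q \<in> (\<lambda>p a. a \<in> d p) -` ?U \<inter> P"
    then obtain p where "p \<in> W" "\<forall>j\<in>J p. j \<in> d q \<longleftrightarrow> j \<in> d p" by auto
    then show "q \<in> W" using J(2)[of p q] q by simp
  qed
  ultimately show "openin filter_topology W"
    unfolding filter_topology_def openin_pullback_topology by blast
qed

lemma topspace_filter_topology [simp]: "topspace filter_topology = P"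
proof -
  have "openin filter_topology P" by (auto simp: openin_filter_topology)
  then have "P \<subseteq> topspace filter_topology" by (rule openin_subset)
  moreover have "topspace filter_topology \<subseteq> P"
    using openin_topspace[of filter_topology] unfolding openin_filter_topology by blast
  ultimately show ?thesis by blast
qed

text \<open>
  The optimal filters are a closed part of the cube, which is compact by Tychonoff's theorem.
\<close>

lemma compact_filter_topology: "compact_space filter_topology"
proof -
  let ?f = "\<lambda>p a. a \<in> d p"
  have top: "topspace cube = UNIV" by (simp add: cube_def)
  have "compact_space cube"
    unfolding cube_def compact_space_product_topology by (simp add: compact_space_discrete_topology)
  moreover have "closedin cube (?f ` P)"
  proof -
    have "openin cube (- ?f ` P)"
      unfolding openin_cube
    proof
      fix x assume x: "x \<in> - ?f ` P"
      have "\<not> optimal_filter M {a. x a}"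
      proof
        assume o: "optimal_filter M {a. x a}"
        have "x = ?f (code {a. x a})" using code(2)[OF o] by auto
        then show False using x code(1)[OF o] by blast
      qed
      then obtain J where J: "finite J"
        "\<And>G. (\<forall>j\<in>J. j \<in> G \<longleftrightarrow> j \<in> {a. x a}) \<Longrightarrow> \<not> optimal_filter M G"
        using optimal_filter_finitary[OF semilattice] by blast
      have "y \<notin> ?f ` P" if y: "\<forall>j\<in>J. y j = x j" for y
      proof
        assume "y \<in> ?f ` P"
        then obtain p where "p \<in> P" "y = ?f p" by blast
        then show False using J(2)[of "d p"] optimal y by auto
      qed
      then have "{y. \<forall>j\<in>J. y j = x j} \<subseteq> - ?f ` P"
        by (intro subsetI ComplI) (simp only: mem_Collect_eq)
      then show "\<exists>J. finite J \<and> {y. \<forall>j\<in>J. y j = x j} \<subseteq> - ?f ` P" using J(1) by (intro exI[of _ J]) simp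
    qed
    then show ?thesis by (simp add: closedin_def top Compl_eq_Diff_UNIV)
  qed
  ultimately have K: "compactin cube (?f ` P)" by (rule closedin_compact_space)
  show ?thesis
    unfolding compact_space_alt topspace_filter_topology
  proof (intro allI impI)
    fix \<U> assume \<U>: "(\<forall>U\<in>\<U>. openin filter_topology U) \<and> P \<subseteq> \<Union>\<U>"
    let ?\<V> = "{V. openin cube V \<and> ?f -` V \<inter> P \<in> \<U>}"
    have "?f ` P \<subseteq> \<Union>?\<V>"
    proof
      fix y assume "y \<in> ?f ` P"
      then obtain p U where p: "p \<in> P" "y = ?f p" "U \<in> \<U>" "p \<in> U" using \<U> by blast
      then obtain V where "openin cube V" "U = ?f -` V \<inter> P"
        using \<U> unfolding filter_topology_def openin_pullback_topology by blast
      then show "y \<in> \<Union>?\<V>" using p by blast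
    qed
    then obtain \<F> where \<F>: "finite \<F>" "\<F> \<subseteq> ?\<V>" "?f ` P \<subseteq> \<Union>\<F>"
      using compactinD[OF K, of ?\<V>] by blast
    then have "P \<subseteq> \<Union>((\<lambda>V. ?f -` V \<inter> P) ` \<F>)" by blast
    then show "\<exists>\<F>. finite \<F> \<and> \<F> \<subseteq> \<U> \<and> P \<subseteq> \<Union>\<F>"
      using \<F>(1,2) by (intro exI[of _ "(\<lambda>V. ?f -` V \<inter> P) ` \<F>"]) auto
  qed
qed

definition space :: "'p pspace" where
  "space = \<lparr>topo = filter_topology, ordr = set_order P d,
     base = {p \<in> P. prime_filter M (d p)}, pt = code (carrier M)\<rparr>"

lemma space_simps [simp]:
  "topo space = filter_topology" "points space = P" "carrier (ordr space) = P"
  "x \<sqsubseteq>\<^bsub>ordr space\<^esub> y \<longleftrightarrow> d x \<subseteq> d y" "base space = {p \<in> P. prime_filter M (d p)}"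
  "pt space = code (carrier M)"
  by (simp_all add: space_def topspace_filter_topology)

definition \<phi> :: "'a \<Rightarrow> 'p set" where
  "\<phi> a = {p \<in> P. a \<in> d p}"

lemma phi_clopen_upset: "clopen_upset space (\<phi> a)"
proof -
  have "openin filter_topology (\<phi> a)"
    unfolding openin_filter_topology by (auto simp: \<phi>_def intro: exI[of _ "{a}"])
  moreover have "openin filter_topology (P - \<phi> a)"
    unfolding openin_filter_topology by (auto simp: \<phi>_def intro: exI[of _ "{a}"])
  moreover have "\<phi> a \<subseteq> P" by (auto simp: \<phi>_def)
  ultimately show ?thesis
    by (auto simp: clopen_upset_def closedin_def topspace_filter_topology \<phi>_def)
qed

lemma phi_closed: "closedin filter_topology (\<phi> a)" and phi_open: "openin filter_topology (\<phi> a)"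
  using phi_clopen_upset[of a] by (simp_all add: clopen_upset_def)

lemma phi_order:
  assumes "a \<in> carrier M" "b \<in> carrier M" shows "\<phi> a \<subseteq> \<phi> b \<longleftrightarrow> a \<sqsubseteq>\<^bsub>M\<^esub> b"
proof
  assume sub: "\<phi> a \<subseteq> \<phi> b"
  show "a \<sqsubseteq>\<^bsub>M\<^esub> b"
  proof (rule ccontr)
    assume "\<not> a \<sqsubseteq>\<^bsub>M\<^esub> b"
    then obtain G where G: "prime_filter M G" "a \<in> G" "b \<notin> G"
      using prime_filter_separates[OF distributive assms] by blast
    then have "code G \<in> \<phi> a" "code G \<notin> \<phi> b" using prime_code[OF G(1)] by (simp_all add: \<phi>_def)
    then show False using sub by blast
  qed
next
  assume "a \<sqsubseteq>\<^bsub>M\<^esub> b"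
  then show "\<phi> a \<subseteq> \<phi> b" using meet_filter_up[OF filter _ assms(2)] by (auto simp: \<phi>_def)
qed

lemma phi_inf:
  assumes C: "C \<subseteq> carrier M" "finite C"
  shows "\<phi> (\<Sqinter>\<^bsub>M\<^esub> C) = P \<inter> (\<Inter>c\<in>C. \<phi> c)"
proof
  show "\<phi> (\<Sqinter>\<^bsub>M\<^esub> C) \<subseteq> P \<inter> (\<Inter>c\<in>C. \<phi> c)"
  proof -
    have "\<phi> (\<Sqinter>\<^bsub>M\<^esub> C) \<subseteq> \<phi> c" if "c \<in> C" for c
      using phi_order[OF semilattice_inf_closed[OF semilattice C] subsetD[OF C(1) that]]
        semilattice_inf_lower[OF semilattice C that] by simp
    then show ?thesis by (auto simp: \<phi>_def)
  qed
  show "P \<inter> (\<Inter>c\<in>C. \<phi> c) \<subseteq> \<phi> (\<Sqinter>\<^bsub>M\<^esub> C)"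
  proof
    fix p assume "p \<in> P \<inter> (\<Inter>c\<in>C. \<phi> c)"
    then have p: "p \<in> P" "C \<subseteq> d p" by (auto simp: \<phi>_def)
    obtain z where z: "z \<in> d p" "\<forall>c\<in>C. z \<sqsubseteq>\<^bsub>M\<^esub> c"
      using meet_filter_lower_bound[OF semilattice filter[OF p(1)] C(2) p(2)] by blast
    have zc: "z \<in> carrier M" using meet_filter_carrier[OF filter[OF p(1)] z(1)] .
    have "z \<sqsubseteq>\<^bsub>M\<^esub> \<Sqinter>\<^bsub>M\<^esub> C" using semilattice_inf_greatest[OF semilattice C zc] z(2) by simp
    then show "p \<in> \<phi> (\<Sqinter>\<^bsub>M\<^esub> C)"
      using meet_filter_up[OF filter[OF p(1)] z(1) semilattice_inf_closed[OF semilattice C]] p(1)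
      by (simp add: \<phi>_def)
  qed
qed

lemma priestley: "priestley_space space"
proof -
  have "\<exists>U. clopen_upset space U \<and> x \<in> U \<and> y \<notin> U" if xy: "x \<in> P" "y \<in> P" "\<not> d x \<subseteq> d y" for x y
  proof -
    obtain a where "a \<in> d x" "a \<notin> d y" using xy(3) by blast
    then show ?thesis using phi_clopen_upset[of a] xy by (intro exI[of _ "\<phi> a"]) (simp add: \<phi>_def)
  qed
  moreover have "partial_order (ordr space)"
    unfolding space_def using partial_order_set_order[OF inj] by simp
  ultimately show ?thesis by (simp add: priestley_space_def compact_filter_topology)
qed

lemma point_top: "code (carrier M) \<in> P" "d (code (carrier M)) = carrier M"
  using code[OF optimal_filter_whole[OF semilattice]] .

text \<open>
  For \<open>x\<close> in \<open>U\<close>, the sets \<open>\<phi> a\<close> with \<open>a \<in> d x\<close> meet in the upset of \<open>x\<close>, so by compactness some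
  \<open>\<phi> a\<close> with \<open>a \<in> d x\<close> is contained in \<open>U\<close>. By compactness again finitely many such sets cover \<open>U\<close>.
\<close>

lemma clopen_upset_Union:
  assumes U: "clopen_upset space U" and ne: "U \<noteq> {}"
  obtains S where "finite S" "S \<noteq> {}" "S \<subseteq> carrier M" "U = \<Union>(\<phi> ` S)"
proof -
  have UP: "U \<subseteq> P" using clopen_upset_subset[OF U] by simp
  have op: "openin filter_topology U" and cl: "closedin filter_topology U"
    and up: "\<And>x y. \<lbrakk>x \<in> U; y \<in> P; d x \<subseteq> d y\<rbrakk> \<Longrightarrow> y \<in> U"
    using U by (auto simp: clopen_upset_def)
  have clc: "closedin filter_topology (P - U)"
    using op closedin_diff[OF closedin_topspace[of filter_topology] op] by (simp add: topspace_filter_topology)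
  have local: "\<exists>a\<in>d x. \<phi> a \<subseteq> U" if x: "x \<in> U" for x
  proof -
    have xP: "x \<in> P" using x UP by blast
    have "\<not> (\<exists>y. \<forall>C\<in>insert (P - U) (\<phi> ` d x). y \<in> C)"
    proof
      assume "\<exists>y. \<forall>C\<in>insert (P - U) (\<phi> ` d x). y \<in> C"
      then obtain y where y: "y \<in> P - U" "\<forall>a\<in>d x. y \<in> \<phi> a" by auto
      then have "d x \<subseteq> d y" by (auto simp: \<phi>_def)
      then show False using up[OF x] y(1) by blast
    qed
    moreover have "closedin filter_topology C" if "C \<in> insert (P - U) (\<phi> ` d x)" for C
      using that clc phi_closed by auto
    ultimately obtain \<F>
      where \<F>: "finite \<F>" "\<F> \<subseteq> insert (P - U) (\<phi> ` d x)" "\<not> (\<exists>y. \<forall>C\<in>\<F>. y \<in> C)"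
      using compact_space_no_common_point[OF compact_filter_topology, of "insert (P - U) (\<phi> ` d x)"] by blast
    then have "finite (\<F> - {P - U})" "\<F> - {P - U} \<subseteq> \<phi> ` d x" by auto
    from finite_subset_image[OF this]
    obtain B where B: "B \<subseteq> d x" "finite B" "\<F> - {P - U} = \<phi> ` B" by (elim exE conjE)
    obtain z where z: "z \<in> d x" "\<forall>b\<in>B. z \<sqsubseteq>\<^bsub>M\<^esub> b"
      using meet_filter_lower_bound[OF semilattice filter[OF xP] B(2,1)] by blast
    have "\<phi> z \<subseteq> U"
    proof
      fix y assume y: "y \<in> \<phi> z"
      have c: "c \<in> carrier M" if "c \<in> d x" for c using meet_filter_carrier[OF filter[OF xP] that] .
      have "y \<in> \<phi> b" if b: "b \<in> B" for b
      proof -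
        have "\<phi> z \<subseteq> \<phi> b" using phi_order[OF c[OF z(1)] c, of b] z(2) B(1) b by blast
        then show ?thesis using y by blast
      qed
      then have "\<forall>C\<in>\<F> - {P - U}. y \<in> C" unfolding B(3) by simp
      then have "y \<notin> P - U" using \<F>(3) by blast
      then show "y \<in> U" using y by (simp add: \<phi>_def)
    qed
    then show ?thesis using z(1) by blast
  qed
  let ?S = "{a \<in> carrier M. \<phi> a \<subseteq> U}"
  let ?\<C> = "insert U ((\<lambda>a. P - \<phi> a) ` ?S)"
  have "\<not> (\<exists>y. \<forall>C\<in>?\<C>. y \<in> C)"
  proof
    assume "\<exists>y. \<forall>C\<in>?\<C>. y \<in> C"
    then obtain y where y: "y \<in> U" "\<forall>a\<in>?S. y \<in> P - \<phi> a" by auto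
    then obtain a where a: "a \<in> d y" "\<phi> a \<subseteq> U" using local by blast
    have yP: "y \<in> P" using y(1) UP by blast
    then have "a \<in> ?S" using meet_filter_carrier[OF filter[OF yP] a(1)] a(2) by simp
    then have "y \<notin> \<phi> a" using y(2) by blast
    then show False using a(1) yP by (simp add: \<phi>_def)
  qed
  moreover have "closedin filter_topology C" if "C \<in> ?\<C>" for C
    using that cl phi_open closedin_diff[OF closedin_topspace[of filter_topology] phi_open]
    by (auto simp: topspace_filter_topology)
  ultimately obtain \<F> where \<F>: "finite \<F>" "\<F> \<subseteq> ?\<C>" "\<not> (\<exists>y. \<forall>C\<in>\<F>. y \<in> C)"
    using compact_space_no_common_point[OF compact_filter_topology, of ?\<C>] by blast
  then have "finite (\<F> - {U})" "\<F> - {U} \<subseteq> (\<lambda>a. P - \<phi> a) ` ?S" by auto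
  from finite_subset_image[OF this]
  obtain S where S: "S \<subseteq> ?S" "finite S" "\<F> - {U} = (\<lambda>a. P - \<phi> a) ` S" by (elim exE conjE)
  have cover: "U \<subseteq> \<Union>(\<phi> ` S)"
  proof
    fix y assume y: "y \<in> U"
    show "y \<in> \<Union>(\<phi> ` S)"
    proof (rule ccontr)
      assume "y \<notin> \<Union>(\<phi> ` S)"
      then have "\<forall>C\<in>\<F> - {U}. y \<in> C" unfolding S(3) using y UP by auto
      then have "\<forall>C\<in>\<F>. y \<in> C" using y by auto
      then show False using \<F>(3) by blast
    qed
  qed
  show ?thesis
  proof (rule that[OF S(2)])
    show "S \<noteq> {}" using cover ne by auto
    show "S \<subseteq> carrier M" using S(1) by blast
    show "U = \<Union>(\<phi> ` S)" using cover S(1) by blast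
  qed
qed

text \<open>
  A maximal point outside \<open>\<phi> a\<close> is a filter maximal among the optimal ones avoiding \<open>a\<close>, hence prime by
  the prime filter theorem; so \<open>\<phi> a\<close> is admissible. Conversely let \<open>U = \<Union>(\<phi> ` S)\<close> be admissible. A point
  outside \<open>U\<close> lies below a maximal such point \<open>z\<close>, which is prime, so \<open>S\<close> has an upper bound \<open>c\<close> outside
  \<open>d z\<close>, and \<open>\<phi> c\<close> contains \<open>U\<close> and avoids the given point. By compactness \<open>U\<close> is the intersection of
  finitely many such \<open>\<phi> c\<close>, which is \<open>\<phi>\<close> of their meet.
\<close>

lemma admissible_space: "admissible space = \<phi> ` carrier M"
proof
  show "\<phi> ` carrier M \<subseteq> admissible space"
  proof
    fix U assume "U \<in> \<phi> ` carrier M"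
    then obtain a where a: "a \<in> carrier M" "U = \<phi> a" by blast
    have "prime_filter M (d x)" if x: "x \<in> P - \<phi> a" "\<forall>y\<in>P - \<phi> a. d x \<subseteq> d y \<longrightarrow> y = x" for x
    proof -
      have xP: "x \<in> P" "a \<notin> d x" using x(1) by (auto simp: \<phi>_def)
      then obtain G where G: "prime_filter M G" "d x \<subseteq> G" "a \<notin> G"
        using prime_filter_extension[OF distributive filter[OF xP(1)] a(1)] by blast
      have "code G \<in> P - \<phi> a" "d x \<subseteq> d (code G)" using prime_code[OF G(1)] G by (simp_all add: \<phi>_def)
      then have "code G = x" using x(2) by blast
      then show ?thesis using prime_code(2)[OF G(1)] G(1) by simp
    qed
    then show "U \<in> admissible space"
      using phi_clopen_upset a(2) by (auto simp: admissible_def maximal_points_def)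
  qed
  show "admissible space \<subseteq> \<phi> ` carrier M"
  proof
    fix U assume "U \<in> admissible space"
    then have U: "clopen_upset space U" and max: "maximal_points (ordr space) (P - U) \<subseteq> {p \<in> P. prime_filter M (d p)}"
      by (simp_all add: admissible_def)
    have UP: "U \<subseteq> P" using clopen_upset_subset[OF U] by simp
    have "code (carrier M) \<in> U"
    proof (rule ccontr)
      assume not: "code (carrier M) \<notin> U"
      have top_max: "y = code (carrier M)" if "y \<in> P" "carrier M \<subseteq> d y" for y
      proof -
        have "d y \<subseteq> carrier M" using filter[OF that(1)] by (simp add: meet_filter_def)
        then show ?thesis using inj_onD[OF inj, of y "code (carrier M)"] that point_top by simp
      qed
      have "code (carrier M) \<in> maximal_points (ordr space) (P - U)"
        unfolding maximal_points_def space_simps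
      proof (intro CollectI conjI ballI impI)
        show "code (carrier M) \<in> P - U" using not point_top(1) by simp
        fix y assume "y \<in> P - U" "d (code (carrier M)) \<subseteq> d y"
        then show "y = code (carrier M)" using top_max[of y] point_top(2) by simp
      qed
      then have "prime_filter M (d (code (carrier M)))" using max by blast
      then show False using point_top by (simp add: prime_filter_def)
    qed
    then obtain S where S: "finite S" "S \<noteq> {}" "S \<subseteq> carrier M" "U = \<Union>(\<phi> ` S)"
      using clopen_upset_Union[OF U] by blast
    have clc: "closedin filter_topology (P - U)"
      using U closedin_diff[OF closedin_topspace[of filter_topology], of U]
      by (simp add: topspace_filter_topology clopen_upset_def)
    let ?T = "{c \<in> carrier M. U \<subseteq> \<phi> c}"
    have "\<not> (\<exists>y. \<forall>C\<in>insert (P - U) (\<phi> ` ?T). y \<in> C)"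
    proof
      assume "\<exists>y. \<forall>C\<in>insert (P - U) (\<phi> ` ?T). y \<in> C"
      then obtain y where y: "y \<in> P - U" "\<forall>c\<in>?T. y \<in> \<phi> c" by auto
      obtain z where z: "z \<in> maximal_points (ordr space) (P - U)" "d y \<subseteq> d z"
        using priestley_below_maximal[OF priestley, of "P - U" y] clc y(1) by auto
      have zP: "z \<in> P - U" using z(1) by (simp add: maximal_points_def)
      have zp: "prime_filter M (d z)" using z(1) max by blast
      have "S \<subseteq> carrier M - d z" using S(3,4) zP by (auto simp: \<phi>_def)
      then obtain c where c: "c \<in> carrier M - d z" "\<forall>s\<in>S. s \<sqsubseteq>\<^bsub>M\<^esub> c"
        using prime_filter_bound[OF zp S(1,2) _ po] by blast
      have cc: "c \<in> carrier M" using c(1) by simp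
      have "\<phi> s \<subseteq> \<phi> c" if "s \<in> S" for s
        using phi_order[OF subsetD[OF S(3) that] cc] c(2) that by simp
      then have "c \<in> ?T" using cc S(4) by auto
      then have "y \<in> \<phi> c" using y(2) by simp
      then have "c \<in> d z" using z(2) by (auto simp: \<phi>_def)
      then show False using c(1) by simp
    qed
    moreover have "closedin filter_topology C" if "C \<in> insert (P - U) (\<phi> ` ?T)" for C
      using that clc phi_closed by auto
    ultimately obtain \<F>
      where \<F>: "finite \<F>" "\<F> \<subseteq> insert (P - U) (\<phi> ` ?T)" "\<not> (\<exists>y. \<forall>C\<in>\<F>. y \<in> C)"
      using compact_space_no_common_point[OF compact_filter_topology, of "insert (P - U) (\<phi> ` ?T)"] by blast
    then have "finite (\<F> - {P - U})" "\<F> - {P - U} \<subseteq> \<phi> ` ?T" by auto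
    from finite_subset_image[OF this]
    obtain C where C: "C \<subseteq> ?T" "finite C" "\<F> - {P - U} = \<phi> ` C" by (elim exE conjE)
    have Cc: "C \<subseteq> carrier M" using C(1) by blast
    have "y \<in> U" if "y \<in> P" "y \<in> (\<Inter>c\<in>C. \<phi> c)" for y
    proof (rule ccontr)
      assume "y \<notin> U"
      moreover have "\<forall>D\<in>\<F> - {P - U}. y \<in> D" unfolding C(3) using that(2) by simp
      ultimately show False using \<F>(3) that(1) by blast
    qed
    moreover have "U \<subseteq> P \<inter> (\<Inter>c\<in>C. \<phi> c)" using UP C(1) by auto
    ultimately have "U = \<phi> (\<Sqinter>\<^bsub>M\<^esub> C)" unfolding phi_inf[OF Cc C(2)] by blast
    then show "U \<in> \<phi> ` carrier M" using semilattice_inf_closed[OF semilattice Cc C(2)] by blast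
  qed
qed

text \<open>
  A basic neighbourhood of \<open>x\<close> requires finitely many elements to be in the filter, all above some
  \<open>b \<in> d x\<close>, and finitely many to be outside. As \<open>d x\<close> is proper, the second set may be assumed nonempty. Since
  \<open>d x\<close> is optimal, it has an upper bound \<open>u\<close> that is not above \<open>b\<close>, and a prime filter containing \<open>b\<close> but not
  \<open>u\<close> lies in the neighbourhood.
\<close>

lemma prime_points_dense:
  assumes x: "x \<in> P" "x \<noteq> code (carrier M)" and W: "openin filter_topology W" "x \<in> W"
  shows "\<exists>p\<in>W. prime_filter M (d p)"
proof -
  note f = filter[OF x(1)]
  from bspec[OF conjunct2[OF W(1)[unfolded openin_filter_topology]] W(2)]
  obtain J where J: "finite J" and J': "\<forall>q\<in>P. (\<forall>j\<in>J. j \<in> d q \<longleftrightarrow> j \<in> d x) \<longrightarrow> q \<in> W"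
    by (elim exE conjE)
  have "d x \<noteq> carrier M" using inj_onD[OF inj _ x(1) point_top(1)] x(2) point_top(2) by auto
  then obtain e where e: "e \<in> carrier M - d x" using f unfolding meet_filter_def by blast
  \<comment> \<open>The element \<open>e\<close> keeps \<open>?S\<close> nonempty, as optimality requires.\<close>
  let ?S = "insert e (J \<inter> carrier M - d x)"
  have JF: "finite (J \<inter> d x)" "J \<inter> d x \<subseteq> d x" using J by auto
  obtain b where b: "b \<in> d x" "\<forall>j\<in>J \<inter> d x. b \<sqsubseteq>\<^bsub>M\<^esub> j"
    using meet_filter_lower_bound[OF semilattice f JF] by blast
  have S: "finite ?S" "?S \<noteq> {}" "?S \<subseteq> carrier M - d x" using J e by auto
  obtain u where u: "u \<in> carrier M" "\<And>s. s \<in> ?S \<Longrightarrow> s \<sqsubseteq>\<^bsub>M\<^esub> u" "\<not> b \<sqsubseteq>\<^bsub>M\<^esub> u"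
    using optimal_filter_bound[OF optimal[OF x(1)] S b(1)] by blast
  obtain G where G: "prime_filter M G" "b \<in> G" "u \<notin> G"
    using prime_filter_separates[OF distributive meet_filter_carrier[OF f b(1)] u(1,3)] by blast
  have Gf: "meet_filter M G" using G(1) by (simp add: prime_filter_def)
  have "j \<in> G \<longleftrightarrow> j \<in> d x" if j: "j \<in> J" for j
  proof (cases "j \<in> d x")
    case True
    then show ?thesis using meet_filter_up[OF Gf G(2) meet_filter_carrier[OF f True]] b(2) j by simp
  next
    case False
    have "j \<notin> G"
    proof
      assume jG: "j \<in> G"
      then have "j \<in> ?S" using meet_filter_carrier[OF Gf jG] j False by simp
      then show False using meet_filter_up[OF Gf jG u(1) u(2)] G(3) by simp
    qed
    then show ?thesis using False by simp
  qed
  then have "code G \<in> W" using bspec[OF J' prime_code(1)[OF G(1)]] prime_code(2)[OF G(1)] by simp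
  then show ?thesis using prime_code(2)[OF G(1)] G(1) by (intro bexI[of _ "code G"]) simp_all
qed

lemma pgps_space: "pgps space"
proof -
  have sub: "d p \<subseteq> carrier M" if "p \<in> P" for p using filter[OF that] by (simp add: meet_filter_def)
  have top_notprime: "\<not> prime_filter M (d (code (carrier M)))"
    unfolding point_top(2) by (simp add: prime_filter_def)
  have 1: "greatest (ordr space) (code (carrier M)) P"
    using point_top sub by (simp add: greatest_def)
  let ?Y = "subtopology filter_topology (P - {code (carrier M)})"
  have "x \<in> ?Y closure_of {p \<in> P. prime_filter M (d p)}" if x: "x \<in> P - {code (carrier M)}" for x
    unfolding in_closure_of
  proof (intro conjI allI impI)
    show "x \<in> topspace ?Y" using x by (simp add: topspace_filter_topology)
    fix T assume T: "x \<in> T \<and> openin ?Y T"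
    then obtain W where W: "openin filter_topology W" "T = W \<inter> (P - {code (carrier M)})"
      unfolding openin_subtopology by blast
    then obtain p where p: "p \<in> W" "prime_filter M (d p)"
      using prime_points_dense[of x W] x T by blast
    have "p \<in> P" using openin_subset[OF W(1)] p(1) by (auto simp: topspace_filter_topology)
    moreover have "p \<noteq> code (carrier M)" using p(2) top_notprime by auto
    ultimately show "\<exists>y. y \<in> {p \<in> P. prime_filter M (d p)} \<and> y \<in> T" using p W(2) by blast
  qed
  moreover have "?Y closure_of {p \<in> P. prime_filter M (d p)} \<subseteq> P - {code (carrier M)}"
    using closure_of_subset_topspace[of ?Y] by (auto simp: topspace_filter_topology)
  ultimately have 2: "?Y closure_of {p \<in> P. prime_filter M (d p)} = P - {code (carrier M)}" by blast
  have 3: "\<exists>y\<in>{p \<in> P. prime_filter M (d p)}. d x \<subseteq> d y" if x: "x \<in> P" "x \<noteq> code (carrier M)" for x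
  proof -
    have "d x \<noteq> carrier M" using inj_onD[OF inj _ x(1) point_top(1)] x(2) point_top(2) by auto
    then obtain a where a: "a \<in> carrier M" "a \<notin> d x" using sub[OF x(1)] by blast
    obtain G where "prime_filter M G" "d x \<subseteq> G" "a \<notin> G"
      using prime_filter_extension[OF distributive filter[OF x(1)] a] .
    then show ?thesis using prime_code by (intro bexI[of _ "code G"]) simp_all
  qed
  have avoid: "admissible_avoiding space x = \<phi> ` (carrier M - d x)" if "x \<in> P" for x
    unfolding admissible_avoiding_def admissible_space using that by (auto simp: \<phi>_def)
  have 4: "prime_filter M (d x) \<longleftrightarrow>
      admissible_avoiding space x \<noteq> {} \<and> directed_by_inclusion (admissible_avoiding space x)" if x: "x \<in> P" for x
  proof -
    have "directed_by_inclusion (\<phi> ` (carrier M - d x)) \<longleftrightarrow>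
        (\<forall>a\<in>carrier M - d x. \<forall>b\<in>carrier M - d x. \<exists>c\<in>carrier M - d x. a \<sqsubseteq>\<^bsub>M\<^esub> c \<and> b \<sqsubseteq>\<^bsub>M\<^esub> c)"
      unfolding directed_by_inclusion_def ball_simps bex_simps
      by (intro ball_cong bex_cong arg_cong2[where f = "(\<and>)"] refl phi_order) simp_all
    moreover have "\<phi> ` (carrier M - d x) \<noteq> {} \<longleftrightarrow> d x \<noteq> carrier M" using sub[OF x] by blast
    ultimately show ?thesis
      unfolding avoid[OF x] prime_filter_def using filter[OF x] by blast
  qed
  have 5: "d x \<subseteq> d y \<longleftrightarrow> (\<forall>U\<in>admissible space. x \<in> U \<longrightarrow> y \<in> U)" if "x \<in> P" "y \<in> P" for x y
    unfolding admissible_space using that sub[OF that(1)] by (auto simp: \<phi>_def)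
  show ?thesis
    unfolding pgps_def space_simps topspace_filter_topology
  proof (intro conjI ballI impI)
    show "{p \<in> P. prime_filter M (d p)} \<subseteq> P - {code (carrier M)}" using top_notprime by auto
    fix x assume x: "x \<in> P"
    show "x \<in> {p \<in> P. prime_filter M (d p)} \<longleftrightarrow>
        admissible_avoiding space x \<noteq> {} \<and> directed_by_inclusion (admissible_avoiding space x)"
      using 4[OF x] x by simp
  qed (fact priestley 1 2 3 5)+
qed

end

lemma admissible_order_essentially_surjective:
  assumes M: "M \<in> Obj (DMS_FSup :: 'u order_cat)"
  shows "\<exists>X\<in>Obj (PGPS_S :: 'u space_cat). \<exists>e. iso_in DMS_FSup M (admissible_order X) e"
proof -
  have dM: "distributive_semilattice M" and sM: "small TYPE('u) (carrier M)" using M by (simp_all add: Obj_DMS)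
  have "{F. optimal_filter M F} \<subseteq> Pow (carrier M)" by (auto simp: optimal_filter_def meet_filter_def)
  from small_subset_Pow[OF sM this]
  obtain P :: "'u set" and d where Pd: "bij_betw d P {F. optimal_filter M F}" by (rule lepoll_bij_betw)
  interpret spectrum M P d using dM Pd by unfold_locales
  have "admissible space \<lesssim> carrier M" unfolding admissible_space by (rule image_lepoll)
  then have "small TYPE('u) (admissible space)" by (rule small_lepoll[OF sM])
  then interpret X: small_pgps space using pgps_space by unfold_locales
  have A: "\<phi> a \<in> admissible space" if "a \<in> carrier M" for a using that by (simp add: admissible_space)
  have ord: "enc space (\<phi> a) \<sqsubseteq>\<^bsub>X.M\<^esub> enc space (\<phi> b) \<longleftrightarrow> a \<sqsubseteq>\<^bsub>M\<^esub> b" if "a \<in> carrier M" "b \<in> carrier M" for a b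
    using that by (simp add: X.dec_enc A phi_order)
  have "a = b" if "a \<in> carrier M" "b \<in> carrier M" "enc space (\<phi> a) = enc space (\<phi> b)" for a b
    using ord[OF that(1,2)] ord[OF that(2,1)] that(3) partial_order_antisym[OF po that(1,2)] by simp
  then have "bij_betw (\<lambda>a. enc space (\<phi> a)) (carrier M) (carrier X.M)"
    by (intro bij_betw_imageI inj_onI) (auto simp: X.carrier_M admissible_space)
  then have "\<exists>e. iso_in DMS_FSup M X.M e" using iso_in_DMS[OF M X.Obj_M _ ord] by blast
  then show ?thesis using X.small_pgps_axioms by (auto simp: Obj_PGPS)
qed

section \<open>The equivalences of categories\<close>

lemma iso_in_id: "category C \<Longrightarrow> X \<in> Obj C \<Longrightarrow> iso_in C X X (Id C X)"
  using category_id[of C X] category_unit[of C X X "Id C X"] by (auto simp: iso_in_def)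

lemma Obj_compact_dual: "L \<in> Obj (AlgFrm_FInf :: 'u order_cat) \<Longrightarrow> compact_dual L \<in> Obj DMS_FSup"
  using compact_dual_distributive by (auto simp: Obj_AlgFrm Obj_DMS)

text \<open>
  The family \<open>KD\<close> of semilattice maps is kept general in order to treat all maps and bounded maps together.
\<close>

theorem equivalent_AlgFrm_DMS:
  fixes K KD :: "'u gorder \<Rightarrow> 'u gorder \<Rightarrow> ('u \<Rightarrow> 'u) set"
  assumes stable: "iso_stable DMS_FSup KD"
    and KD: "\<And>M N. \<lbrakk>M \<in> Obj DMS_FSup; N \<in> Obj DMS_FSup\<rbrakk> \<Longrightarrow> KD M N \<subseteq> FSup_hom M N"
    and K: "\<And>L M. \<lbrakk>L \<in> Obj AlgFrm_FInf; M \<in> Obj AlgFrm_FInf\<rbrakk> \<Longrightarrow> K L M =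
      {f \<in> FInf_hom L M. restrict f (compact_elements L) \<in> KD (compact_dual L) (compact_dual M)}"
  shows "equivalent (AlgFrm_FInf\<lparr>Hom := K\<rparr>) (DMS_FSup\<lparr>Hom := KD\<rparr>)"
proof (rule equivalent_of_cospan[OF category_AlgFrm category_DMS category_DMS fully_faithful_compact_dual
      fully_faithful_id[OF category_DMS] _ _ stable])
  show "\<forall>L\<in>Obj AlgFrm_FInf. \<exists>M\<in>Obj DMS_FSup. \<exists>e. iso_in DMS_FSup (compact_dual L) (M :: 'u gorder) e"
    using Obj_compact_dual iso_in_id[OF category_DMS] by blast
  show "\<forall>M\<in>Obj DMS_FSup. \<exists>L\<in>Obj AlgFrm_FInf. \<exists>e. iso_in DMS_FSup (compact_dual L) (M :: 'u gorder) e"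
    using compact_dual_essentially_surjective by blast
  show "K L M = {f \<in> Hom AlgFrm_FInf L M. restrict f (compact_elements L) \<in> KD (compact_dual L) (compact_dual M)}"
    if "L \<in> Obj AlgFrm_FInf" "M \<in> Obj AlgFrm_FInf" for L M
    using K[OF that] by (simp add: Hom_AlgFrm)
  show "KD M N = {f \<in> Hom DMS_FSup M N. f \<in> KD M N}" if "M \<in> Obj DMS_FSup" "N \<in> Obj DMS_FSup" for M N
    using KD[OF that] by (auto simp: Hom_DMS)
qed

theorem dually_equivalent_AlgFrm_PGPS:
  fixes K KD :: "'u gorder \<Rightarrow> 'u gorder \<Rightarrow> ('u \<Rightarrow> 'u) set" and K' :: "'u pspace \<Rightarrow> 'u pspace \<Rightarrow> ('u \<Rightarrow> 'u) set"
  assumes stable: "iso_stable DMS_FSup KD"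
    and K: "\<And>L M. \<lbrakk>L \<in> Obj AlgFrm_FInf; M \<in> Obj AlgFrm_FInf\<rbrakk> \<Longrightarrow> K L M =
      {f \<in> FInf_hom L M. restrict f (compact_elements L) \<in> KD (compact_dual L) (compact_dual M)}"
    and K': "\<And>X Y. \<lbrakk>X \<in> Obj PGPS_S; Y \<in> Obj PGPS_S\<rbrakk> \<Longrightarrow> K' X Y =
      {f \<in> strong_hom X Y. inverse_image X Y f \<in> KD (admissible_order Y) (admissible_order X)}"
  shows "dually_equivalent (AlgFrm_FInf\<lparr>Hom := K\<rparr>) (PGPS_S\<lparr>Hom := K'\<rparr>)"
proof -
  have "equivalent ((op_cat AlgFrm_FInf)\<lparr>Hom := \<lambda>L M. K M L\<rparr>) (PGPS_S\<lparr>Hom := K'\<rparr>)"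
  proof (rule equivalent_of_cospan[OF category_op[OF category_AlgFrm] category_PGPS category_op[OF category_DMS]
        fully_faithful_op[OF fully_faithful_compact_dual] fully_faithful_admissible _ _ iso_stable_op[OF stable]])
    show "\<forall>L\<in>Obj (op_cat AlgFrm_FInf). \<exists>X\<in>Obj PGPS_S. \<exists>e.
        iso_in (op_cat DMS_FSup) (compact_dual L) (admissible_order (X :: 'u pspace)) e"
    proof
      fix L :: "'u gorder" assume "L \<in> Obj (op_cat AlgFrm_FInf)"
      then have "compact_dual L \<in> Obj DMS_FSup" using Obj_compact_dual by (simp add: op_cat_def)
      then obtain X e where X: "X \<in> Obj PGPS_S" and e: "iso_in DMS_FSup (compact_dual L) (admissible_order X) e"
        using admissible_order_essentially_surjective by blast
      obtain g where "iso_in DMS_FSup (admissible_order X) (compact_dual L) g" using iso_in_sym[OF e] .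
      then show "\<exists>X\<in>Obj PGPS_S. \<exists>e. iso_in (op_cat DMS_FSup) (compact_dual L) (admissible_order (X :: 'u pspace)) e"
        unfolding iso_in_op using X by blast
    qed
    show "\<forall>X\<in>Obj PGPS_S. \<exists>L\<in>Obj (op_cat AlgFrm_FInf). \<exists>e.
        iso_in (op_cat DMS_FSup) (compact_dual L) (admissible_order (X :: 'u pspace)) e"
    proof
      fix X :: "'u pspace" assume "X \<in> Obj PGPS_S"
      then have "admissible_order X \<in> Obj DMS_FSup" by (simp add: Obj_PGPS small_pgps.Obj_M)
      then obtain L e where L: "L \<in> Obj AlgFrm_FInf" and e: "iso_in DMS_FSup (compact_dual L) (admissible_order X) e"
        using compact_dual_essentially_surjective by blast
      obtain g where "iso_in DMS_FSup (admissible_order X) (compact_dual L) g" using iso_in_sym[OF e] .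
      moreover have "L \<in> Obj (op_cat AlgFrm_FInf)" using L by (simp add: op_cat_def)
      ultimately show "\<exists>L\<in>Obj (op_cat AlgFrm_FInf). \<exists>e. iso_in (op_cat DMS_FSup) (compact_dual L) (admissible_order X) e"
        unfolding iso_in_op by blast
    qed
    show "K M L = {f \<in> Hom (op_cat AlgFrm_FInf) L M.
        restrict f (compact_elements M) \<in> KD (compact_dual M) (compact_dual L)}"
      if "L \<in> Obj (op_cat AlgFrm_FInf)" "M \<in> Obj (op_cat AlgFrm_FInf)" for L M
      using K[of M L] that by (simp add: op_cat_def Hom_AlgFrm)
    show "K' X Y = {f \<in> Hom PGPS_S X Y. inverse_image X Y f \<in> KD (admissible_order Y) (admissible_order X)}"
      if "X \<in> Obj PGPS_S" "Y \<in> Obj PGPS_S" for X Y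
      using K'[OF that] by (simp add: Hom_PGPS)
  qed
  then show ?thesis by (simp add: dually_equivalent_def op_cat_def)
qed

lemma AlgFrm_FInfB_eq: "AlgFrm_FInfB = AlgFrm_FInf\<lparr>Hom := FInfB_hom\<rparr>"
  and DMS_FSupB_eq: "DMS_FSupB = DMS_FSup\<lparr>Hom := FSupB_hom\<rparr>"
  and PGPS_ST_eq: "PGPS_ST = PGPS_S\<lparr>Hom := strong_top_hom\<rparr>"
  by (simp_all add: AlgFrm_FInfB_def AlgFrm_FInf_def DMS_FSupB_def DMS_FSup_def PGPS_ST_def PGPS_S_def
      concrete_cat_def)

lemma precategory_AlgFrm_FInfB: "precategory AlgFrm_FInfB"
  unfolding AlgFrm_FInfB_def
proof (rule precategory_concrete)
  show "FInfB_hom L M \<subseteq> carrier L \<rightarrow>\<^sub>E carrier M" for L M :: "'u gorder"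
    by (rule subset_trans[OF _ FInf_hom_funcset]) (auto simp: FInfB_hom_def)
  fix L :: "'u gorder" assume L: "L \<in> {L. algebraic_frame L \<and> small TYPE('u) (compact_elements L)}"
  have "\<top>\<^bsub>L\<^esub> \<in> carrier L" if "compact_frame L"
    using that subsetD[OF compact_elements_subset[of L]] by (simp add: compact_frame_def)
  then show "(\<lambda>x\<in>carrier L. x) \<in> FInfB_hom L L" using FInf_hom_id[of L] L by (simp add: FInfB_hom_def)
qed

lemma precategory_DMS_FSupB: "precategory DMS_FSupB"
  unfolding DMS_FSupB_def
proof (rule precategory_concrete)
  show "FSupB_hom M N \<subseteq> carrier M \<rightarrow>\<^sub>E carrier N" for M N :: "'u gorder"
    by (rule subset_trans[OF _ FSup_hom_funcset]) (auto simp: FSupB_hom_def)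
  fix M :: "'u gorder" assume "M \<in> {M. distributive_semilattice M \<and> small TYPE('u) (carrier M)}"
  then have sl: "meet_semilattice M" by (simp add: distributive_semilattice_def)
  have "z = w" if "least M z (carrier M)" "least M w (carrier M)" for z w
    using partial_order.least_unique[OF semilattice_partial_order[OF sl] that] .
  then show "(\<lambda>x\<in>carrier M. x) \<in> FSupB_hom M M"
    unfolding FSupB_hom_iff[OF sl sl] using FSup_hom_id[OF sl] by (auto simp: least_iff)
qed

lemma precategory_PGPS_ST: "precategory PGPS_ST"
  unfolding PGPS_ST_def
proof (rule precategory_concrete)
  show "strong_top_hom X Y \<subseteq> points X \<rightarrow>\<^sub>E points Y" for X Y :: "'u pspace"
    by (rule subset_trans[OF _ strong_hom_funcset]) (auto simp: strong_top_hom_def)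
  show "(\<lambda>x\<in>points X. x) \<in> strong_top_hom X X" for X :: "'u pspace"
    using strong_hom_id[of X] by (auto simp: strong_top_hom_def)
qed

theorem corollary5p14:
  shows "(category (AlgFrm_FInf :: 'u order_cat) \<and>
          category (DMS_FSup :: 'u order_cat) \<and>
          category (PGPS_S :: 'u space_cat) \<and>
          equivalent (AlgFrm_FInf :: 'u order_cat) (DMS_FSup :: 'u order_cat) \<and>
          dually_equivalent (AlgFrm_FInf :: 'u order_cat) (PGPS_S :: 'u space_cat)) \<and>
         (precategory (AlgFrm_FInfB :: 'u order_cat) \<and>
          precategory (DMS_FSupB :: 'u order_cat) \<and>
          precategory (PGPS_ST :: 'u space_cat) \<and>
          equivalent (AlgFrm_FInfB :: 'u order_cat) (DMS_FSupB :: 'u order_cat) \<and>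
          dually_equivalent (AlgFrm_FInfB :: 'u order_cat) (PGPS_ST :: 'u space_cat))"
proof -
  have stable: "iso_stable DMS_FSup (FSup_hom :: 'u gorder \<Rightarrow> 'u gorder \<Rightarrow> _)"
    using iso_stable_Hom[OF category_DMS] by (simp add: Hom_DMS)
  have FInf: "FInf_hom L M =
      {f \<in> FInf_hom L M. restrict f (compact_elements L) \<in> FSup_hom (compact_dual L) (compact_dual M)}"
    if "L \<in> Obj AlgFrm_FInf" "M \<in> Obj AlgFrm_FInf" for L M :: "'u gorder"
    using FInf_hom_restrict that by (auto simp: Obj_AlgFrm)
  have FInfB: "FInfB_hom L M =
      {f \<in> FInf_hom L M. restrict f (compact_elements L) \<in> FSupB_hom (compact_dual L) (compact_dual M)}"
    if "L \<in> Obj AlgFrm_FInf" "M \<in> Obj AlgFrm_FInf" for L M :: "'u gorder"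
    using FInfB_hom_iff that by (auto simp: Obj_AlgFrm)
  have strong: "strong_hom X Y =
      {f \<in> strong_hom X Y. inverse_image X Y f \<in> FSup_hom (admissible_order Y) (admissible_order X)}"
    if "X \<in> Obj PGPS_S" "Y \<in> Obj PGPS_S" for X Y :: "'u pspace"
    using small_pgps_pair.inverse_image_FSup that by (auto simp: Obj_PGPS small_pgps_pair_def)
  have strong_top: "strong_top_hom X Y =
      {f \<in> strong_hom X Y. inverse_image X Y f \<in> FSupB_hom (admissible_order Y) (admissible_order X)}"
    if "X \<in> Obj PGPS_S" "Y \<in> Obj PGPS_S" for X Y :: "'u pspace"
    using small_pgps_pair.strong_top_hom_iff that by (auto simp: Obj_PGPS small_pgps_pair_def)
  have FSupB: "FSupB_hom M N \<subseteq> FSup_hom M N" for M N :: "'u gorder" by (auto simp: FSupB_hom_def)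
  have all_maps: "AlgFrm_FInf\<lparr>Hom := FInf_hom\<rparr> = (AlgFrm_FInf :: 'u order_cat)"
    "DMS_FSup\<lparr>Hom := FSup_hom\<rparr> = (DMS_FSup :: 'u order_cat)"
    "PGPS_S\<lparr>Hom := strong_hom\<rparr> = (PGPS_S :: 'u space_cat)"
    by (simp_all add: AlgFrm_FInf_def DMS_FSup_def PGPS_S_def concrete_cat_def)
  have "equivalent (AlgFrm_FInf :: 'u order_cat) (DMS_FSup :: 'u order_cat)"
    using equivalent_AlgFrm_DMS[OF stable subset_refl FInf] by (simp add: all_maps)
  moreover have "dually_equivalent (AlgFrm_FInf :: 'u order_cat) (PGPS_S :: 'u space_cat)"
    using dually_equivalent_AlgFrm_PGPS[OF stable FInf strong] by (simp add: all_maps)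
  moreover have "equivalent (AlgFrm_FInfB :: 'u order_cat) (DMS_FSupB :: 'u order_cat)"
    unfolding AlgFrm_FInfB_eq DMS_FSupB_eq by (rule equivalent_AlgFrm_DMS[OF iso_stable_FSupB FSupB FInfB])
  moreover have "dually_equivalent (AlgFrm_FInfB :: 'u order_cat) (PGPS_ST :: 'u space_cat)"
    unfolding AlgFrm_FInfB_eq PGPS_ST_eq
    by (rule dually_equivalent_AlgFrm_PGPS[OF iso_stable_FSupB FInfB strong_top])
  ultimately show ?thesis
    using category_AlgFrm category_DMS category_PGPS precategory_AlgFrm_FInfB precategory_DMS_FSupB
      precategory_PGPS_ST by blast
qed

end
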